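(* The covers of $\mathbb{V}(C_4)$ within $\mathsf{M}$ (i.e., in the lattice of subvarieties of $\mathsf{M}$) are just $\mathbb{V}(G_1)$, $\mathbb{V}(G_2)$, $\mathbb{V}(G_3)$, $\mathbb{V}(G_4)$, $\mathbb{V}(G_5)$ and $\mathbb{V}(G_6)$, where $G_1=\mathrm{R}(\mathbf{2}^+)$, $G_2=\mathrm{R}(S_3^+)$, $G_3=\mathrm{S}^{\leqslant}(S_3^+)$, $G_4=\mathrm{S}^{\leqslant}(C_4^+)$, $G_5=\mathrm{S}^{\leqslant}(T_5)$ and $G_6=\mathrm{S}^{\leqslant}(T_6)$ are the (skew) reflections specified in the context.
   Context: A residuated lattice (RL) is an algebra $\langle B;\cdot,\to,\wedge,\vee,e\rangle$ where $\langle B;\cdot,e\rangle$ is a commutative monoid, $\langle B;\wedge,\vee\rangle$ is a lattice and $x\cdot y\leqslant z$ iff $y\leqslant x\to z$. An involutive residuated lattice (IRL) is an algebra $\langle A;\cdot,\wedge,\vee,\neg,e\rangle$ where $\langle A;\cdot,e\rangle$ is a commutative monoid, $\langle A;\wedge,\vee\rangle$ is a lattice, and $\neg\neg x=x$ and ($x\cdot y\leqslant z$ iff $\neg z\cdot y\leqslant\neg x$); put $f:=\neg e$, $x\to y:=\neg(x\cdot\neg y)$, $x^2:=x\cdot x$. An RL or IRL is square-increasing if $x\leqslant x^2$. An IRL is anti-idempotent if it is square-increasing and satisfies $x\leqslant f^2$. A De Morgan monoid is a square-increasing IRL with distributive lattice reduct; a Dunn monoid is a square-increasing RL with distributive lattice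 reduct. $\mathbb{V}(A)$ is the variety generated by $A$. $\mathsf{M}$ is the variety of anti-idempotent De Morgan monoids satisfying $e\leqslant f$ and $((f\to x)\vee(x\to e))\to\mathit{0}=\mathit{0}$, where $\mathit{0}:=\neg(f^2)$. $C_4$ is the De Morgan monoid on the chain $\mathit{0}<e<f<\mathit{1}$, where $\neg$ interchanges $\mathit{0},\mathit{1}$ and interchanges $e,f$, and $\cdot$ is commutative with $e$ neutral, $\mathit{0}\cdot x=\mathit{0}$ for all $x$, $\mathit{1}\cdot x=\mathit{1}$ for $x\neq\mathit{0}$, and $f\cdot f=\mathit{1}$. Skew reflections. Let $B$ be a Dunn monoid, $B'=\{b':b\in B\}$ a disjoint copy of $B$, $\mathit{0},\mathit{1}$ distinct non-elements of $B\cup B'$, and $S=B\cup B'\cup\{\mathit{0},\mathit{1}\}$. For a suitable subset $I\subseteq B$, let $\leqslant$ be the relation on $S$ with least element $\mathit{0}$ and greatest element $\mathit{1}$ that extends the order of $B$ and satisfies, for $b,c\in B$: $b'\leqslant c'$ iff $c\leqslant b$; $b'\not\leqslant c$; and $b\leqslant c'$ iff $b\cdot c\in I$. (In the cases used below this is a lattice order.) The skew reflection $\mathrm{S}^{\leqslant}(B)$ is the algebra $\langle S;\cdot,\wedge,\vee,\neg,e\rangle$, where $\wedge,\vee$ are the lattice operations of $\leqslant$, $e$ is that of $B$, $\cdot$ is commutative and extends that of $B$, $a\cdot\mathit{0}=\mathit{0}$ for all $a\in S$, $a\cdot\mathit{1}=\mathit{1}$ for $a\in S\setminus\{\mathit{0}\}$,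 $b\cdot c'=(b\to c)'$ and $b'\cdot c'=\mathit{1}$ for $b,c\in B$, and $\neg\mathit{0}=\mathit{1}$, $\neg\mathit{1}=\mathit{0}$, $\neg b=b'$, $\neg(b')=b$. When $I=B$ (so $b\leqslant c'$ for all $b,c\in B$), $\mathrm{S}^{\leqslant}(B)$ is called the reflection $\mathrm{R}(B)$ of $B$. The Dunn monoids used (in each, $\cdot$ is commutative, $e$ is neutral, $\bot$ is the least element, $\bot\cdot x=\bot$ for all $x$, and $x\to y$ is the largest $z$ with $x\cdot z\leqslant y$): - $\mathbf{2}^+$: the chain $\bot<e$. - $S_3^+$: the chain $\bot<e<\top$, with $\top\cdot\top=\top$. - $C_4^+$: the chain $\bot<e<a<\top$, with $a\cdot a=a\cdot\top=\top\cdot\top=\top$. - $T_5$: elements $\bot,e,s,t,\top$, where $\bot<e<t<\top$, $\bot<s<t$, $e,s$ are incomparable and $t=e\vee s$; $s\cdot s=s\cdot t=s\cdot\top=s$, $t\cdot t=t$, $t\cdot\top=\top\cdot\top=\top$. - $T_6$: elements $\bot,e,s,t,u,\top$, where $\bot<e<t<u<\top$, $\bot<s<t$, $e,s$ are incomparable and $t=e\vee s$; $s\cdot s=s\cdot t=s\cdot u=s\cdot\top=s$, $t\cdot t=t$, $t\cdot u=u$, $t\cdot\top=u\cdot u=u\cdot\top=\top\cdot\top=\top$. For $G_1=\mathrm{R}(\mathbf{2}^+)$ and $G_2=\mathrm{R}(S_3^+)$, $I=B$. For $G_3=\mathrm{S}^{\leqslant}(S_3^+)$, $G_4=\mathrm{S}^{\leqslant}(C_4^+)$,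 $G_5=\mathrm{S}^{\leqslant}(T_5)$, $G_6=\mathrm{S}^{\leqslant}(T_6)$, the order $\leqslant$ is the one given by $I=B\setminus\{\top\}$. *)

theory Defs
  imports "HOL-Algebra.Group" "HOL-Algebra.Lattice"
begin

section \<open>Residuated structures\<close>

record 'a lat_monoid = "'a monoid" +
  wedge :: "'a \<Rightarrow> 'a \<Rightarrow> 'a" (infixl "\<curlywedge>\<index>" 70)
  vee :: "'a \<Rightarrow> 'a \<Rightarrow> 'a" (infixl "\<curlyvee>\<index>" 65)

record 'a rl = "'a lat_monoid" +
  imp :: "'a \<Rightarrow> 'a \<Rightarrow> 'a" (infixr "\<rightharpoonup>\<index>" 60)

record 'a irl = "'a lat_monoid" +
  neg :: "'a \<Rightarrow> 'a" ("\<sim>\<index> _" [81] 80)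

definition below :: "('a, 'm) lat_monoid_scheme \<Rightarrow> 'a \<Rightarrow> 'a \<Rightarrow> bool" (infix "\<preceq>\<index>" 50)
  where "x \<preceq>\<^bsub>A\<^esub> y \<longleftrightarrow> x \<curlywedge>\<^bsub>A\<^esub> y = x"

locale lattice_monoid = comm_monoid A for A :: "('a, 'm) lat_monoid_scheme" (structure) +
  assumes wedge_closed: "\<lbrakk>x \<in> carrier A; y \<in> carrier A\<rbrakk> \<Longrightarrow> x \<curlywedge> y \<in> carrier A"
    and vee_closed: "\<lbrakk>x \<in> carrier A; y \<in> carrier A\<rbrakk> \<Longrightarrow> x \<curlyvee> y \<in> carrier A"
    and wedge_commute: "\<lbrakk>x \<in> carrier A; y \<in> carrier A\<rbrakk> \<Longrightarrow> x \<curlywedge> y = y \<curlywedge> x"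
    and vee_commute: "\<lbrakk>x \<in> carrier A; y \<in> carrier A\<rbrakk> \<Longrightarrow> x \<curlyvee> y = y \<curlyvee> x"
    and wedge_assoc: "\<lbrakk>x \<in> carrier A; y \<in> carrier A; z \<in> carrier A\<rbrakk>
      \<Longrightarrow> (x \<curlywedge> y) \<curlywedge> z = x \<curlywedge> (y \<curlywedge> z)"
    and vee_assoc: "\<lbrakk>x \<in> carrier A; y \<in> carrier A; z \<in> carrier A\<rbrakk>
      \<Longrightarrow> (x \<curlyvee> y) \<curlyvee> z = x \<curlyvee> (y \<curlyvee> z)"
    and wedge_absorb: "\<lbrakk>x \<in> carrier A; y \<in> carrier A\<rbrakk> \<Longrightarrow> x \<curlywedge> (x \<curlyvee> y) = x"
    and vee_absorb: "\<lbrakk>x \<in> carrier A; y \<in> carrier A\<rbrakk> \<Longrightarrow> x \<curlyvee> (x \<curlywedge> y) = x"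

locale distrib_lattice_monoid = lattice_monoid +
  assumes wedge_vee_distrib: "\<lbrakk>x \<in> carrier A; y \<in> carrier A; z \<in> carrier A\<rbrakk>
    \<Longrightarrow> x \<curlywedge> (y \<curlyvee> z) = (x \<curlywedge> y) \<curlyvee> (x \<curlywedge> z)"

locale square_increasing = lattice_monoid +
  assumes square_increasing: "x \<in> carrier A \<Longrightarrow> x \<preceq> x \<otimes> x"

locale residuated_lattice = lattice_monoid B for B :: "('a, 'm) rl_scheme" (structure) +
  assumes imp_closed: "\<lbrakk>x \<in> carrier B; y \<in> carrier B\<rbrakk> \<Longrightarrow> x \<rightharpoonup> y \<in> carrier B"
    and residuation: "\<lbrakk>x \<in> carrier B; y \<in> carrier B; z \<in> carrier B\<rbrakk>
      \<Longrightarrow> x \<otimes> y \<preceq> z \<longleftrightarrow> y \<preceq> x \<rightharpoonup> z"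

locale dunn_monoid =
  residuated_lattice B + distrib_lattice_monoid B + square_increasing B
  for B :: "('a, 'm) rl_scheme" (structure)

locale involutive_residuated_lattice = lattice_monoid A
  for A :: "('a, 'm) irl_scheme" (structure) +
  assumes neg_closed: "x \<in> carrier A \<Longrightarrow> \<sim> x \<in> carrier A"
    and neg_neg: "x \<in> carrier A \<Longrightarrow> \<sim> (\<sim> x) = x"
    and neg_residuation: "\<lbrakk>x \<in> carrier A; y \<in> carrier A; z \<in> carrier A\<rbrakk>
      \<Longrightarrow> x \<otimes> y \<preceq> z \<longleftrightarrow> \<sim> z \<otimes> y \<preceq> \<sim> x"

locale de_morgan_monoid =
  involutive_residuated_lattice A + distrib_lattice_monoid A + square_increasing A
  for A :: "('a, 'm) irl_scheme" (structure)

definition irl_f :: "('a, 'm) irl_scheme \<Rightarrow> 'a" ("\<f>\<index>")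
  where "\<f>\<^bsub>A\<^esub> = \<sim>\<^bsub>A\<^esub> \<one>\<^bsub>A\<^esub>"

definition irl_zero :: "('a, 'm) irl_scheme \<Rightarrow> 'a" ("\<o>\<index>")
  where "\<o>\<^bsub>A\<^esub> = \<sim>\<^bsub>A\<^esub> (\<f>\<^bsub>A\<^esub> \<otimes>\<^bsub>A\<^esub> \<f>\<^bsub>A\<^esub>)"

definition irl_imp :: "('a, 'm) irl_scheme \<Rightarrow> 'a \<Rightarrow> 'a \<Rightarrow> 'a" (infixr "\<leadsto>\<index>" 60)
  where "x \<leadsto>\<^bsub>A\<^esub> y = \<sim>\<^bsub>A\<^esub> (x \<otimes>\<^bsub>A\<^esub> (\<sim>\<^bsub>A\<^esub> y))"

locale anti_idempotent_de_morgan_monoid = de_morgan_monoid +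
  assumes anti_idempotent: "x \<in> carrier A \<Longrightarrow> x \<preceq> \<f> \<otimes> \<f>"

text \<open>The class of all members of \<open>\<M>\<close> whose carrier is a subset of the type \<open>'u\<close>.\<close>

definition class_M :: "'u irl set"
  where "class_M = {A. anti_idempotent_de_morgan_monoid A \<and> \<one>\<^bsub>A\<^esub> \<preceq>\<^bsub>A\<^esub> \<f>\<^bsub>A\<^esub> \<and>
    (\<forall>x\<in>carrier A. ((\<f>\<^bsub>A\<^esub> \<leadsto>\<^bsub>A\<^esub> x) \<curlyvee>\<^bsub>A\<^esub> (x \<leadsto>\<^bsub>A\<^esub> \<one>\<^bsub>A\<^esub>)) \<leadsto>\<^bsub>A\<^esub> \<o>\<^bsub>A\<^esub> = \<o>\<^bsub>A\<^esub>)}"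


section \<open>Varieties\<close>

datatype trm = Var nat | TOne | TMult trm trm | TWedge trm trm | TVee trm trm | TNeg trm

primrec eval_trm :: "('a, 'm) irl_scheme \<Rightarrow> (nat \<Rightarrow> 'a) \<Rightarrow> trm \<Rightarrow> 'a" where
  "eval_trm A v (Var n) = v n"
| "eval_trm A v TOne = \<one>\<^bsub>A\<^esub>"
| "eval_trm A v (TMult s t) = eval_trm A v s \<otimes>\<^bsub>A\<^esub> eval_trm A v t"
| "eval_trm A v (TWedge s t) = eval_trm A v s \<curlywedge>\<^bsub>A\<^esub> eval_trm A v t"
| "eval_trm A v (TVee s t) = eval_trm A v s \<curlyvee>\<^bsub>A\<^esub> eval_trm A v t"
| "eval_trm A v (TNeg t) = \<sim>\<^bsub>A\<^esub> (eval_trm A v t)"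

definition satisfies :: "('a, 'm) irl_scheme \<Rightarrow> (trm \<times> trm) set \<Rightarrow> bool" (infix "\<Turnstile>" 50)
  where "A \<Turnstile> \<Sigma> \<longleftrightarrow> (\<forall>(s, t)\<in>\<Sigma>. \<forall>v. range v \<subseteq> carrier A \<longrightarrow> eval_trm A v s = eval_trm A v t)"

locale irl_algebra =
  fixes A :: "('a, 'm) irl_scheme" (structure)
  assumes alg_one: "\<one> \<in> carrier A"
    and "\<lbrakk>x \<in> carrier A; y \<in> carrier A\<rbrakk> \<Longrightarrow> x \<otimes> y \<in> carrier A"
    and "\<lbrakk>x \<in> carrier A; y \<in> carrier A\<rbrakk> \<Longrightarrow> x \<curlywedge> y \<in> carrier A"
    and "\<lbrakk>x \<in> carrier A; y \<in> carrier A\<rbrakk> \<Longrightarrow> x \<curlyvee> y \<in> carrier A"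
    and "x \<in> carrier A \<Longrightarrow> \<sim> x \<in> carrier A"

text \<open>
  A variety is an equational class. Here it is given by its members whose carriers are subsets of a
  fixed type \<open>'u\<close>. As there are countably many variables, an equational class is generated by its
  countable members, so no information is lost when \<open>'u\<close> is infinite. The operations of a record are
  unconstrained outside its carrier; this is harmless as satisfaction does not depend on them there.
\<close>

definition models :: "(trm \<times> trm) set \<Rightarrow> 'u irl set"
  where "models \<Sigma> = {A. irl_algebra A \<and> A \<Turnstile> \<Sigma>}"

definition variety :: "'u irl set \<Rightarrow> bool"
  where "variety K \<longleftrightarrow> (\<exists>\<Sigma>. K = models \<Sigma>)"

text \<open>
  The least equational class to which \<open>A\<close> belongs. The carrier type of \<open>A\<close> may differ from \<open>'u\<close>, so
  membership of \<open>A\<close> in the class axiomatized by \<open>\<Sigma>\<close> is expressed by \<open>A \<Turnstile> \<Sigma>\<close>.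
\<close>

definition variety_generated :: "'a irl \<Rightarrow> 'u irl set" ("\<V>")
  where "\<V> A = \<Inter>{models \<Sigma> |\<Sigma>. A \<Turnstile> \<Sigma>}"

definition subvarieties :: "'u irl set \<Rightarrow> 'u irl set set"
  where "subvarieties M = {K. variety K \<and> K \<subseteq> M}"

definition covers_in :: "'x set set \<Rightarrow> 'x set \<Rightarrow> 'x set set"
  where "covers_in L a =
    {b \<in> L. a \<in> L \<and> a \<subset> b \<and> \<not> (\<exists>c\<in>L. a \<subset> c \<and> c \<subset> b)}"


section \<open>The algebra \<open>C\<^sub>4\<close>\<close>

datatype c4 = C4_0 | C4_e | C4_f | C4_1

definition c4_order :: "c4 gorder"
  where "c4_order = \<lparr>carrier = UNIV, eq = (=),
    le = (\<lambda>x y. x = y \<or> x = C4_0 \<or> y = C4_1 \<or> x = C4_e \<and> y = C4_f)\<rparr>"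

primrec c4_neg :: "c4 \<Rightarrow> c4" where
  "c4_neg C4_0 = C4_1" | "c4_neg C4_e = C4_f" | "c4_neg C4_f = C4_e" | "c4_neg C4_1 = C4_0"

definition c4_mult :: "c4 \<Rightarrow> c4 \<Rightarrow> c4"
  where "c4_mult x y =
    (if x = C4_0 \<or> y = C4_0 then C4_0
     else if x = C4_e then y else if y = C4_e then x
     else C4_1)"

definition C4 :: "c4 irl"
  where "C4 = \<lparr>carrier = UNIV, mult = c4_mult, one = C4_e,
    wedge = meet c4_order, vee = join c4_order, neg = c4_neg\<rparr>"


section \<open>Skew reflections\<close>

text \<open>\<open>Copy b\<close> stands for \<open>b'\<close>; \<open>Lo\<close> and \<open>Hi\<close> are the new least and greatest elements.\<close>

datatype 'b skew = Base 'b | Copy 'b | Lo | Hi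

definition skew_carrier :: "('b, 'm) rl_scheme \<Rightarrow> 'b skew set"
  where "skew_carrier B = Base ` carrier B \<union> Copy ` carrier B \<union> {Lo, Hi}"

fun skew_le :: "'b set \<Rightarrow> ('b, 'm) rl_scheme \<Rightarrow> 'b skew \<Rightarrow> 'b skew \<Rightarrow> bool" where
  "skew_le I B Lo _ \<longleftrightarrow> True"
| "skew_le I B _ Hi \<longleftrightarrow> True"
| "skew_le I B (Base b) (Base c) \<longleftrightarrow> b \<preceq>\<^bsub>B\<^esub> c"
| "skew_le I B (Base b) (Copy c) \<longleftrightarrow> b \<otimes>\<^bsub>B\<^esub> c \<in> I"
| "skew_le I B (Copy b) (Copy c) \<longleftrightarrow> c \<preceq>\<^bsub>B\<^esub> b"
| "skew_le I B (Copy b) (Base c) \<longleftrightarrow> False"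
| "skew_le I B Hi _ \<longleftrightarrow> False"
| "skew_le I B _ Lo \<longleftrightarrow> False"

definition skew_order :: "'b set \<Rightarrow> ('b, 'm) rl_scheme \<Rightarrow> 'b skew gorder"
  where "skew_order I B = \<lparr>carrier = skew_carrier B, eq = (=), le = skew_le I B\<rparr>"

fun skew_mult :: "('b, 'm) rl_scheme \<Rightarrow> 'b skew \<Rightarrow> 'b skew \<Rightarrow> 'b skew" where
  "skew_mult B Lo _ = Lo"
| "skew_mult B _ Lo = Lo"
| "skew_mult B Hi _ = Hi"
| "skew_mult B _ Hi = Hi"
| "skew_mult B (Base b) (Base c) = Base (b \<otimes>\<^bsub>B\<^esub> c)"
| "skew_mult B (Base b) (Copy c) = Copy (b \<rightharpoonup>\<^bsub>B\<^esub> c)"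
| "skew_mult B (Copy b) (Base c) = Copy (c \<rightharpoonup>\<^bsub>B\<^esub> b)"
| "skew_mult B (Copy b) (Copy c) = Hi"

primrec skew_neg :: "'b skew \<Rightarrow> 'b skew" where
  "skew_neg Lo = Hi"
| "skew_neg Hi = Lo"
| "skew_neg (Base b) = Copy b"
| "skew_neg (Copy b) = Base b"

definition skew_reflection :: "'b set \<Rightarrow> ('b, 'm) rl_scheme \<Rightarrow> 'b skew irl"
  where "skew_reflection I B =
    \<lparr>carrier = skew_carrier B, mult = skew_mult B, one = Base \<one>\<^bsub>B\<^esub>,
     wedge = meet (skew_order I B), vee = join (skew_order I B), neg = skew_neg\<rparr>"

definition reflection :: "('b, 'm) rl_scheme \<Rightarrow> 'b skew irl"
  where "reflection B = skew_reflection (carrier B) B"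


section \<open>The Dunn monoids\<close>

text \<open>
  All five monoids live on subsets of one type, with a common order and a common multiplication:
  the order is the transitive one determined by \<open>\<bottom> < e < a < \<top>\<close>, \<open>\<bottom> < e < t < u < \<top>\<close> and
  \<open>\<bottom> < s < t\<close>, and on each of the five carriers below the multiplication restricts to the one
  described by the respective product table. (The element \<open>a\<close> never occurs together with
  \<open>s\<close>, \<open>t\<close>, \<open>u\<close>.) The residual and the lattice operations depend on the carrier.
\<close>

datatype delt = Dbot | De | Da | Ds | Dt | Du | Dtop

definition delt_le :: "delt \<Rightarrow> delt \<Rightarrow> bool"
  where "delt_le x y \<longleftrightarrow> x = y \<or> x = Dbot \<or> y = Dtop \<or>
    (x, y) \<in> {(De, Da), (De, Dt), (De, Du), (Ds, Dt), (Ds, Du), (Dt, Du)}"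

definition delt_mult :: "delt \<Rightarrow> delt \<Rightarrow> delt"
  where "delt_mult x y =
    (if x = Dbot \<or> y = Dbot then Dbot
     else if x = De then y else if y = De then x
     else if x = Ds \<or> y = Ds then Ds
     else if x = Dt then y else if y = Dt then x
     else Dtop)"

definition delt_order :: "delt set \<Rightarrow> delt gorder"
  where "delt_order D = \<lparr>carrier = D, eq = (=), le = delt_le\<rparr>"

definition dunn_on :: "delt set \<Rightarrow> delt rl"
  where "dunn_on D =
    \<lparr>carrier = D, mult = delt_mult, one = De,
     wedge = meet (delt_order D), vee = join (delt_order D),
     imp = (\<lambda>x y. THE z. greatest (delt_order D) z {z \<in> D. delt_le (delt_mult x z) y})\<rparr>"

definition two_plus :: "delt rl" where "two_plus = dunn_on {Dbot, De}"
definition S3_plus :: "delt rl" where "S3_plus = dunn_on {Dbot, De, Dtop}"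
definition C4_plus :: "delt rl" where "C4_plus = dunn_on {Dbot, De, Da, Dtop}"
definition T5 :: "delt rl" where "T5 = dunn_on {Dbot, De, Ds, Dt, Dtop}"
definition T6 :: "delt rl" where "T6 = dunn_on {Dbot, De, Ds, Dt, Du, Dtop}"

definition G1 :: "delt skew irl" where "G1 = reflection two_plus"
definition G2 :: "delt skew irl" where "G2 = reflection S3_plus"
definition G3 :: "delt skew irl" where "G3 = skew_reflection (carrier S3_plus - {Dtop}) S3_plus"
definition G4 :: "delt skew irl" where "G4 = skew_reflection (carrier C4_plus - {Dtop}) C4_plus"
definition G5 :: "delt skew irl" where "G5 = skew_reflection (carrier T5 - {Dtop}) T5"
definition G6 :: "delt skew irl" where "G6 = skew_reflection (carrier T6 - {Dtop}) T6"

end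

theory Submission
  imports Defs
begin

text \<open>
  A subvariety of \<open>\<M>\<close> that properly contains \<open>\<V> C\<^sub>4\<close> has a member \<open>A\<close> refuting an equation
  \<open>p = q\<close> of \<open>C\<^sub>4\<close>. A lattice filter of \<open>A\<close> that contains \<open>e\<close> and is maximal with respect to not
  containing \<open>a = p \<leftrightarrow> q\<close> determines a subdirectly irreducible quotient, in which \<open>c = a \<and> e\<close> is the
  largest element strictly below \<open>e\<close>. In this quotient, for every \<open>x\<close>, exactly one of \<open>x\<close> and \<open>\<not>x\<close> satisfies \<open>x \<rightarrow> e \<noteq> 0\<close>; so it is a skew reflection
  of the Dunn monoid \<open>B\<close> of the nonzero elements with this property. If \<open>c = 0\<close>, the quotient is \<open>C\<^sub>4\<close>,
  which satisfies \<open>p = q\<close>. Otherwise put \<open>d = c \<rightarrow> e\<close>, \<open>s = d \<and> \<not>d\<close>, \<open>t = e \<or> s\<close> and \<open>u = d \<and> f\<close>.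
  The subalgebra generated by \<open>c\<close> is \<open>G\<^sub>1\<close> if \<open>d = e\<close>, and \<open>G\<^sub>2\<close> if \<open>e < d \<le> f\<close>. If \<open>d \<le> f\<close> fails, then
  \<open>{c, e, s, t, u, d}\<close> is closed under the operations of \<open>B\<close>, and according to whether \<open>s = c\<close> and
  whether \<open>u = t\<close> one obtains \<open>G\<^sub>3\<close>, \<open>G\<^sub>4\<close>, \<open>G\<^sub>5\<close> or \<open>G\<^sub>6\<close>. The six varieties are pairwise incomparable
  because each \<open>G\<^sub>i\<close> refutes a one-variable equation that holds in the other five.
\<close>

section \<open>Lattice-ordered monoids\<close>

text \<open>Varieties are compared through equational theories alone: once some \<open>G\<close>
  embeds in a quotient of \<open>A\<close>, every equation of \<open>A\<close> holds in
  \<open>G\<close>, so the variety of \<open>G\<close> lies inside every variety that contains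
  \<open>A\<close>. The single failing equation p = q selects the quotient and keeps it from being a
  copy of C4.

  In the quotient the law of M enters only through its consequence that f \<rightarrow> x or x
  \<rightarrow> e is nonzero. The main obstacle is the case c = 0: an element z not above e
  satisfies z \<and> e = 0, and it has to be shown that z = 0. Such contradictions are reached by
  finding a nonzero p with p \<cdot> f \<le> e, since multiplying by f once more gives f \<cdot> f
  \<le> f.

  In the case c \<noteq> 0, the interval from c to d is where c acts as a zero, which bounds all
  residuals in advance. The elements s, t, u come from complementation relative to d: s = d \<and>
  \<not>d, u = d \<and> \<not>e and t = d \<and> \<not>u. The mixed part of the skew order is this
  same map, and G3 to G6 differ only in which of these values coincide.\<close>

context lattice_monoid begin

lemma wedge_idem: assumes "x \<in> carrier A" shows "x \<curlywedge> x = x"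
  using wedge_absorb[of x "x \<curlywedge> x"] vee_absorb[of x x] assms wedge_closed by simp

lemma vee_idem: assumes "x \<in> carrier A" shows "x \<curlyvee> x = x"
  using vee_absorb[of x "x \<curlyvee> x"] wedge_absorb[of x x] assms vee_closed by simp

lemma below_iff_vee: assumes "x \<in> carrier A" "y \<in> carrier A" shows "x \<preceq> y \<longleftrightarrow> x \<curlyvee> y = y"
  unfolding below_def using assms wedge_absorb vee_absorb wedge_commute vee_commute by metis

lemma below_refl: "x \<in> carrier A \<Longrightarrow> x \<preceq> x"
  unfolding below_def by (rule wedge_idem)

lemma below_trans: "\<lbrakk>x \<preceq> y; y \<preceq> z; x \<in> carrier A; y \<in> carrier A; z \<in> carrier A\<rbrakk> \<Longrightarrow> x \<preceq> z"
  unfolding below_def by (metis wedge_assoc)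

lemma below_antisym: "\<lbrakk>x \<preceq> y; y \<preceq> x; x \<in> carrier A; y \<in> carrier A\<rbrakk> \<Longrightarrow> x = y"
  unfolding below_def by (metis wedge_commute)

lemma below_wedge_iff:
  assumes "x \<in> carrier A" "y \<in> carrier A" "z \<in> carrier A"
  shows "z \<preceq> x \<curlywedge> y \<longleftrightarrow> z \<preceq> x \<and> z \<preceq> y"
  using assms unfolding below_def
  by (metis wedge_assoc wedge_commute wedge_idem wedge_closed)

lemma vee_below_iff:
  assumes "x \<in> carrier A" "y \<in> carrier A" "z \<in> carrier A"
  shows "x \<curlyvee> y \<preceq> z \<longleftrightarrow> x \<preceq> z \<and> y \<preceq> z"
  using assms by (simp add: below_iff_vee vee_closed)
    (metis vee_assoc vee_commute vee_idem vee_closed)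

lemma wedge_below: assumes "x \<in> carrier A" "y \<in> carrier A" shows "x \<curlywedge> y \<preceq> x" "x \<curlywedge> y \<preceq> y"
  using assms below_wedge_iff[of x y "x \<curlywedge> y"] by (simp_all add: wedge_closed below_refl)

lemma below_vee: assumes "x \<in> carrier A" "y \<in> carrier A" shows "x \<preceq> x \<curlyvee> y" "y \<preceq> x \<curlyvee> y"
  using assms vee_below_iff[of x y "x \<curlyvee> y"] by (simp_all add: vee_closed below_refl)

end

context residuated_lattice begin

lemma residuation': "\<lbrakk>x \<in> carrier B; y \<in> carrier B; z \<in> carrier B\<rbrakk>
    \<Longrightarrow> x \<otimes> y \<preceq> z \<longleftrightarrow> x \<preceq> y \<rightharpoonup> z"
  using residuation[of y x z] m_comm by simp

lemma below_eqI:
  assumes "x \<in> carrier B" "y \<in> carrier B" "\<And>z. z \<in> carrier B \<Longrightarrow> z \<preceq> x \<longleftrightarrow> z \<preceq> y"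
  shows "x = y"
  using assms below_antisym below_refl by blast

lemma mult_imp: assumes "x \<in> carrier B" "y \<in> carrier B" "z \<in> carrier B"
  shows "x \<otimes> y \<rightharpoonup> z = x \<rightharpoonup> (y \<rightharpoonup> z)"
  by (rule below_eqI)
    (use assms in \<open>simp_all add: imp_closed flip: residuation', simp add: m_assoc m_comm m_lcomm\<close>)

lemma one_imp: assumes "x \<in> carrier B" shows "\<one> \<rightharpoonup> x = x"
  by (rule below_eqI) (use assms in \<open>simp_all add: imp_closed flip: residuation\<close>)

end

text \<open>\<open>meet\<close> picks a greatest lower bound by Hilbert choice, so computing it
  requires uniqueness; antisymmetry on the carrier and the universal property of \<open>z\<close>
  supply it.\<close>

lemma meet_eqI:
  assumes "\<And>x y. \<lbrakk>x \<in> carrier L; y \<in> carrier L; le L x y; le L y x\<rbrakk> \<Longrightarrow> x = y"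
    and "z \<in> carrier L" "\<And>w. w \<in> carrier L \<Longrightarrow> le L w z \<longleftrightarrow> le L w x \<and> le L w y"
    and "le L z z" "x \<in> carrier L" "y \<in> carrier L"
  shows "meet L x y = z"
  unfolding meet_def inf_def
proof (rule some_equality)
  have *: "Lower L {x, y} = {w \<in> carrier L. le L w x \<and> le L w y}"
    using assms(5,6) by (auto simp: Lower_def)
  show "greatest L z (Lower L {x, y})"
    using assms(2-6) unfolding greatest_def * by auto
  show "w = z" if "greatest L w (Lower L {x, y})" for w
    using that assms(2-6) unfolding greatest_def * by (auto intro!: assms(1))
qed

lemma join_eqI:
  assumes "\<And>x y. \<lbrakk>x \<in> carrier L; y \<in> carrier L; le L x y; le L y x\<rbrakk> \<Longrightarrow> x = y"
    and "z \<in> carrier L" "\<And>w. w \<in> carrier L \<Longrightarrow> le L z w \<longleftrightarrow> le L x w \<and> le L y w"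
    and "le L z z" "x \<in> carrier L" "y \<in> carrier L"
  shows "join L x y = z"
  unfolding join_def sup_def
proof (rule some_equality)
  have *: "Upper L {x, y} = {w \<in> carrier L. le L x w \<and> le L y w}"
    using assms(5,6) by (auto simp: Upper_def)
  show "least L z (Upper L {x, y})"
    using assms(2-6) unfolding least_def * by auto
  show "w = z" if "least L w (Upper L {x, y})" for w
    using that assms(2-6) unfolding least_def * by (auto intro!: assms(1))
qed

section \<open>Skew reflections are members of M\<close>

text \<open>
  The condition on \<open>h\<close> says that \<open>h c\<close> is the largest element of \<open>B\<close> below \<open>c'\<close>. The laws \<open>distrib1\<close> to
  \<open>distrib3\<close> state the distributivity of the skew order for triples that meet both \<open>B\<close> and \<open>B'\<close>.
\<close>

locale skew_dunn = dunn_monoid B for B :: "('b, 'm) rl_scheme" (structure) +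
  fixes I :: "'b set" and h :: "'b \<Rightarrow> 'b"
  assumes h_closed [simp]: "b \<in> carrier B \<Longrightarrow> h b \<in> carrier B"
    and mult_in_I_iff: "\<lbrakk>b \<in> carrier B; c \<in> carrier B\<rbrakk> \<Longrightarrow> b \<otimes> c \<in> I \<longleftrightarrow> b \<preceq> h c"
    and one_in_I: "\<one> \<in> I"
    and distrib1: "\<lbrakk>a \<in> carrier B; b \<in> carrier B; c \<in> carrier B;
      b \<curlywedge> h a \<preceq> c; b \<preceq> h (a \<curlywedge> h c)\<rbrakk> \<Longrightarrow> b \<preceq> c"
    and distrib2: "\<lbrakk>a \<in> carrier B; b \<in> carrier B; c \<in> carrier B;
      b \<curlywedge> a \<preceq> h c; b \<preceq> h (c \<curlywedge> h a)\<rbrakk> \<Longrightarrow> b \<preceq> h c"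
    and distrib3: "\<lbrakk>a \<in> carrier B; b \<in> carrier B; c \<in> carrier B;
      b \<curlywedge> h a \<preceq> h c; b \<preceq> h (a \<curlywedge> c)\<rbrakk> \<Longrightarrow> b \<preceq> h c"
begin

fun skew_inf where
  "skew_inf Lo _ = Lo"
| "skew_inf _ Lo = Lo"
| "skew_inf Hi x = x"
| "skew_inf x Hi = x"
| "skew_inf (Base b) (Base c) = Base (b \<curlywedge> c)"
| "skew_inf (Copy b) (Copy c) = Copy (b \<curlyvee> c)"
| "skew_inf (Base b) (Copy c) = Base (b \<curlywedge> h c)"
| "skew_inf (Copy c) (Base b) = Base (b \<curlywedge> h c)"

definition "skew_sup x y = skew_neg (skew_inf (skew_neg x) (skew_neg y))"

abbreviation S where "S \<equiv> skew_reflection I B"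
abbreviation sle (infix "\<lesssim>" 50) where "x \<lesssim> y \<equiv> skew_le I B x y"

lemma skew_carrier_simps [simp]:
  "Base b \<in> skew_carrier B \<longleftrightarrow> b \<in> carrier B" "Copy b \<in> skew_carrier B \<longleftrightarrow> b \<in> carrier B"
  "Lo \<in> skew_carrier B" "Hi \<in> skew_carrier B"
  by (auto simp: skew_carrier_def)

lemma skew_neg_neg [simp]: "skew_neg (skew_neg x) = x"
  by (cases x) auto

lemma skew_neg_closed [simp]: "skew_neg x \<in> skew_carrier B \<longleftrightarrow> x \<in> skew_carrier B"
  by (cases x) auto

lemma skew_neg_le: "x \<in> skew_carrier B \<Longrightarrow> y \<in> skew_carrier B \<Longrightarrow> skew_neg x \<lesssim> skew_neg y \<longleftrightarrow> y \<lesssim> x"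
  by (cases x; cases y) (auto simp: m_comm)

lemma skew_inf_closed [simp]:
  "x \<in> skew_carrier B \<Longrightarrow> y \<in> skew_carrier B \<Longrightarrow> skew_inf x y \<in> skew_carrier B"
  by (cases x; cases y) (auto simp: wedge_closed vee_closed)

lemma skew_sup_closed [simp]:
  "x \<in> skew_carrier B \<Longrightarrow> y \<in> skew_carrier B \<Longrightarrow> skew_sup x y \<in> skew_carrier B"
  by (simp add: skew_sup_def)

lemma skew_mult_closed [simp]:
  "x \<in> skew_carrier B \<Longrightarrow> y \<in> skew_carrier B \<Longrightarrow> skew_mult B x y \<in> skew_carrier B"
  by (cases x; cases y) (auto simp: imp_closed)

lemma skew_le_refl: "x \<in> skew_carrier B \<Longrightarrow> x \<lesssim> x"
  by (cases x) (auto simp: below_refl)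

lemma skew_le_antisym: "\<lbrakk>x \<lesssim> y; y \<lesssim> x; x \<in> skew_carrier B; y \<in> skew_carrier B\<rbrakk> \<Longrightarrow> x = y"
  by (cases x; cases y) (auto intro: below_antisym)

text \<open>Commutativity of the product makes \<open>h\<close> a Galois connection with itself;
  this is why \<open>h\<close> turns joins into conjunctions in \<open>below_h_vee\<close>.\<close>

lemma below_h_commute: "\<lbrakk>b \<in> carrier B; c \<in> carrier B\<rbrakk> \<Longrightarrow> b \<preceq> h c \<longleftrightarrow> c \<preceq> h b"
  by (simp add: m_comm flip: mult_in_I_iff)

lemma below_h_vee:
  assumes "a \<in> carrier B" "b \<in> carrier B" "c \<in> carrier B"
  shows "a \<preceq> h (b \<curlyvee> c) \<longleftrightarrow> a \<preceq> h b \<and> a \<preceq> h c"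
  using assms below_h_commute[of a] by (simp add: vee_closed vee_below_iff)

lemma skew_le_inf_iff:
  "\<lbrakk>x \<in> skew_carrier B; y \<in> skew_carrier B; z \<in> skew_carrier B\<rbrakk>
    \<Longrightarrow> z \<lesssim> skew_inf x y \<longleftrightarrow> z \<lesssim> x \<and> z \<lesssim> y"
  by (cases x; cases y; cases z)
    (auto simp: below_wedge_iff vee_below_iff vee_closed mult_in_I_iff below_h_vee)

lemma skew_sup_le_iff:
  assumes "x \<in> skew_carrier B" "y \<in> skew_carrier B" "z \<in> skew_carrier B"
  shows "skew_sup x y \<lesssim> z \<longleftrightarrow> x \<lesssim> z \<and> y \<lesssim> z"
  using assms skew_neg_le[of z "skew_sup x y"]
    skew_le_inf_iff[of "skew_neg x" "skew_neg y" "skew_neg z"]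
  by (simp add: skew_sup_def skew_neg_le)

text \<open>From \<open>y \<lesssim> z\<close> antisymmetry yields \<open>y = skew_inf y z\<close>,
  so \<open>x \<lesssim> y\<close> already says that x is below z; the case distinction over three
  constructors is avoided.\<close>

lemma skew_trans: "\<lbrakk>x \<lesssim> y; y \<lesssim> z; x \<in> skew_carrier B; y \<in> skew_carrier B; z \<in> skew_carrier B\<rbrakk> \<Longrightarrow> x \<lesssim> z"
  by (metis skew_inf_closed skew_le_antisym skew_le_inf_iff skew_le_refl)

lemma S_simps [simp]:
  "carrier S = skew_carrier B" "mult S = skew_mult B" "\<one>\<^bsub>S\<^esub> = Base \<one>" "neg S = skew_neg"
  by (simp_all add: skew_reflection_def)

lemma wedge_S: "\<lbrakk>x \<in> skew_carrier B; y \<in> skew_carrier B\<rbrakk> \<Longrightarrow> x \<curlywedge>\<^bsub>S\<^esub> y = skew_inf x y"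
  unfolding skew_reflection_def skew_order_def
  by simp (rule meet_eqI, auto simp: skew_le_inf_iff skew_le_refl intro: skew_le_antisym)

lemma vee_S: "\<lbrakk>x \<in> skew_carrier B; y \<in> skew_carrier B\<rbrakk> \<Longrightarrow> x \<curlyvee>\<^bsub>S\<^esub> y = skew_sup x y"
  unfolding skew_reflection_def skew_order_def
  by simp (rule join_eqI, auto simp: skew_sup_le_iff skew_le_refl intro: skew_le_antisym)

lemma below_S: "\<lbrakk>x \<in> skew_carrier B; y \<in> skew_carrier B\<rbrakk> \<Longrightarrow> x \<preceq>\<^bsub>S\<^esub> y \<longleftrightarrow> x \<lesssim> y"
  unfolding below_def
  by (metis wedge_S skew_inf_closed skew_le_antisym skew_le_inf_iff skew_le_refl)

text \<open>A lattice is distributive just when this cut rule holds. Being an implication between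
  inequalities, the rule can be checked constructor by constructor.\<close>

lemma skew_distrib:
  assumes "x \<in> skew_carrier B" "y \<in> skew_carrier B" "z \<in> skew_carrier B"
    "skew_inf x y \<lesssim> z" "x \<lesssim> skew_sup y z"
  shows "x \<lesssim> z"
proof -
  have distrib: "b \<preceq> c" if "a \<in> carrier B" "b \<in> carrier B" "c \<in> carrier B" "b \<curlywedge> a \<preceq> c" "b \<preceq> a \<curlyvee> c" for a b c
    using that wedge_vee_distrib[of b a c]
    unfolding below_def[of _ b "a \<curlyvee> c"] by (simp add: below_iff_vee below_def wedge_closed vee_closed)
      (metis wedge_assoc wedge_commute wedge_idem wedge_closed vee_closed vee_absorb vee_commute wedge_absorb)
  \<comment> \<open>For \<open>x\<close> and \<open>z\<close> in B' and \<open>y\<close> in B: the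
    image of \<open>distrib1\<close> under negation, with one inequality moved across the Galois
    connection \<open>h\<close>.\<close>
  have copy_base: "c \<preceq> b" if "a \<in> carrier B" "b \<in> carrier B" "c \<in> carrier B"
    "a \<curlywedge> h b \<preceq> h c" "c \<curlywedge> h a \<preceq> b" for a b c
    using that distrib1[of a c b] below_h_commute[of c "a \<curlywedge> h b"] by (simp add: wedge_closed)
  have copy_copy: "c \<preceq> b" if "a \<in> carrier B" "b \<in> carrier B" "c \<in> carrier B"
    "c \<preceq> b \<curlyvee> a" "a \<curlywedge> c \<preceq> b" for a b c
    using that distrib[of a c b] by (simp add: wedge_commute vee_commute)
  show ?thesis
    using assms
    by (cases x; cases y; cases z)
      (simp_all add: skew_sup_def mult_in_I_iff vee_closed wedge_closed,
       (fast elim: distrib distrib1 distrib2 distrib3 copy_base copy_copy)+)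
qed

lemma
  assumes "x \<in> skew_carrier B" "y \<in> skew_carrier B"
  shows skew_inf_le: "skew_inf x y \<lesssim> x" "skew_inf x y \<lesssim> y"
    and le_skew_sup: "x \<lesssim> skew_sup x y" "y \<lesssim> skew_sup x y"
  using assms skew_le_inf_iff[of x y "skew_inf x y"] skew_sup_le_iff[of x y "skew_sup x y"]
  by (simp_all add: skew_le_refl)

lemma skew_eqI:
  assumes "\<And>w. w \<in> skew_carrier B \<Longrightarrow> w \<lesssim> x \<longleftrightarrow> w \<lesssim> y" "x \<in> skew_carrier B" "y \<in> skew_carrier B"
  shows "x = y"
  using assms skew_le_refl skew_le_antisym by blast

lemma skew_eqI':
  assumes "\<And>w. w \<in> skew_carrier B \<Longrightarrow> x \<lesssim> w \<longleftrightarrow> y \<lesssim> w" "x \<in> skew_carrier B" "y \<in> skew_carrier B"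
  shows "x = y"
  using assms skew_le_refl skew_le_antisym by blast

text \<open>Two cuts give the hard inequality: the first removes \<open>z\<close> from the join
  above \<open>?u\<close>, the second removes \<open>y\<close>.\<close>

lemma skew_inf_sup_distrib:
  assumes x: "x \<in> skew_carrier B" and y: "y \<in> skew_carrier B" and z: "z \<in> skew_carrier B"
  shows "skew_inf x (skew_sup y z) = skew_sup (skew_inf x y) (skew_inf x z)"
proof (rule skew_le_antisym)
  let ?u = "skew_inf x (skew_sup y z)" and ?w = "skew_sup (skew_inf x y) (skew_inf x z)"
  note inf = skew_inf_le and sup = le_skew_sup
  note closed = skew_inf_closed skew_sup_closed x y z
  have uy: "skew_inf ?u y \<lesssim> ?w"
  proof -
    have "skew_inf ?u y \<lesssim> skew_inf x y"
      by (simp add: skew_le_inf_iff closed inf) (rule skew_trans[of _ ?u], simp_all add: closed inf)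
    then show ?thesis by (rule skew_trans) (simp_all add: closed sup)
  qed
  have uz: "skew_inf ?u z \<lesssim> ?w"
  proof -
    have "skew_inf ?u z \<lesssim> skew_inf x z"
      by (simp add: skew_le_inf_iff closed inf) (rule skew_trans[of _ ?u], simp_all add: closed inf)
    then show ?thesis by (rule skew_trans) (simp_all add: closed sup)
  qed
  have "?u \<lesssim> skew_sup y ?w"
  proof (rule skew_distrib[of _ z])
    show "skew_inf ?u z \<lesssim> skew_sup y ?w"
      using uz by (rule skew_trans) (simp_all add: closed sup)
    have "skew_sup y z \<lesssim> skew_sup z (skew_sup y ?w)"
      using skew_trans[of y "skew_sup y ?w" "skew_sup z (skew_sup y ?w)"]
      by (simp add: skew_sup_le_iff closed sup)
    then show "?u \<lesssim> skew_sup z (skew_sup y ?w)"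
      using skew_trans[of ?u "skew_sup y z"] by (simp add: closed inf)
  qed (simp_all add: closed)
  then show "?u \<lesssim> ?w"
    using skew_distrib[OF _ _ _ uy] by (simp add: closed)
  have "skew_inf x y \<lesssim> ?u" "skew_inf x z \<lesssim> ?u"
    using skew_trans[OF inf(2) sup(1), of x y z] skew_trans[OF inf(2) sup(2), of x z y]
    by (simp_all add: skew_le_inf_iff closed inf)
  then show "?w \<lesssim> ?u"
    by (simp add: skew_sup_le_iff closed)
qed (simp_all add: x y z)

lemma skew_mult_commute:
  "\<lbrakk>x \<in> skew_carrier B; y \<in> skew_carrier B\<rbrakk> \<Longrightarrow> skew_mult B x y = skew_mult B y x"
  by (cases x; cases y) (auto simp: m_comm)

lemma skew_mult_assoc:
  "\<lbrakk>x \<in> skew_carrier B; y \<in> skew_carrier B; z \<in> skew_carrier B\<rbrakk>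
    \<Longrightarrow> skew_mult B (skew_mult B x y) z = skew_mult B x (skew_mult B y z)"
  by (cases x; cases y; cases z) (auto simp: m_ac simp flip: mult_imp)

lemma skew_one_mult: "x \<in> skew_carrier B \<Longrightarrow> skew_mult B (Base \<one>) x = x"
  by (cases x) (auto simp: one_imp)

lemma skew_residuation:
  "\<lbrakk>x \<in> skew_carrier B; y \<in> skew_carrier B; z \<in> skew_carrier B\<rbrakk>
    \<Longrightarrow> skew_mult B x y \<lesssim> z \<longleftrightarrow> skew_mult B (skew_neg z) y \<lesssim> skew_neg x"
  by (cases x; cases y; cases z) (auto simp: m_ac residuation imp_closed simp flip: residuation)

lemma skew_le_simps [simp]: "Lo \<lesssim> x" "x \<lesssim> Hi"
  by (cases x; simp)+

lemma lattice_monoid_S: "lattice_monoid S"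
proof (unfold_locales, simp_all add: wedge_S vee_S skew_mult_assoc skew_one_mult)
  show "skew_mult B x (Base \<one>) = x" if "x \<in> skew_carrier B" for x
    using that by (cases x) (auto simp: one_imp)
  show "skew_mult B x y = skew_mult B y x" if "x \<in> skew_carrier B" "y \<in> skew_carrier B" for x y
    using that by (rule skew_mult_commute)
next
  fix x y assume x: "x \<in> skew_carrier B" and y: "y \<in> skew_carrier B"
  show "skew_inf x y = skew_inf y x"
    by (rule skew_le_antisym) (use x y skew_inf_le in \<open>simp_all add: skew_le_inf_iff\<close>)
  show "skew_sup x y = skew_sup y x"
    by (rule skew_le_antisym) (use x y le_skew_sup in \<open>simp_all add: skew_sup_le_iff\<close>)
  show "skew_inf x (skew_sup x y) = x"
    by (rule skew_le_antisym)
      (use x y skew_inf_le le_skew_sup in \<open>simp_all add: skew_le_inf_iff skew_le_refl\<close>)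
  show "skew_sup x (skew_inf x y) = x"
    by (rule skew_le_antisym)
      (use x y skew_inf_le le_skew_sup in \<open>simp_all add: skew_sup_le_iff skew_le_refl\<close>)
next
  fix x y z assume "x \<in> skew_carrier B" "y \<in> skew_carrier B" "z \<in> skew_carrier B"
  then show "skew_inf (skew_inf x y) z = skew_inf x (skew_inf y z)"
    "skew_sup (skew_sup x y) z = skew_sup x (skew_sup y z)"
    by - (rule skew_eqI skew_eqI', simp_all add: skew_le_inf_iff skew_sup_le_iff conj_assoc)+
qed

lemma skew_square: "x \<in> skew_carrier B \<Longrightarrow> x \<lesssim> skew_mult B x x"
  by (cases x) (auto simp: square_increasing)

lemma de_morgan_monoid_S: "anti_idempotent_de_morgan_monoid S"
proof -
  interpret S: lattice_monoid S by (rule lattice_monoid_S)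
  show ?thesis
    by unfold_locales
      (simp_all add: below_S skew_square wedge_S vee_S skew_inf_sup_distrib irl_f_def,
       rule skew_residuation)
qed

text \<open>As \<open>Hi\<close> absorbs everything except \<open>Lo\<close>, the last law of M only
  asks that f \<rightarrow> x or x \<rightarrow> e be nonzero. For x in B the second residual lies
  in B, for x in B' the first does.\<close>

lemma S_in_class_M: "S \<in> class_M"
proof -
  have "((\<f>\<^bsub>S\<^esub> \<leadsto>\<^bsub>S\<^esub> x) \<curlyvee>\<^bsub>S\<^esub> (x \<leadsto>\<^bsub>S\<^esub> \<one>\<^bsub>S\<^esub>)) \<leadsto>\<^bsub>S\<^esub> \<o>\<^bsub>S\<^esub> = \<o>\<^bsub>S\<^esub>"
    if "x \<in> skew_carrier B" for x
    using that
    by (cases x) (auto simp: irl_f_def irl_imp_def irl_zero_def vee_S skew_sup_def imp_closed wedge_closed)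
  then show ?thesis
    unfolding class_M_def using de_morgan_monoid_S one_in_I by (simp add: irl_f_def below_S)
qed

end

section \<open>Preordered De Morgan monoids\<close>

text \<open>
  The quotient of a De Morgan monoid by a filter is treated as a preorder on the original elements,
  so that its laws hold up to \<open>\<simeq>\<close> only; associativity and commutativity of the product are equalities
  before the quotient is taken.
\<close>

locale dm_preorder =
  fixes le :: "'a \<Rightarrow> 'a \<Rightarrow> bool" (infix "\<lesssim>" 50)
    and mul :: "'a \<Rightarrow> 'a \<Rightarrow> 'a" (infixl "\<odot>" 70)
    and inf :: "'a \<Rightarrow> 'a \<Rightarrow> 'a" (infixl "\<triangle>" 68)
    and sup :: "'a \<Rightarrow> 'a \<Rightarrow> 'a" (infixl "\<nabla>" 65)
    and ng :: "'a \<Rightarrow> 'a"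
    and e :: 'a
  assumes pre_refl [simp]: "x \<lesssim> x"
    and pre_trans [trans]: "\<lbrakk>x \<lesssim> y; y \<lesssim> z\<rbrakk> \<Longrightarrow> x \<lesssim> z"
    and mul_assoc: "(x \<odot> y) \<odot> z = x \<odot> (y \<odot> z)"
    and mul_commute: "x \<odot> y = y \<odot> x"
    and mul_e1 [simp]: "x \<odot> e \<lesssim> x"
    and mul_e2 [simp]: "x \<lesssim> x \<odot> e"
    and inf_le1 [simp]: "x \<triangle> y \<lesssim> x"
    and inf_le2 [simp]: "x \<triangle> y \<lesssim> y"
    and le_inf: "\<lbrakk>z \<lesssim> x; z \<lesssim> y\<rbrakk> \<Longrightarrow> z \<lesssim> x \<triangle> y"
    and sup_ge1 [simp]: "x \<lesssim> x \<nabla> y"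
    and sup_ge2 [simp]: "y \<lesssim> x \<nabla> y"
    and sup_le: "\<lbrakk>x \<lesssim> z; y \<lesssim> z\<rbrakk> \<Longrightarrow> x \<nabla> y \<lesssim> z"
    and distrib: "x \<triangle> (y \<nabla> z) \<lesssim> (x \<triangle> y) \<nabla> (x \<triangle> z)"
    and ng_ng1 [simp]: "ng (ng x) \<lesssim> x"
    and ng_ng2 [simp]: "x \<lesssim> ng (ng x)"
    and residuation: "x \<odot> y \<lesssim> z \<longleftrightarrow> ng z \<odot> y \<lesssim> ng x"
    and square: "x \<lesssim> x \<odot> x"
begin


lemma mul_left_commute: "x \<odot> (y \<odot> z) = y \<odot> (x \<odot> z)"
  by (metis mul_assoc mul_commute)

lemmas mul_ac = mul_assoc mul_commute mul_left_commute

definition eqv (infix "\<simeq>" 50) where "x \<simeq> y \<longleftrightarrow> x \<lesssim> y \<and> y \<lesssim> x"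
abbreviation f where "f \<equiv> ng e"
abbreviation hi where "hi \<equiv> f \<odot> f"
abbreviation lo where "lo \<equiv> ng hi"
definition im (infixr "\<rightarrowtail>" 60) where "x \<rightarrowtail> y = ng (x \<odot> ng y)"

lemma e_mul1 [simp]: "e \<odot> x \<lesssim> x" and e_mul2 [simp]: "x \<lesssim> e \<odot> x"
  using mul_commute[of e x] by simp_all

lemma ng_antimono: assumes "x \<lesssim> y" shows "ng y \<lesssim> ng x"
proof -
  have "x \<odot> e \<lesssim> y" using assms mul_e1 pre_trans by blast
  then have "ng y \<odot> e \<lesssim> ng x" by (simp add: residuation[of x e y])
  then show ?thesis using mul_e2 pre_trans by blast
qed

lemma ng_le_iff: "ng x \<lesssim> y \<longleftrightarrow> ng y \<lesssim> x"
  by (meson ng_antimono ng_ng1 pre_trans)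

lemma le_ng_iff: "x \<lesssim> ng y \<longleftrightarrow> y \<lesssim> ng x"
  by (meson ng_antimono ng_ng2 pre_trans)

lemma ng_le_ng_iff [simp]: "ng x \<lesssim> ng y \<longleftrightarrow> y \<lesssim> x"
  by (meson ng_antimono ng_ng2 ng_ng1 pre_trans)

lemma le_ng_ng [simp]: "x \<lesssim> ng (ng y) \<longleftrightarrow> x \<lesssim> y" "ng (ng x) \<lesssim> y \<longleftrightarrow> x \<lesssim> y"
  by (meson ng_ng2 ng_ng1 pre_trans)+

lemma le_im_iff: "y \<lesssim> x \<rightarrowtail> z \<longleftrightarrow> x \<odot> y \<lesssim> z"
  unfolding im_def using residuation[of y x z] by (simp add: mul_commute le_ng_iff)

lemma mul_im [simp]: "x \<odot> (x \<rightarrowtail> y) \<lesssim> y"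
  by (simp flip: le_im_iff)

lemma mul_mono2: assumes "x \<lesssim> y" shows "z \<odot> x \<lesssim> z \<odot> y"
  by (metis assms le_im_iff pre_refl pre_trans)

lemma mul_mono: assumes "x \<lesssim> y" "z \<lesssim> w" shows "x \<odot> z \<lesssim> y \<odot> w"
  by (metis assms mul_mono2 mul_commute pre_trans)

lemma le_ng_iff_mul: "x \<lesssim> ng y \<longleftrightarrow> x \<odot> y \<lesssim> f"
  using residuation[of y x f] le_ng_iff[of x y]
  by (metis e_mul1 e_mul2 le_ng_ng(1) mul_commute mul_mono2 ng_ng1 residuation pre_trans)

lemma mul_ng_self [simp]: "x \<odot> ng x \<lesssim> f"
  using le_ng_iff_mul by (metis mul_commute pre_refl)

lemma inf_mono: "\<lbrakk>x \<lesssim> y; z \<lesssim> w\<rbrakk> \<Longrightarrow> x \<triangle> z \<lesssim> y \<triangle> w"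
  by (meson inf_le1 inf_le2 le_inf pre_trans)

lemma sup_mono: "\<lbrakk>x \<lesssim> y; z \<lesssim> w\<rbrakk> \<Longrightarrow> x \<nabla> z \<lesssim> y \<nabla> w"
  by (meson sup_ge1 sup_ge2 sup_le pre_trans)

lemma le_inf_iff: "z \<lesssim> x \<triangle> y \<longleftrightarrow> z \<lesssim> x \<and> z \<lesssim> y"
  by (meson inf_le1 inf_le2 le_inf pre_trans)

lemma sup_le_iff: "x \<nabla> y \<lesssim> z \<longleftrightarrow> x \<lesssim> z \<and> y \<lesssim> z"
  by (meson sup_ge1 sup_ge2 sup_le pre_trans)

lemma mul_sup: "z \<odot> (x \<nabla> y) \<lesssim> z \<odot> x \<nabla> z \<odot> y"
  by (metis le_im_iff sup_ge1 sup_ge2 sup_le_iff)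

text \<open>The meet lies below its own square. For this reason a lattice filter is closed under
  products, which is what its quotient needs.\<close>

lemma inf_le_mul: "x \<triangle> y \<lesssim> x \<odot> y"
  by (meson inf_le1 inf_le2 mul_mono square pre_trans)

lemma ng_sup: "ng (x \<nabla> y) \<lesssim> ng x \<triangle> ng y"
  by (simp add: le_inf_iff)

lemma ng_inf: "ng (x \<triangle> y) \<lesssim> ng x \<nabla> ng y"
  by (metis inf_le1 inf_le2 le_inf_iff ng_le_iff sup_ge1 sup_ge2)

lemma inf_ng_le_f: "x \<triangle> ng x \<lesssim> f"
  using inf_le_mul mul_ng_self pre_trans by blast

lemma excluded_middle: "e \<lesssim> x \<nabla> ng x"
proof -
  have "ng x \<triangle> ng (ng x) \<lesssim> f" by (rule inf_ng_le_f)
  then have "e \<lesssim> ng (ng x \<triangle> ng (ng x))" by (simp add: le_ng_iff)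
  also have "\<dots> \<lesssim> ng (ng x) \<nabla> ng (ng (ng x))" by (rule ng_inf)
  also have "\<dots> \<lesssim> x \<nabla> ng x" by (simp add: sup_mono)
  finally show ?thesis .
qed

end

section \<open>Consequences of the law of M when e has a largest element strictly below it\<close>

locale M_preorder = dm_preorder +
  assumes le_hi [simp]: "x \<lesssim> hi"
    and e_le_f [simp]: "e \<lesssim> f"
    and M_law: "((f \<rightarrowtail> x) \<nabla> (x \<rightarrowtail> e)) \<rightarrowtail> lo \<lesssim> lo"

locale m_preorder = M_preorder +
  fixes c
  assumes c_le_e [simp]: "c \<lesssim> e"
    and not_e_le_c [simp]: "\<not> e \<lesssim> c"
    and c_greatest: "\<not> e \<lesssim> x \<Longrightarrow> x \<triangle> e \<lesssim> c"
begin

lemma lo_le [simp]: "lo \<lesssim> x"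
  using le_hi[of "ng x"] ng_le_iff by blast

text \<open>Distributivity splits e along the join, and a part of e that is not all of e falls below
  \<open>c\<close>.\<close>

lemma prime: assumes "e \<lesssim> x \<nabla> y" "\<not> e \<lesssim> x" shows "e \<lesssim> y"
proof (rule ccontr)
  assume "\<not> e \<lesssim> y"
  have "e \<lesssim> e \<triangle> (x \<nabla> y)" using assms by (simp add: le_inf_iff)
  also have "\<dots> \<lesssim> (e \<triangle> x) \<nabla> (e \<triangle> y)" by (rule distrib)
  also have "\<dots> \<lesssim> c"
    using c_greatest[OF assms(2)] c_greatest[OF \<open>\<not> e \<lesssim> y\<close>]
    by (meson inf_le1 inf_le2 le_inf sup_le pre_trans)
  finally show False by simp
qed

lemma le_f_if: assumes "\<not> e \<lesssim> x" shows "x \<lesssim> f"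
  using prime[OF excluded_middle assms] le_ng_iff by blast

text \<open>If f \<cdot> f \<le> f, residuation gives f \<le> e, so e bounds everything, in
  particular \<open>ng c\<close>; negating, e \<le> f \<le> c.\<close>

lemma not_hi_le_f [simp]: "\<not> hi \<lesssim> f"
proof
  assume "hi \<lesssim> f"
  then have "ng f \<odot> f \<lesssim> ng f" using residuation by blast
  then have "f \<lesssim> e" by (meson e_mul2 mul_mono ng_ng1 ng_ng2 le_ng_ng pre_trans pre_refl)
  then have "ng c \<lesssim> e" using \<open>hi \<lesssim> f\<close> le_hi pre_trans by meson
  then have "f \<lesssim> c" by (simp add: ng_le_iff)
  then show False using e_le_f not_e_le_c pre_trans by blast
qed

lemma lo_mul: "lo \<odot> x \<lesssim> lo"
  by (metis le_im_iff lo_le mul_commute)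

text \<open>Primeness leaves two cases. If e \<le> hi \<cdot> x, multiply by \<open>hi\<close>;
  otherwise hi \<cdot> x \<le> f, which says that x is below the negation of
  \<open>hi\<close>.\<close>

lemma hi_mul: assumes "\<not> x \<lesssim> lo" shows "hi \<lesssim> hi \<odot> x"
proof (cases "e \<lesssim> hi \<odot> x")
  case True
  have "hi \<lesssim> hi \<odot> e" by simp
  also have "\<dots> \<lesssim> hi \<odot> (hi \<odot> x)" using True by (rule mul_mono2)
  also have "\<dots> = (hi \<odot> hi) \<odot> x" by (simp only: mul_assoc)
  also have "\<dots> \<lesssim> hi \<odot> x" by (rule mul_mono) simp_all
  finally show ?thesis .
next
  case False
  then have "hi \<odot> x \<lesssim> f" by (rule le_f_if)
  then have "x \<lesssim> lo" using le_ng_iff_mul by (metis mul_commute)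
  then show ?thesis using assms by simp
qed

lemma not_hi_le_lo [simp]: "\<not> hi \<lesssim> lo"
  using lo_le not_hi_le_f pre_trans by blast

lemma mul_nonzero: assumes "\<not> x \<lesssim> lo" "\<not> y \<lesssim> lo" shows "\<not> x \<odot> y \<lesssim> lo"
proof
  assume "x \<odot> y \<lesssim> lo"
  have "hi \<lesssim> hi \<odot> y" using hi_mul assms by blast
  also have "\<dots> \<lesssim> (hi \<odot> x) \<odot> y" by (intro mul_mono hi_mul assms pre_refl)
  also have "\<dots> \<lesssim> hi \<odot> lo" using \<open>x \<odot> y \<lesssim> lo\<close> mul_mono2 by (simp only: mul_assoc)
  also have "\<dots> \<lesssim> lo" using lo_mul mul_commute by metis
  finally show False by simp
qed

lemma hi_le_mul_hi: assumes "\<not> x \<lesssim> lo" shows "hi \<lesssim> x \<odot> hi"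
  by (metis assms hi_mul mul_commute)

text \<open>The contradiction on which later arguments end: a further factor f would give hi = x
  \<cdot> hi = (x \<cdot> f) \<cdot> f \<le> f.\<close>

lemma not_mul_f_le_e: assumes "\<not> x \<lesssim> lo" shows "\<not> x \<odot> f \<lesssim> e"
proof
  assume "x \<odot> f \<lesssim> e"
  have "hi \<lesssim> x \<odot> hi" using assms by (rule hi_le_mul_hi)
  also have "\<dots> = (x \<odot> f) \<odot> f" by (simp only: mul_assoc)
  also have "\<dots> \<lesssim> e \<odot> f" using \<open>x \<odot> f \<lesssim> e\<close> by (simp add: mul_mono)
  also have "\<dots> \<lesssim> f" by simp
  finally show False by simp
qed

text \<open>If both residuals vanished, so would their join, and 0 \<rightarrow> 0 is
  \<open>hi\<close> rather than the \<open>lo\<close> that \<open>M_law\<close> prescribes.\<close>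

lemma M_cases: "\<not> (f \<rightarrowtail> x) \<lesssim> lo \<or> \<not> (x \<rightarrowtail> e) \<lesssim> lo"
proof (rule ccontr)
  assume "\<not> ?thesis"
  then have "(f \<rightarrowtail> x) \<nabla> (x \<rightarrowtail> e) \<lesssim> lo" by (simp add: sup_le)
  then have "((f \<rightarrowtail> x) \<nabla> (x \<rightarrowtail> e)) \<odot> hi \<lesssim> lo \<odot> hi" by (simp add: mul_mono)
  also have "\<dots> \<lesssim> lo" by (rule lo_mul)
  finally have "hi \<lesssim> ((f \<rightarrowtail> x) \<nabla> (x \<rightarrowtail> e)) \<rightarrowtail> lo" by (simp add: le_im_iff)
  then show False using M_law pre_trans not_hi_le_lo by blast
qed

lemma not_e_le_lo [simp]: "\<not> e \<lesssim> lo"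
proof
  assume "e \<lesssim> lo"
  then have "e \<odot> hi \<lesssim> lo \<odot> hi" by (simp add: mul_mono)
  also have "\<dots> \<lesssim> lo" by (rule lo_mul)
  finally show False using e_mul2 pre_trans not_hi_le_lo by blast
qed

text \<open>
  Key step: a nonzero \<open>z\<close> with \<open>z \<and> e = 0\<close> would force the dual element \<open>z \<rightarrow> e\<close> to be of the same kind;
  combining the two witnesses \<open>q\<close> then makes \<open>f\<^sup>2 \<le> f\<close>.
\<close>

lemma inf_e_zero_dual:
  assumes z: "\<not> z \<lesssim> lo" and ze: "z \<triangle> e \<lesssim> lo"
  shows "\<exists>q. \<not> q \<lesssim> lo \<and> q \<lesssim> e \<and> q \<odot> f \<lesssim> z \<nabla> e"
    and "\<not> (z \<rightarrowtail> e) \<lesssim> lo" and "(z \<rightarrowtail> e) \<triangle> e \<lesssim> lo"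
proof -
  have "\<not> e \<lesssim> z"
  proof
    assume "e \<lesssim> z"
    then have "e \<lesssim> z \<triangle> e" by (simp add: le_inf_iff)
    then show False using ze pre_trans not_e_le_lo by blast
  qed
  then have zf: "z \<lesssim> f" by (rule le_f_if)
  have le_e: "p \<lesssim> e" if "p \<odot> f \<lesssim> f" for p
    using that by (simp flip: le_ng_iff_mul)
  \<comment> \<open>f \<rightarrow> z is zero because such a \<open>p\<close> is a lower bound of
    both z and e; \<open>M_cases\<close> then makes z \<rightarrow> e nonzero.\<close>
  have "p \<lesssim> lo" if "p \<odot> f \<lesssim> z" for p
  proof -
    have "p \<lesssim> e" using that zf pre_trans le_e by blast
    moreover have "p \<lesssim> p \<odot> f" using mul_mono2[OF e_le_f, of p] mul_e2 pre_trans by blast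
    ultimately show ?thesis using that pre_trans ze by (metis le_inf_iff)
  qed
  then have "(f \<rightarrowtail> z) \<lesssim> lo" by (metis mul_im mul_commute)
  then show v: "\<not> (z \<rightarrowtail> e) \<lesssim> lo" using M_cases by blast
  \<comment> \<open>\<open>hi\<close> is the negation of z \<and> e. Multiplied by z it yields hi
    \<le> f \<or> z \<cdot> f, and the negation of the right-hand side lies above (z \<rightarrow>
    e) \<and> e.\<close>
  have "hi \<lesssim> ng (z \<triangle> e)" using ze le_ng_iff by blast
  also have "\<dots> \<lesssim> ng z \<nabla> f" by (rule ng_inf)
  finally have "z \<odot> hi \<lesssim> z \<odot> (ng z \<nabla> f)" by (rule mul_mono2)
  also have "\<dots> \<lesssim> z \<odot> ng z \<nabla> z \<odot> f" by (rule mul_sup)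
  also have "\<dots> \<lesssim> f \<nabla> z \<odot> f" by (simp add: sup_mono)
  finally have "hi \<lesssim> f \<nabla> z \<odot> f" using hi_le_mul_hi[OF z] pre_trans by blast
  then have "ng (f \<nabla> z \<odot> f) \<lesssim> lo" by simp
  have "f \<nabla> z \<odot> f \<lesssim> ng ((z \<rightarrowtail> e) \<triangle> e)"
  proof (rule sup_le)
    show "z \<odot> f \<lesssim> ng ((z \<rightarrowtail> e) \<triangle> e)"
      unfolding le_ng_iff[of "z \<odot> f"] by (simp flip: im_def)
  qed simp
  then have "(z \<rightarrowtail> e) \<triangle> e \<lesssim> ng (f \<nabla> z \<odot> f)"
    by (simp only: le_ng_iff)
  also have "\<dots> \<lesssim> lo" by fact
  finally show w: "(z \<rightarrowtail> e) \<triangle> e \<lesssim> lo" .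
  \<comment> \<open>The law of M is now applied to z \<or> e: its residual into e lies below the
    meet just shown to vanish, so f \<rightarrow> (z \<or> e) is nonzero and serves as q.\<close>
  have "(z \<nabla> e) \<rightarrowtail> e \<lesssim> (z \<rightarrowtail> e) \<triangle> e"
  proof (rule le_inf)
    have *: "x \<odot> ((z \<nabla> e) \<rightarrowtail> e) \<lesssim> e" if "x \<lesssim> z \<nabla> e" for x
      using pre_trans[OF mul_mono[OF that pre_refl] mul_im] .
    show "(z \<nabla> e) \<rightarrowtail> e \<lesssim> z \<rightarrowtail> e" using * by (simp add: le_im_iff)
    show "(z \<nabla> e) \<rightarrowtail> e \<lesssim> e" by (rule pre_trans[OF e_mul2 *]) simp
  qed
  then have "\<not> (f \<rightarrowtail> (z \<nabla> e)) \<lesssim> lo" using M_cases w pre_trans by blast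
  moreover have q: "(f \<rightarrowtail> (z \<nabla> e)) \<odot> f \<lesssim> z \<nabla> e" by (metis mul_im mul_commute)
  moreover have "f \<rightarrowtail> (z \<nabla> e) \<lesssim> e" using q zf e_le_f by (meson le_e sup_le pre_trans)
  ultimately show "\<exists>q. \<not> q \<lesssim> lo \<and> q \<lesssim> e \<and> q \<odot> f \<lesssim> z \<nabla> e" by blast
qed

lemma inf_e_nonzero: assumes z: "\<not> z \<lesssim> lo" shows "\<not> z \<triangle> e \<lesssim> lo"
proof
  assume ze: "z \<triangle> e \<lesssim> lo"
  let ?v = "z \<rightarrowtail> e"
  obtain q where q: "\<not> q \<lesssim> lo" "q \<lesssim> e" "q \<odot> f \<lesssim> z \<nabla> e"
    using inf_e_zero_dual(1)[OF z ze] by blast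
  obtain p where p: "\<not> p \<lesssim> lo" "p \<lesssim> e" "p \<odot> f \<lesssim> ?v \<nabla> e"
    using inf_e_zero_dual(1)[OF inf_e_zero_dual(2,3)[OF z ze]] by blast
  \<comment> \<open>The two witnesses interact here: distributivity reduces (z \<or> e) \<and> (v
    \<or> e) to parts below e, since z \<and> v \<le> z \<cdot> v \<le> e.\<close>
  have zv: "z \<triangle> ?v \<lesssim> e" by (rule pre_trans[OF inf_le_mul mul_im])
  have "(q \<odot> p) \<odot> f \<lesssim> q \<odot> f" using p(2) by (meson mul_e1 mul_mono pre_refl pre_trans)
  moreover have "(q \<odot> p) \<odot> f \<lesssim> p \<odot> f" using q(2) by (meson e_mul1 mul_mono pre_refl pre_trans)
  ultimately have "(q \<odot> p) \<odot> f \<lesssim> (z \<nabla> e) \<triangle> (?v \<nabla> e)" using p q by (meson le_inf pre_trans)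
  also have "\<dots> \<lesssim> (z \<nabla> e) \<triangle> ?v \<nabla> (z \<nabla> e) \<triangle> e" by (rule distrib)
  also have "\<dots> \<lesssim> e"
  proof (rule sup_le)
    have "(z \<nabla> e) \<triangle> ?v \<lesssim> ?v \<triangle> (z \<nabla> e)" by (simp add: le_inf_iff)
    also have "\<dots> \<lesssim> (?v \<triangle> z) \<nabla> (?v \<triangle> e)" by (rule distrib)
    also have "\<dots> \<lesssim> e" using zv by (meson inf_le1 inf_le2 le_inf sup_le pre_trans)
    finally show "(z \<nabla> e) \<triangle> ?v \<lesssim> e" .
  qed simp
  finally show False using not_mul_f_le_e mul_nonzero p q by blast
qed

text \<open>\<open>small x\<close> says that \<open>x\<close> lies in \<open>B\<close> or is the least element.\<close>

definition small where "small x \<longleftrightarrow> \<not> (x \<rightarrowtail> e) \<lesssim> lo"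

lemma smallI: "\<lbrakk>\<not> z \<lesssim> lo; x \<odot> z \<lesssim> e\<rbrakk> \<Longrightarrow> small x"
  unfolding small_def by (meson le_im_iff pre_trans)

lemma smallE: assumes "small x" obtains z where "\<not> z \<lesssim> lo" "x \<odot> z \<lesssim> e"
  using assms mul_im unfolding small_def by blast

lemma small_mono: "\<lbrakk>small y; x \<lesssim> y\<rbrakk> \<Longrightarrow> small x"
  by (meson smallE smallI mul_mono pre_refl pre_trans)

text \<open>By contraposition f \<rightarrow> x is \<open>ng x \<rightarrowtail> e\<close>, so the
  two alternatives of \<open>M_cases\<close> are the two smallness claims.\<close>

lemma small_or: "small x \<or> small (ng x)"
proof -
  have "(f \<rightarrowtail> x) \<lesssim> ng x \<rightarrowtail> e"
    unfolding im_def by (simp add: mul_commute)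
  then show ?thesis using M_cases[of x] pre_trans unfolding small_def by blast
qed

text \<open>With x \<cdot> z \<le> e and \<not>x \<cdot> w \<le> e one gets w \<cdot> f \<le> x,
  hence (z \<cdot> w) \<cdot> f \<le> e although z \<cdot> w is nonzero.\<close>

lemma ng_not_small: assumes "small x" shows "\<not> small (ng x)"
proof
  assume "small (ng x)"
  obtain z where z: "\<not> z \<lesssim> lo" "x \<odot> z \<lesssim> e" using assms smallE by blast
  obtain w where w: "\<not> w \<lesssim> lo" "ng x \<odot> w \<lesssim> e" using \<open>small (ng x)\<close> smallE by blast
  have "w \<odot> f \<lesssim> x" using w(2) residuation[of "ng x" w e] by (simp add: mul_commute)
  then have "(z \<odot> w) \<odot> f \<lesssim> z \<odot> x" by (simp add: mul_assoc mul_mono2)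
  also have "\<dots> \<lesssim> e" using z by (simp add: mul_commute)
  finally show False using not_mul_f_le_e mul_nonzero z w by blast
qed

text \<open>This is the rule b' \<cdot> c' = 1 of skew reflections. The negations lie above z
  \<cdot> f and w \<cdot> f for nonzero z and w, and (z \<cdot> f) \<cdot> (w \<cdot> f) = (z
  \<cdot> w) \<cdot> hi.\<close>

lemma hi_le_ng_mul_ng: assumes "small x" "small y" shows "hi \<lesssim> ng x \<odot> ng y"
proof -
  obtain z where z: "\<not> z \<lesssim> lo" "x \<odot> z \<lesssim> e" using assms smallE by blast
  obtain w where w: "\<not> w \<lesssim> lo" "y \<odot> w \<lesssim> e" using assms smallE by blast
  have *: "p \<odot> f \<lesssim> ng u" if "u \<odot> p \<lesssim> e" for u p
    using that residuation[of u p e] by (simp add: mul_commute)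
  have "hi \<lesssim> (z \<odot> w) \<odot> hi" using z w by (intro hi_le_mul_hi mul_nonzero)
  also have "\<dots> = (z \<odot> f) \<odot> (w \<odot> f)" by (simp add: mul_ac)
  also have "\<dots> \<lesssim> ng x \<odot> ng y" using * z w mul_mono by blast
  finally show ?thesis .
qed

lemma not_small_hi: "\<not> small hi"
  by (metis le_hi ng_not_small small_mono)

lemma small_not_le_ng: "\<lbrakk>small x; small y\<rbrakk> \<Longrightarrow> \<not> ng x \<lesssim> y"
  using small_mono ng_not_small by blast

end

section \<open>Congruence rules and embeddings up to equivalence\<close>

context dm_preorder begin

lemma eqvI: "\<lbrakk>x \<lesssim> y; y \<lesssim> x\<rbrakk> \<Longrightarrow> x \<simeq> y"
  by (simp add: eqv_def)

lemma eqvD: assumes "x \<simeq> y" shows "x \<lesssim> y" "y \<lesssim> x"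
  using assms by (simp_all add: eqv_def)

lemma eqv_refl [simp]: "x \<simeq> x"
  by (simp add: eqv_def)

lemma eqv_sym: "x \<simeq> y \<Longrightarrow> y \<simeq> x"
  by (simp add: eqv_def)

lemma eqv_trans [trans]: "\<lbrakk>x \<simeq> y; y \<simeq> z\<rbrakk> \<Longrightarrow> x \<simeq> z"
  unfolding eqv_def by (meson pre_trans)

lemma mul_cong: "\<lbrakk>x \<simeq> x'; y \<simeq> y'\<rbrakk> \<Longrightarrow> x \<odot> y \<simeq> x' \<odot> y'"
  unfolding eqv_def by (simp add: mul_mono)

lemma inf_cong: "\<lbrakk>x \<simeq> x'; y \<simeq> y'\<rbrakk> \<Longrightarrow> x \<triangle> y \<simeq> x' \<triangle> y'"
  unfolding eqv_def by (simp add: inf_mono)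

lemma sup_cong: "\<lbrakk>x \<simeq> x'; y \<simeq> y'\<rbrakk> \<Longrightarrow> x \<nabla> y \<simeq> x' \<nabla> y'"
  unfolding eqv_def by (simp add: sup_mono)

lemma ng_cong: "x \<simeq> x' \<Longrightarrow> ng x \<simeq> ng x'"
  unfolding eqv_def by simp

lemma ng_inf_eqv: "ng (x \<triangle> y) \<simeq> ng x \<nabla> ng y"
  by (simp add: eqv_def ng_inf sup_le_iff)

lemma ng_sup_eqv: "ng (x \<nabla> y) \<simeq> ng x \<triangle> ng y"
proof -
  have "x \<nabla> y \<lesssim> ng (ng x \<triangle> ng y)"
    by (rule sup_le; subst le_ng_iff; simp)
  then have "ng x \<triangle> ng y \<lesssim> ng (x \<nabla> y)" by (subst le_ng_iff)
  then show ?thesis by (simp add: eqv_def ng_sup)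
qed

lemma ng_ng_eqv [simp]: "ng (ng x) \<simeq> x" "x \<simeq> ng (ng x)"
  by (simp_all add: eqv_def)

text \<open>An embedding of \<open>G\<close> into the quotient by \<open>\<simeq>\<close>, expressed
  on representatives so that no quotient algebra has to be formed.\<close>

definition embeds :: "('g, 'm) irl_scheme \<Rightarrow> ('g \<Rightarrow> 'a) \<Rightarrow> bool"
  where "embeds G \<phi> \<longleftrightarrow> \<phi> \<one>\<^bsub>G\<^esub> \<simeq> e \<and>
    (\<forall>x\<in>carrier G. \<phi> (\<sim>\<^bsub>G\<^esub> x) \<simeq> ng (\<phi> x)) \<and>
    (\<forall>x\<in>carrier G. \<forall>y\<in>carrier G. \<phi> (x \<otimes>\<^bsub>G\<^esub> y) \<simeq> \<phi> x \<odot> \<phi> y \<and>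
      \<phi> (x \<curlywedge>\<^bsub>G\<^esub> y) \<simeq> \<phi> x \<triangle> \<phi> y \<and> \<phi> (x \<curlyvee>\<^bsub>G\<^esub> y) \<simeq> \<phi> x \<nabla> \<phi> y) \<and>
    (\<forall>x\<in>carrier G. \<forall>y\<in>carrier G. \<phi> x \<simeq> \<phi> y \<longrightarrow> x = y)"

end

context m_preorder begin

text \<open>A copy of B among the small nonzero elements determines the rest: smallness forces the
  products of negations to be \<open>hi\<close> and separates B, B' and the bounds, while
  \<open>mix'\<close> says where meets of B with B' fall. Joins follow by De Morgan duality.\<close>

lemma skew_embeds:
  assumes "skew_dunn B I h"
    and one: "\<beta> \<one>\<^bsub>B\<^esub> \<simeq> e"
    and small: "\<And>b. b \<in> carrier B \<Longrightarrow> small (\<beta> b)"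
    and nonzero: "\<And>b. b \<in> carrier B \<Longrightarrow> \<not> \<beta> b \<lesssim> lo"
    and mult': "\<And>b c. \<lbrakk>b \<in> carrier B; c \<in> carrier B\<rbrakk> \<Longrightarrow> \<beta> b \<odot> \<beta> c \<simeq> \<beta> (b \<otimes>\<^bsub>B\<^esub> c)"
    and imp': "\<And>b c. \<lbrakk>b \<in> carrier B; c \<in> carrier B\<rbrakk> \<Longrightarrow> \<beta> b \<rightarrowtail> \<beta> c \<simeq> \<beta> (b \<rightharpoonup>\<^bsub>B\<^esub> c)"
    and wedge': "\<And>b c. \<lbrakk>b \<in> carrier B; c \<in> carrier B\<rbrakk> \<Longrightarrow> \<beta> b \<triangle> \<beta> c \<simeq> \<beta> (b \<curlywedge>\<^bsub>B\<^esub> c)"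
    and vee': "\<And>b c. \<lbrakk>b \<in> carrier B; c \<in> carrier B\<rbrakk> \<Longrightarrow> \<beta> b \<nabla> \<beta> c \<simeq> \<beta> (b \<curlyvee>\<^bsub>B\<^esub> c)"
    and mix': "\<And>b c. \<lbrakk>b \<in> carrier B; c \<in> carrier B\<rbrakk> \<Longrightarrow> \<beta> b \<triangle> ng (\<beta> c) \<simeq> \<beta> (b \<curlywedge>\<^bsub>B\<^esub> h c)"
    and inj: "\<And>b c. \<lbrakk>b \<in> carrier B; c \<in> carrier B; \<beta> b \<simeq> \<beta> c\<rbrakk> \<Longrightarrow> b = c"
  shows "embeds (skew_reflection I B) (case_skew \<beta> (\<lambda>b. ng (\<beta> b)) lo hi)"
    (is "embeds _ ?\<phi>")
proof -
  interpret skew_dunn B I h by fact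
  note mult = mult'[THEN eqv_sym] and imp = imp'[THEN eqv_sym] and wedge = wedge'[THEN eqv_sym]
    and vee = vee'[THEN eqv_sym] and mix = mix'[THEN eqv_sym]
  have lo: "lo \<odot> x \<simeq> lo" "x \<odot> lo \<simeq> lo" for x
    using lo_mul[of x] by (simp_all add: eqv_def mul_commute[of x])
  have hi: "hi \<odot> x \<simeq> hi" "x \<odot> hi \<simeq> hi" if "\<not> x \<lesssim> lo" for x
    using hi_mul[OF that] by (simp_all add: eqv_def mul_commute[of x])
  have ng_nonzero: "\<not> ng (\<beta> b) \<lesssim> lo" if "b \<in> carrier B" for b
    using small[OF that] not_small_hi by (auto dest: small_mono)
  have ng: "?\<phi> (skew_neg x) \<simeq> ng (?\<phi> x)" for x
    by (cases x) simp_all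
  have m: "?\<phi> (skew_mult B x y) \<simeq> ?\<phi> x \<odot> ?\<phi> y"
    if "x \<in> skew_carrier B" "y \<in> skew_carrier B" for x y
  proof -
    have base_copy: "ng (\<beta> (b \<rightharpoonup>\<^bsub>B\<^esub> c)) \<simeq> \<beta> b \<odot> ng (\<beta> c)" if "b \<in> carrier B" "c \<in> carrier B" for b c
      using ng_cong[OF imp[OF that]] ng_ng_eqv eqv_trans unfolding im_def by blast
    then have copy_base: "ng (\<beta> (b \<rightharpoonup>\<^bsub>B\<^esub> c)) \<simeq> ng (\<beta> c) \<odot> \<beta> b" if "b \<in> carrier B" "c \<in> carrier B" for b c
      using that by (simp add: mul_commute)
    have copy_copy: "hi \<simeq> ng (\<beta> b) \<odot> ng (\<beta> c)" if "b \<in> carrier B" "c \<in> carrier B" for b c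
      using hi_le_ng_mul_ng small that by (simp add: eqv_def)
    show ?thesis
      using that by (cases x; cases y)
        (simp_all add: lo hi[OF nonzero] hi[OF ng_nonzero] hi[OF not_hi_le_lo] eqv_sym mult base_copy copy_base copy_copy)
  qed
  have w: "?\<phi> (skew_inf x y) \<simeq> ?\<phi> x \<triangle> ?\<phi> y"
    if "x \<in> skew_carrier B" "y \<in> skew_carrier B" for x y
  proof -
    have *: "lo \<simeq> lo \<triangle> x" "lo \<simeq> x \<triangle> lo" "x \<simeq> hi \<triangle> x" "x \<simeq> x \<triangle> hi" for x
      by (simp_all add: eqv_def le_inf)
    have comm: "\<beta> (b \<curlywedge>\<^bsub>B\<^esub> h c) \<simeq> ng (\<beta> c) \<triangle> \<beta> b" if "b \<in> carrier B" "c \<in> carrier B" for b c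
      using mix[OF that] by (simp add: eqv_def le_inf_iff) (meson inf_le1 inf_le2 le_inf pre_trans)
    have copy: "ng (\<beta> (b \<curlyvee>\<^bsub>B\<^esub> c)) \<simeq> ng (\<beta> b) \<triangle> ng (\<beta> c)" if "b \<in> carrier B" "c \<in> carrier B" for b c
      using ng_cong[OF vee[OF that]] ng_sup_eqv eqv_trans by blast
    show ?thesis
      using that by (cases x; cases y) (simp_all add: * wedge mix copy comm)
  qed
  have v: "?\<phi> (skew_sup x y) \<simeq> ?\<phi> x \<nabla> ?\<phi> y"
    if "x \<in> skew_carrier B" "y \<in> skew_carrier B" for x y
  proof -
    have "?\<phi> (skew_sup x y) \<simeq> ng (?\<phi> (skew_inf (skew_neg x) (skew_neg y)))"
      unfolding skew_sup_def by (rule ng)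
    also have "\<dots> \<simeq> ng (?\<phi> (skew_neg x) \<triangle> ?\<phi> (skew_neg y))"
      using that by (intro ng_cong w) simp_all
    also have "\<dots> \<simeq> ng (ng (?\<phi> x) \<triangle> ng (?\<phi> y))"
      by (intro ng_cong inf_cong ng)
    also have "\<dots> \<simeq> ng (ng (?\<phi> x)) \<nabla> ng (ng (?\<phi> y))" by (rule ng_inf_eqv)
    also have "\<dots> \<simeq> ?\<phi> x \<nabla> ?\<phi> y" by (intro sup_cong ng_ng_eqv)
    finally show ?thesis .
  qed
  have i: "x = y" if "x \<in> skew_carrier B" "y \<in> skew_carrier B" "?\<phi> x \<simeq> ?\<phi> y" for x y
  proof -
    have [simp]: "\<not> ng (\<beta> b) \<lesssim> \<beta> c" "\<not> hi \<lesssim> \<beta> c" "\<not> hi \<lesssim> ng (\<beta> c)"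
      if "b \<in> carrier B" "c \<in> carrier B" for b c
      using small that small_not_le_ng not_small_hi small_mono nonzero[of c]
      by (blast, blast, metis le_ng_iff)
    note [simp] = nonzero ng_nonzero
    show ?thesis
      using that inj by (cases x; cases y) (auto simp: eqv_def)
  qed
  show ?thesis
    unfolding embeds_def using one ng m w v i by (simp add: wedge_S vee_S)
qed

end

section \<open>The subalgebra generated by the coatom below the identity\<close>

context m_preorder begin

definition "d = c \<rightarrowtail> e"
definition "s = d \<triangle> ng d"
definition "u = d \<triangle> f"
definition "t = e \<nabla> s"

context
  assumes c_nonzero: "\<not> c \<lesssim> lo"
begin

lemma le_mul_right: "e \<lesssim> x \<Longrightarrow> y \<lesssim> x \<odot> y"
  using mul_mono[of e x y y] e_mul2 pre_trans pre_refl by meson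

text \<open>\<open>c\<close> is idempotent, being below e and below its square. This improves the
  bound c \<cdot> d \<le> e to c, so \<open>c\<close> acts as a zero on the interval from
  \<open>c\<close> to \<open>d\<close>.\<close>

lemma c_mul_d: "c \<odot> d \<lesssim> c"
proof -
  have "c \<odot> d \<lesssim> (c \<odot> c) \<odot> d" by (rule mul_mono[OF square pre_refl])
  also have "\<dots> = c \<odot> (c \<odot> d)" by (simp only: mul_assoc)
  also have "\<dots> \<lesssim> c \<odot> e" unfolding d_def by (rule mul_mono2[OF mul_im])
  also have "\<dots> \<lesssim> c" by simp
  finally show ?thesis .
qed

lemma le_d_iff: "x \<lesssim> d \<longleftrightarrow> c \<odot> x \<lesssim> e"
  unfolding d_def by (rule le_im_iff)

lemma e_le_d [simp]: "e \<lesssim> d"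
  unfolding le_d_iff by (rule pre_trans[OF mul_e1 c_le_e])

lemma c_le_d [simp]: "c \<lesssim> d"
  by (rule pre_trans[OF c_le_e e_le_d])

lemma c_mul_le: "x \<lesssim> d \<Longrightarrow> c \<odot> x \<lesssim> c"
  by (rule pre_trans[OF mul_mono2 c_mul_d])

lemma d_mul_d: "d \<odot> d \<lesssim> d"
proof -
  have "c \<odot> (d \<odot> d) = (c \<odot> d) \<odot> d" by (simp only: mul_assoc)
  also have "\<dots> \<lesssim> c \<odot> d" by (rule mul_mono[OF c_mul_d pre_refl])
  also have "\<dots> \<lesssim> e" by (simp flip: le_d_iff)
  finally show ?thesis by (simp add: le_d_iff)
qed

lemma d_mul_le: "\<lbrakk>x \<lesssim> d; y \<lesssim> d\<rbrakk> \<Longrightarrow> x \<odot> y \<lesssim> d"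
  by (rule pre_trans[OF mul_mono d_mul_d])

lemma small_d: "small d"
proof (rule smallI[OF c_nonzero])
  show "d \<odot> c \<lesssim> e" using le_d_iff[of d] by (simp add: mul_commute)
qed

lemma mem: assumes "c \<lesssim> x" "x \<lesssim> d" shows "small x" "\<not> x \<lesssim> lo"
  using small_mono[OF small_d assms(2)] c_nonzero pre_trans[OF assms(1)] by auto

lemma c_mul_eqv: assumes "c \<lesssim> x" "x \<lesssim> d" shows "c \<odot> x \<simeq> c"
  by (rule eqvI[OF c_mul_le[OF assms(2)] pre_trans[OF square mul_mono2[OF assms(1)]]])

lemma d_mul_eqv: assumes "e \<lesssim> x" "x \<lesssim> d" shows "d \<odot> x \<simeq> d"
  using assms d_mul_le[of d x] le_mul_right[of x d] by (simp add: eqvI mul_commute)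

lemma im_eqvI: assumes "y \<odot> z \<lesssim> x" "\<And>w. y \<odot> w \<lesssim> x \<Longrightarrow> w \<lesssim> z" shows "y \<rightarrowtail> x \<simeq> z"
  using assms by (intro eqvI) (simp_all add: le_im_iff)

lemma e_im: "e \<rightarrowtail> x \<simeq> x"
  by (rule im_eqvI) (simp, meson e_mul2 pre_trans)

text \<open>Bounds residuals in the interval from \<open>c\<close> to \<open>d\<close>: in c \<cdot>
  w \<le> (c \<cdot> c) \<cdot> w one factor c may be enlarged to \<open>y\<close>, which leads to c
  \<cdot> x \<le> e.\<close>

lemma le_d_if: assumes "c \<lesssim> y" "y \<odot> w \<lesssim> x" "x \<lesssim> d" shows "w \<lesssim> d"
proof -
  have "c \<odot> w \<lesssim> (c \<odot> c) \<odot> w" by (rule mul_mono[OF square pre_refl])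
  also have "\<dots> \<lesssim> c \<odot> (y \<odot> w)" unfolding mul_assoc by (intro mul_mono2 mul_mono assms pre_refl)
  also have "\<dots> \<lesssim> c \<odot> x" by (rule mul_mono2[OF assms(2)])
  also have "\<dots> \<lesssim> e" using assms(3) le_d_iff by blast
  finally show ?thesis by (simp add: le_d_iff)
qed

lemma im_eqv_d: assumes "c \<lesssim> y" "y \<odot> d \<lesssim> x" "x \<lesssim> d" shows "y \<rightarrowtail> x \<simeq> d"
  by (rule im_eqvI[OF assms(2) le_d_if[OF assms(1) _ assms(3)]])

lemma c_im: assumes "c \<lesssim> x" "x \<lesssim> d" shows "c \<rightarrowtail> x \<simeq> d"
  by (rule im_eqv_d[OF pre_refl pre_trans[OF c_mul_d assms(1)] assms(2)])

lemma im_d: assumes "c \<lesssim> x" "x \<lesssim> d" shows "x \<rightarrowtail> d \<simeq> d"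
  by (rule im_eqv_d[OF assms(1) d_mul_le[OF assms(2) pre_refl] pre_refl])

lemma im_c: assumes "e \<lesssim> x" "x \<lesssim> d" shows "x \<rightarrowtail> c \<simeq> c"
  by (rule im_eqvI[OF c_mul_le[OF assms(2), unfolded mul_commute[of c]] pre_trans[OF le_mul_right[OF assms(1)]]])

lemma not_e_le_if: "\<not> x \<lesssim> y \<Longrightarrow> x \<odot> w \<lesssim> y \<Longrightarrow> \<not> e \<lesssim> w"
  using le_mul_right[of w x] by (metis mul_commute pre_trans)

lemma im_e: assumes "e \<lesssim> x" "x \<lesssim> d" "\<not> x \<lesssim> e" shows "x \<rightarrowtail> e \<simeq> c"
proof (rule im_eqvI)
  show "x \<odot> c \<lesssim> e" using assms le_d_iff by (simp add: mul_commute)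
  fix w assume w: "x \<odot> w \<lesssim> e"
  then have "\<not> e \<lesssim> w" using assms(3) not_e_le_if by blast
  then have "w \<triangle> e \<lesssim> c" by (rule c_greatest)
  moreover have "w \<lesssim> w \<triangle> e" by (rule le_inf[OF pre_refl pre_trans[OF le_mul_right[OF assms(1)] w]])
  ultimately show "w \<lesssim> c" by (rule pre_trans[rotated])
qed

lemma inf_eqv1: "x \<lesssim> y \<Longrightarrow> x \<triangle> y \<simeq> x" and inf_eqv2: "y \<lesssim> x \<Longrightarrow> x \<triangle> y \<simeq> y"
  by (simp_all add: eqv_def le_inf)

lemma sup_eqv1: "x \<lesssim> y \<Longrightarrow> x \<nabla> y \<simeq> y" and sup_eqv2: "y \<lesssim> x \<Longrightarrow> x \<nabla> y \<simeq> x"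
  by (simp_all add: eqv_def sup_le)

lemma s_simps [simp]: "s \<lesssim> d" "s \<lesssim> ng d" "s \<lesssim> f"
  unfolding s_def by (simp, simp, rule pre_trans[OF inf_le2 ng_antimono[OF e_le_d]])

lemma u_simps [simp]: "u \<lesssim> d" "u \<lesssim> f" "e \<lesssim> u" "s \<lesssim> u"
  unfolding u_def using s_simps by (simp_all add: le_inf)

lemma t_simps [simp]: "e \<lesssim> t" "s \<lesssim> t" "t \<lesssim> u" "t \<lesssim> d" "t \<lesssim> f"
  unfolding t_def by (simp_all add: sup_le)

lemma c_le [simp]: "c \<lesssim> s" "c \<lesssim> t" "c \<lesssim> u"
proof -
  have "c \<odot> d \<lesssim> f" by (rule pre_trans[OF c_mul_d pre_trans[OF c_le_e e_le_f]])
  then show s: "c \<lesssim> s" unfolding s_def by (simp add: le_inf le_ng_iff_mul[of _ d])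
  show "c \<lesssim> t" "c \<lesssim> u" using pre_trans[OF c_le_e] by simp_all
qed

text \<open>Multiplication by \<open>d\<close> does not leave the elements below
  \<open>ng d\<close>: from d \<cdot> d \<le> d and s \<cdot> d \<le> f it follows that (d \<cdot>
  s) \<cdot> d \<le> f.\<close>

lemma d_mul_s: "d \<odot> s \<lesssim> s"
proof -
  have *: "(d \<odot> s) \<odot> d \<lesssim> d \<odot> s"
    using mul_mono[OF d_mul_d pre_refl, of s] by (simp only: mul_ac)
  have "s \<odot> d \<lesssim> f" by (rule iffD1[OF le_ng_iff_mul s_simps(2)])
  then have "(d \<odot> s) \<odot> d \<lesssim> f" using pre_trans[OF *] by (simp only: mul_commute)
  then have "d \<odot> s \<lesssim> ng d" by (rule iffD2[OF le_ng_iff_mul])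
  moreover have "d \<odot> s \<lesssim> d" by (rule d_mul_le) simp_all
  ultimately show ?thesis by (subst (2) s_def) (rule le_inf)
qed

lemma mul_s: "x \<lesssim> d \<Longrightarrow> x \<odot> s \<lesssim> s"
  by (rule pre_trans[OF mul_mono[OF _ pre_refl] d_mul_s])

lemma mul_s_eqv: "x \<lesssim> d \<Longrightarrow> e \<lesssim> x \<or> s \<lesssim> x \<Longrightarrow> x \<odot> s \<simeq> s"
  using le_mul_right[of x s] pre_trans[OF square mul_mono[OF _ pre_refl], of s x]
  by (intro eqvI mul_s) auto

lemma s_im_eqv_d: "s \<lesssim> x \<Longrightarrow> x \<lesssim> d \<Longrightarrow> s \<rightarrowtail> x \<simeq> d"
  using pre_trans[OF d_mul_s] by (intro im_eqv_d) (simp_all add: mul_commute[of s])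

text \<open>The value does not depend on \<open>x\<close>: d \<cdot> w \<le> u gives w \<le> \<not>d
  because u \<le> f, and w \<le> d because w \<le> d \<cdot> w.\<close>

lemma d_im: assumes "s \<lesssim> x" "x \<lesssim> u" shows "d \<rightarrowtail> x \<simeq> s"
proof (rule im_eqvI)
  show "d \<odot> s \<lesssim> x" by (rule pre_trans[OF d_mul_s assms(1)])
  fix w assume w: "d \<odot> w \<lesssim> x"
  then have "d \<odot> w \<lesssim> u" by (rule pre_trans[OF _ assms(2)])
  then have "w \<odot> d \<lesssim> f" "d \<odot> w \<lesssim> d" using pre_trans[OF _ u_simps(2)] pre_trans[OF _ u_simps(1)]
    by (simp_all add: mul_commute)
  moreover have "w \<lesssim> d" by (rule pre_trans[OF le_mul_right[OF e_le_d]]) fact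
  ultimately show "w \<lesssim> s" unfolding s_def by (simp add: le_inf le_ng_iff_mul[of _ d])
qed

lemma im_s: assumes "e \<lesssim> x" "x \<lesssim> d" shows "x \<rightarrowtail> s \<simeq> s"
  by (rule im_eqvI[OF mul_s[OF assms(2)] pre_trans[OF le_mul_right[OF assms(1)]]])

text \<open>Above \<open>s\<close>, the element \<open>t\<close> is a second identity, since its
  part \<open>s\<close> contributes only x \<cdot> s \<le> s \<le> x.\<close>

lemma t_mul: assumes "x \<lesssim> d" "s \<lesssim> x" shows "t \<odot> x \<simeq> x"
proof (rule eqvI)
  have "x \<odot> t \<lesssim> x \<odot> e \<nabla> x \<odot> s" unfolding t_def by (rule mul_sup)
  also have "\<dots> \<lesssim> x" by (rule sup_le[OF mul_e1 pre_trans[OF mul_s[OF assms(1)] assms(2)]])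
  finally show "t \<odot> x \<lesssim> x" by (simp add: mul_commute)
qed (simp add: le_mul_right)

lemma t_im: assumes "x \<lesssim> d" "s \<lesssim> x" shows "t \<rightarrowtail> x \<simeq> x"
  by (rule im_eqvI[OF eqvD(1)[OF t_mul[OF assms]] pre_trans[OF le_mul_right[OF t_simps(1)]]])

text \<open>It is enough to bring \<open>w\<close> below \<open>s\<close>, as then w \<le> w \<cdot>
  w \<le> s \<cdot> w \<le> c. Since \<open>s\<close> absorbs \<open>d\<close>, also s \<cdot> (d
  \<cdot> w) \<le> c; so e is not below d \<cdot> w, and \<open>le_f_if\<close> turns this into w
  \<le> \<not>d.\<close>

lemma s_im_c: assumes "\<not> s \<lesssim> c" shows "s \<rightarrowtail> c \<simeq> c"
proof (rule im_eqvI)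
  show "s \<odot> c \<lesssim> c" using c_mul_le[of s] by (simp add: mul_commute)
  fix w assume w: "s \<odot> w \<lesssim> c"
  have "s \<odot> (d \<odot> w) \<lesssim> c"
    using pre_trans[OF mul_mono[OF d_mul_s pre_refl, of w] w] by (simp add: mul_ac)
  then have "\<not> e \<lesssim> d \<odot> w" using assms not_e_le_if by blast
  then have "w \<odot> d \<lesssim> f" by (simp add: le_f_if mul_commute)
  moreover have "w \<lesssim> d" using le_d_if[OF c_le(1) w] by simp
  ultimately have "w \<lesssim> s" unfolding s_def by (simp add: le_inf le_ng_iff_mul[of _ d])
  then have "w \<odot> w \<lesssim> s \<odot> w" by (simp add: mul_mono)
  then show "w \<lesssim> c" using pre_trans[OF pre_trans[OF square]] w by blast
qed

lemma d_inf_ng_u_le: "d \<triangle> ng u \<lesssim> t"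
proof -
  have "d \<triangle> ng u \<lesssim> d \<triangle> (ng d \<nabla> e)"
    unfolding u_def by (intro inf_mono pre_refl pre_trans[OF ng_inf] sup_mono ng_ng1)
  also have "\<dots> \<lesssim> (d \<triangle> ng d) \<nabla> (d \<triangle> e)" by (rule distrib)
  also have "\<dots> \<lesssim> t" unfolding t_def s_def by (rule sup_le[OF sup_ge2 pre_trans[OF inf_le2 sup_ge1]])
  finally show ?thesis .
qed

lemma t_mul_u: "t \<odot> u \<lesssim> u"
  using t_mul[of u] by (simp add: eqv_def)

text \<open>Complementation relative to \<open>d\<close> will be the map \<open>h\<close> of the
  skew reflection. Here and in the next lemmas it is seen to exchange \<open>t\<close> and
  \<open>u\<close> and to send \<open>s\<close> and \<open>c\<close> to \<open>d\<close>.\<close>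

lemma d_inf_ng_u: "d \<triangle> ng u \<simeq> t"
  using d_inf_ng_u_le pre_trans[OF t_mul_u u_simps(2)]
  by (simp add: eqv_def le_inf le_ng_iff_mul[of _ u])

lemma u_im_u: "u \<rightarrowtail> u \<simeq> t"
proof (rule im_eqvI)
  show "u \<odot> t \<lesssim> u" using t_mul_u by (simp add: mul_commute)
  fix w assume w: "u \<odot> w \<lesssim> u"
  then have "w \<odot> u \<lesssim> f" using pre_trans[OF _ u_simps(2)] by (simp add: mul_commute)
  moreover have "w \<lesssim> d" by (rule pre_trans[OF pre_trans[OF le_mul_right[OF u_simps(3)] w] u_simps(1)])
  ultimately have "w \<lesssim> d \<triangle> ng u" by (simp add: le_inf le_ng_iff_mul[of _ u])
  then show "w \<lesssim> t" by (rule pre_trans[OF _ d_inf_ng_u_le])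
qed

lemma d_inf_ng_t: "d \<triangle> ng t \<simeq> u"
proof (rule eqvI)
  show "d \<triangle> ng t \<lesssim> u" unfolding u_def by (rule inf_mono) simp_all
  have "u \<odot> t \<lesssim> f" using pre_trans[OF t_mul_u u_simps(2)] by (simp add: mul_commute)
  then show "u \<lesssim> d \<triangle> ng t" by (simp add: le_inf le_ng_iff_mul[of _ t])
qed

lemma d_inf_ng_s: "d \<triangle> ng s \<simeq> d"
  using s_simps(2) by (intro inf_eqv1) (simp add: le_ng_iff)

lemma d_inf_ng_c: "d \<triangle> ng c \<simeq> d"
  using pre_trans[OF c_le(1) s_simps(2)] le_ng_iff[of c] by (intro inf_eqv1) blast

section \<open>The generated elements when \<open>d\<close> is not below f\<close>

context
  assumes d_not_le_f: "\<not> d \<lesssim> f"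
begin

lemma not_e_le_ng_d: "\<not> e \<lesssim> ng d"
  using d_not_le_f by (simp add: le_ng_iff[of e])

lemma not_e_le_s: "\<not> e \<lesssim> s"
  using not_e_le_ng_d pre_trans[OF _ s_simps(2)] by blast

lemma s_inf_e: "s \<triangle> e \<lesssim> c"
  using not_e_le_s by (rule c_greatest)

lemma not_t_le_e: "\<not> s \<lesssim> c \<Longrightarrow> \<not> t \<lesssim> e"
  using pre_trans[OF le_inf[OF pre_refl pre_trans[OF t_simps(2)]] s_inf_e] by blast

text \<open>s \<cdot> w \<le> e already forces s \<cdot> w \<le> s \<and> e \<le> c, which reduces
  the claim to \<open>s_im_c\<close>.\<close>

lemma s_im_e: assumes "\<not> s \<lesssim> c" shows "s \<rightarrowtail> e \<simeq> c"
proof (rule im_eqvI)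
  show "s \<odot> c \<lesssim> e" using le_d_iff[of s] by (simp add: mul_commute)
  fix w assume w: "s \<odot> w \<lesssim> e"
  have "s \<odot> w \<lesssim> s \<odot> (s \<odot> w)" using mul_mono[OF square pre_refl] by (simp add: mul_assoc)
  also have "\<dots> \<lesssim> s \<odot> e" by (rule mul_mono2[OF w])
  also have "\<dots> \<lesssim> s" by simp
  finally have "s \<odot> w \<lesssim> s" .
  then have "s \<odot> w \<lesssim> c" by (rule pre_trans[OF le_inf[OF _ w] s_inf_e])
  then have "w \<lesssim> s \<rightarrowtail> c" by (simp add: le_im_iff)
  then show "w \<lesssim> c" by (rule pre_trans[OF _ eqvD(1)[OF s_im_c[OF assms]]])
qed

text \<open>Any such \<open>w\<close> is below t = e \<or> s and not above e; distributivity splits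
  it into a part below c \<le> s and a part below \<open>s\<close>.\<close>

lemma u_im_t: assumes "\<not> u \<lesssim> t" shows "u \<rightarrowtail> t \<simeq> s"
proof (rule im_eqvI)
  show "u \<odot> s \<lesssim> t" by (rule pre_trans[OF mul_s[OF u_simps(1)] t_simps(2)])
  fix w assume w: "u \<odot> w \<lesssim> t"
  then have "\<not> e \<lesssim> w" using assms not_e_le_if by blast
  then have "w \<triangle> e \<lesssim> c" by (rule c_greatest)
  then have *: "(w \<triangle> e) \<nabla> (w \<triangle> s) \<lesssim> s" by (rule sup_le[OF pre_trans[OF _ c_le(1)] inf_le2])
  have "w \<lesssim> t" by (rule pre_trans[OF le_mul_right[OF u_simps(3)] w])
  then have "w \<lesssim> w \<triangle> (e \<nabla> s)" unfolding t_def by (simp add: le_inf)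
  also have "\<dots> \<lesssim> (w \<triangle> e) \<nabla> (w \<triangle> s)" by (rule distrib)
  also have "\<dots> \<lesssim> s" by fact
  finally show "w \<lesssim> s" .
qed

text \<open>u \<cdot> u \<le> f is impossible, as it would put \<open>u\<close> below d \<and>
  \<not>u \<le> t. So the negation of u \<cdot> u meets e below \<open>c\<close>; negated, this
  reads \<not>c \<le> u \<cdot> u \<or> f, and meeting with \<open>d\<close> leaves d \<le> u
  \<cdot> u \<or> u = u \<cdot> u.\<close>

lemma u_mul_u: assumes "\<not> u \<lesssim> t" shows "u \<odot> u \<simeq> d"
proof (rule eqvI)
  let ?v = "u \<odot> u"
  have "\<not> ?v \<lesssim> f"
  proof
    assume "?v \<lesssim> f"
    then have "u \<lesssim> d \<triangle> ng u" by (simp add: le_inf le_ng_iff_mul[of _ u])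
    then show False using assms pre_trans[OF _ d_inf_ng_u_le] by blast
  qed
  then have "\<not> e \<lesssim> ng ?v" by (simp add: le_ng_iff[of e])
  then have "ng ?v \<triangle> e \<lesssim> c" by (rule c_greatest)
  then have "ng c \<lesssim> ng (ng ?v \<triangle> e)" by simp
  also have "\<dots> \<lesssim> ?v \<nabla> f" by (rule pre_trans[OF ng_inf sup_mono[OF ng_ng1 pre_refl]])
  finally have "d \<triangle> ng c \<lesssim> d \<triangle> (?v \<nabla> f)" by (simp add: inf_mono)
  also have "\<dots> \<lesssim> (d \<triangle> ?v) \<nabla> u" unfolding u_def by (rule distrib)
  also have "\<dots> \<lesssim> ?v" by (simp add: sup_le square)
  finally show "d \<lesssim> ?v" by (rule pre_trans[OF eqvD(2)[OF d_inf_ng_c]])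
qed (simp add: d_mul_le)

end
end
end

section \<open>The Dunn monoids\<close>

text \<open>The default values \<open>Dbot\<close> here and \<open>Dt\<close> in
  \<open>delt_sup\<close> are the meet and the join of \<open>De\<close> and \<open>Ds\<close>, the
  only incomparable pair in any of the five carriers.\<close>

definition delt_inf :: "delt \<Rightarrow> delt \<Rightarrow> delt"
  where "delt_inf x y = (if delt_le x y then x else if delt_le y x then y else Dbot)"

definition delt_sup :: "delt \<Rightarrow> delt \<Rightarrow> delt"
  where "delt_sup x y = (if delt_le x y then y else if delt_le y x then x else Dt)"

text \<open>A closed form for the residual that \<open>dunn_on\<close> introduces by description.
  The carrier is consulted only for its greatest element, the value at
  \<open>x = Dbot\<close>.\<close>

definition delt_imp :: "delt set \<Rightarrow> delt \<Rightarrow> delt \<Rightarrow> delt"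
  where "delt_imp D x y =
    (if x = Dbot then if Dtop \<in> D then Dtop else De
     else if x = De \<or> y = Dbot \<or> y = Dtop then y
     else if y = De then Dbot
     else if y = Da then if x = Da then De else Dbot
     else if x = Ds then Dtop
     else if x = Dt then y
     else if x = Du \<and> y = Du then Dt
     else Ds)"

definition delt_carriers :: "delt set set"
  where "delt_carriers = {{Dbot, De}, {Dbot, De, Dtop}, {Dbot, De, Da, Dtop},
    {Dbot, De, Ds, Dt, Dtop}, {Dbot, De, Ds, Dt, Du, Dtop}}"

lemma delt_le_refl: "delt_le x x"
  by (simp add: delt_le_def)

lemma delt_le_antisym: "\<lbrakk>delt_le x y; delt_le y x\<rbrakk> \<Longrightarrow> x = y"
  by (auto simp: delt_le_def)

lemma delt_mult_commute: "delt_mult x y = delt_mult y x"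
  by (auto simp: delt_mult_def)

lemma delt_mult_assoc: "delt_mult (delt_mult x y) z = delt_mult x (delt_mult y z)"
  by (cases x; cases y; cases z) (simp_all add: delt_mult_def)

lemma delt_mult_De: "delt_mult De x = x" "delt_mult x De = x"
  by (auto simp: delt_mult_def)

lemma delt_square: "delt_le x (delt_mult x x)"
  by (auto simp: delt_le_def delt_mult_def)

lemma delt_closed:
  assumes "D \<in> delt_carriers" "x \<in> D" "y \<in> D"
  shows "delt_mult x y \<in> D" "delt_inf x y \<in> D" "delt_sup x y \<in> D" "delt_imp D x y \<in> D"
proof -
  have "\<forall>D\<in>delt_carriers. \<forall>x\<in>D. \<forall>y\<in>D. delt_mult x y \<in> D \<and> delt_inf x y \<in> D \<and> delt_sup x y \<in> D \<and> delt_imp D x y \<in> D"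
    by code_simp
  with assms show "delt_mult x y \<in> D" "delt_inf x y \<in> D" "delt_sup x y \<in> D" "delt_imp D x y \<in> D"
    by blast+
qed

lemma delt_lattice:
  assumes "D \<in> delt_carriers" "x \<in> D" "y \<in> D" "z \<in> D"
  shows delt_inf_iff: "delt_le z (delt_inf x y) \<longleftrightarrow> delt_le z x \<and> delt_le z y"
    and delt_sup_iff: "delt_le (delt_sup x y) z \<longleftrightarrow> delt_le x z \<and> delt_le y z"
    and delt_distrib: "delt_inf x (delt_sup y z) = delt_sup (delt_inf x y) (delt_inf x z)"
    and delt_assoc: "delt_inf (delt_inf x y) z = delt_inf x (delt_inf y z)"
      "delt_sup (delt_sup x y) z = delt_sup x (delt_sup y z)"
proof -
  have *:
    "\<forall>D\<in>delt_carriers. \<forall>x\<in>D. \<forall>y\<in>D. \<forall>z\<in>D. delt_le z (delt_inf x y) \<longleftrightarrow> delt_le z x \<and> delt_le z y"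
    "\<forall>D\<in>delt_carriers. \<forall>x\<in>D. \<forall>y\<in>D. \<forall>z\<in>D. delt_le (delt_sup x y) z \<longleftrightarrow> delt_le x z \<and> delt_le y z"
    "\<forall>D\<in>delt_carriers. \<forall>x\<in>D. \<forall>y\<in>D. \<forall>z\<in>D. delt_inf x (delt_sup y z) = delt_sup (delt_inf x y) (delt_inf x z)"
    "\<forall>D\<in>delt_carriers. \<forall>x\<in>D. \<forall>y\<in>D. \<forall>z\<in>D. delt_inf (delt_inf x y) z = delt_inf x (delt_inf y z)"
    "\<forall>D\<in>delt_carriers. \<forall>x\<in>D. \<forall>y\<in>D. \<forall>z\<in>D. delt_sup (delt_sup x y) z = delt_sup x (delt_sup y z)"
    by code_simp+
  show "delt_le z (delt_inf x y) \<longleftrightarrow> delt_le z x \<and> delt_le z y" using *(1) assms by blast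
  show "delt_le (delt_sup x y) z \<longleftrightarrow> delt_le x z \<and> delt_le y z" using *(2) assms by blast
  show "delt_inf x (delt_sup y z) = delt_sup (delt_inf x y) (delt_inf x z)" using *(3) assms by blast
  show "delt_inf (delt_inf x y) z = delt_inf x (delt_inf y z)" using *(4) assms by blast
  show "delt_sup (delt_sup x y) z = delt_sup x (delt_sup y z)" using *(5) assms by blast
qed

lemma delt_residuation:
  assumes "D \<in> delt_carriers" "x \<in> D" "y \<in> D" "z \<in> D"
  shows "delt_le (delt_mult x y) z \<longleftrightarrow> delt_le y (delt_imp D x z)"
proof -
  have "\<forall>D\<in>delt_carriers. \<forall>x\<in>D. \<forall>y\<in>D. \<forall>z\<in>D. delt_le (delt_mult x y) z \<longleftrightarrow> delt_le y (delt_imp D x z)"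
    by code_simp
  with assms show ?thesis by blast
qed

lemma delt_inf_sup_absorb: "delt_inf x (delt_sup x y) = x" "delt_sup x (delt_inf x y) = x"
  if "D \<in> delt_carriers" "x \<in> D" "y \<in> D"
proof -
  have "\<forall>D\<in>delt_carriers. \<forall>x\<in>D. \<forall>y\<in>D. delt_inf x (delt_sup x y) = x \<and> delt_sup x (delt_inf x y) = x"
    by code_simp
  with that show "delt_inf x (delt_sup x y) = x" "delt_sup x (delt_inf x y) = x"
    by blast+
qed

lemma delt_commute: "delt_inf x y = delt_inf y x" "delt_sup x y = delt_sup y x"
  by (auto simp: delt_inf_def delt_sup_def dest: delt_le_antisym)

lemma dunn_on_simps [simp]:
  "carrier (dunn_on D) = D" "mult (dunn_on D) = delt_mult" "\<one>\<^bsub>dunn_on D\<^esub> = De"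
  by (simp_all add: dunn_on_def)

context
  fixes D
  assumes D: "D \<in> delt_carriers"
begin

lemma wedge_dunn_on: "\<lbrakk>x \<in> D; y \<in> D\<rbrakk> \<Longrightarrow> x \<curlywedge>\<^bsub>dunn_on D\<^esub> y = delt_inf x y"
  unfolding dunn_on_def delt_order_def using D
  by simp (rule meet_eqI, auto simp: delt_inf_iff delt_sup_iff delt_le_refl delt_closed intro: delt_le_antisym)

lemma vee_dunn_on: "\<lbrakk>x \<in> D; y \<in> D\<rbrakk> \<Longrightarrow> x \<curlyvee>\<^bsub>dunn_on D\<^esub> y = delt_sup x y"
  unfolding dunn_on_def delt_order_def using D
  by simp (rule join_eqI, auto simp: delt_inf_iff delt_sup_iff delt_le_refl delt_closed intro: delt_le_antisym)

lemma imp_dunn_on: assumes "x \<in> D" "y \<in> D" shows "x \<rightharpoonup>\<^bsub>dunn_on D\<^esub> y = delt_imp D x y"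
proof -
  have "(THE z. greatest (delt_order D) z {z \<in> D. delt_le (delt_mult x z) y}) = delt_imp D x y"
  proof (rule the_equality)
    show "greatest (delt_order D) (delt_imp D x y) {z \<in> D. delt_le (delt_mult x z) y}"
      using assms D by (auto simp: greatest_def delt_order_def delt_residuation delt_closed delt_le_refl)
    show "z = delt_imp D x y" if "greatest (delt_order D) z {z \<in> D. delt_le (delt_mult x z) y}" for z
      using that assms D unfolding greatest_def delt_order_def
      by (auto simp: delt_residuation delt_closed delt_le_refl intro!: delt_le_antisym)
  qed
  then show ?thesis by (simp add: dunn_on_def)
qed

lemma below_dunn_on: "\<lbrakk>x \<in> D; y \<in> D\<rbrakk> \<Longrightarrow> x \<preceq>\<^bsub>dunn_on D\<^esub> y \<longleftrightarrow> delt_le x y"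
  by (auto simp: below_def wedge_dunn_on delt_inf_def delt_le_refl dest: delt_le_antisym)
    (auto simp: delt_le_def)

lemmas dunn_on_ops = wedge_dunn_on vee_dunn_on imp_dunn_on below_dunn_on

lemma dunn_monoid_dunn_on: "dunn_monoid (dunn_on D)"
proof -
  have De: "De \<in> D" using D by (auto simp: delt_carriers_def)
  note closed = delt_closed[OF D]
  show ?thesis
    by (unfold_locales)
      (auto simp: dunn_on_ops closed De delt_mult_assoc delt_mult_De delt_square delt_inf_sup_absorb[OF D]
        delt_assoc[OF D] delt_distrib[OF D] delt_residuation[OF D] intro: delt_mult_commute delt_commute)
qed

end

text \<open>The largest \<open>z\<close> in \<open>D\<close> such that \<open>z \<cdot> x\<close> differs from \<open>\<top>\<close>.\<close>

definition delt_h :: "delt set \<Rightarrow> delt \<Rightarrow> delt"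
  where "delt_h D x =
    (if x = Dbot \<or> x = Ds then Dtop
     else if x = Dtop then if Ds \<in> D then Ds else Dbot
     else if x = Du then Dt
     else if x = Da then De
     else if Du \<in> D then Du else if Dt \<in> D then Dt else if Da \<in> D then Da else De)"

text \<open>The conditions of \<open>skew_dunn\<close> on \<open>I\<close> and \<open>h\<close>, as
  bounded quantifications over a finite carrier that can be decided by evaluation.\<close>

definition skew_cond :: "delt set \<Rightarrow> delt set \<Rightarrow> (delt \<Rightarrow> delt) \<Rightarrow> bool"
  where "skew_cond D I h \<longleftrightarrow> De \<in> I \<and> (\<forall>a\<in>D. h a \<in> D) \<and>
    (\<forall>a\<in>D. \<forall>b\<in>D. delt_mult a b \<in> I \<longleftrightarrow> delt_le a (h b)) \<and>
    (\<forall>a\<in>D. \<forall>b\<in>D. \<forall>c\<in>D.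
      (delt_le (delt_inf b (h a)) c \<longrightarrow> delt_le b (h (delt_inf a (h c))) \<longrightarrow> delt_le b c) \<and>
      (delt_le (delt_inf b a) (h c) \<longrightarrow> delt_le b (h (delt_inf c (h a))) \<longrightarrow> delt_le b (h c)) \<and>
      (delt_le (delt_inf b (h a)) (h c) \<longrightarrow> delt_le b (h (delt_inf a c)) \<longrightarrow> delt_le b (h c)))"

lemma skew_dunn_dunn_on:
  assumes D: "D \<in> delt_carriers" and "skew_cond D I h"
  shows "skew_dunn (dunn_on D) I h"
proof -
  interpret dunn_monoid "dunn_on D" by (rule dunn_monoid_dunn_on[OF D])
  show ?thesis
  proof unfold_locales
    fix a b c assume abc: "a \<in> carrier (dunn_on D)" "b \<in> carrier (dunn_on D)" "c \<in> carrier (dunn_on D)"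
    then have abc: "a \<in> D" "b \<in> D" "c \<in> D" by simp_all
    have h_closed: "h x \<in> D" if "x \<in> D" for x
      using assms(2) that unfolding skew_cond_def by blast
    note [simp] = dunn_on_ops[OF D] delt_closed[OF D] h_closed abc
    note * = assms(2)[unfolded skew_cond_def, THEN conjunct2, THEN conjunct2, THEN conjunct2,
        THEN bspec, OF abc(1), THEN bspec, OF abc(2), THEN bspec, OF abc(3)]
    let ?B = "dunn_on D"
    show "b \<preceq>\<^bsub>?B\<^esub> c" if "b \<curlywedge>\<^bsub>?B\<^esub> h a \<preceq>\<^bsub>?B\<^esub> c" "b \<preceq>\<^bsub>?B\<^esub> h (a \<curlywedge>\<^bsub>?B\<^esub> h c)"
      using that * by simp
    show "b \<preceq>\<^bsub>?B\<^esub> h c" if "b \<curlywedge>\<^bsub>?B\<^esub> a \<preceq>\<^bsub>?B\<^esub> h c" "b \<preceq>\<^bsub>?B\<^esub> h (c \<curlywedge>\<^bsub>?B\<^esub> h a)"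
      using that * by simp
    show "b \<preceq>\<^bsub>?B\<^esub> h c" if "b \<curlywedge>\<^bsub>?B\<^esub> h a \<preceq>\<^bsub>?B\<^esub> h c" "b \<preceq>\<^bsub>?B\<^esub> h (a \<curlywedge>\<^bsub>?B\<^esub> c)"
      using that * by simp
  qed (use assms(2) in \<open>simp_all add: skew_cond_def below_dunn_on[OF D]\<close>)
qed

text \<open>In the reflections G1 and G2 every b is below every c', so \<open>h\<close> is constant
  with the greatest element of B as its value.\<close>

lemma skew_dunn_G:
  shows skew_dunn_G1: "skew_dunn two_plus {Dbot, De} (\<lambda>_. De)"
    and skew_dunn_G2: "skew_dunn S3_plus {Dbot, De, Dtop} (\<lambda>_. Dtop)"
    and skew_dunn_G3: "skew_dunn S3_plus {Dbot, De} (delt_h {Dbot, De, Dtop})"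
    and skew_dunn_G4: "skew_dunn C4_plus {Dbot, De, Da} (delt_h {Dbot, De, Da, Dtop})"
    and skew_dunn_G5: "skew_dunn T5 {Dbot, De, Ds, Dt} (delt_h {Dbot, De, Ds, Dt, Dtop})"
    and skew_dunn_G6: "skew_dunn T6 {Dbot, De, Ds, Dt, Du} (delt_h {Dbot, De, Ds, Dt, Du, Dtop})"
  unfolding two_plus_def S3_plus_def C4_plus_def T5_def T6_def
  by (rule skew_dunn_dunn_on, simp add: delt_carriers_def, code_simp)+

lemma G_eqs:
  shows G1_eq: "G1 = skew_reflection {Dbot, De} two_plus"
    and G2_eq: "G2 = skew_reflection {Dbot, De, Dtop} S3_plus"
    and G3_eq: "G3 = skew_reflection {Dbot, De} S3_plus"
    and G4_eq: "G4 = skew_reflection {Dbot, De, Da} C4_plus"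
    and G5_eq: "G5 = skew_reflection {Dbot, De, Ds, Dt} T5"
    and G6_eq: "G6 = skew_reflection {Dbot, De, Ds, Dt, Du} T6"
  by (auto simp: G1_def G2_def G3_def G4_def G5_def G6_def reflection_def
      two_plus_def S3_plus_def C4_plus_def T5_def T6_def intro!: arg_cong2[of _ _ _ _ skew_reflection])

lemma G_in_class_M: "G \<in> {G1, G2, G3, G4, G5, G6} \<Longrightarrow> G \<in> class_M"
  using skew_dunn_G[THEN skew_dunn.S_in_class_M] by (auto simp: G_eqs)

section \<open>Embedding one of the six algebras when c is nonzero\<close>

context m_preorder begin

context
  assumes c_nonzero: "\<not> c \<lesssim> lo"
begin

text \<open>Lying between \<open>c\<close> and \<open>d\<close> makes the images small and nonzero.
  Below \<open>d\<close>, a meet with a negation depends only on the complement relative to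
  \<open>d\<close>, so \<open>h\<close> has to be compared with that one-place map only.\<close>

lemma dunn_on_embeds:
  assumes D: "D \<in> delt_carriers" and "skew_dunn (dunn_on D) I h"
    and bounds: "\<forall>x\<in>D. c \<lesssim> \<beta> x \<and> \<beta> x \<lesssim> d"
    and one: "\<beta> De = e"
    and ops: "\<forall>x\<in>D. \<forall>y\<in>D. \<beta> x \<odot> \<beta> y \<simeq> \<beta> (delt_mult x y) \<and> \<beta> x \<rightarrowtail> \<beta> y \<simeq> \<beta> (delt_imp D x y) \<and>
      \<beta> x \<triangle> \<beta> y \<simeq> \<beta> (delt_inf x y) \<and> \<beta> x \<nabla> \<beta> y \<simeq> \<beta> (delt_sup x y)"
    and h: "\<forall>x\<in>D. d \<triangle> ng (\<beta> x) \<simeq> \<beta> (h x)"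
    and reflects: "\<forall>x\<in>D. \<forall>y\<in>D. delt_le x y \<or> \<not> \<beta> x \<lesssim> \<beta> y"
  shows "\<exists>\<phi>. embeds (skew_reflection I (dunn_on D)) \<phi>"
proof (rule exI, rule skew_embeds)
  show "skew_dunn (dunn_on D) I h" by fact
  then have h_closed: "h x \<in> D" if "x \<in> D" for x
    using skew_dunn.h_closed that by fastforce
  fix x y assume xy: "x \<in> carrier (dunn_on D)" "y \<in> carrier (dunn_on D)"
  have "\<beta> x \<triangle> ng (\<beta> y) \<simeq> \<beta> x \<triangle> (d \<triangle> ng (\<beta> y))"
  proof (rule eqvI)
    have "\<beta> x \<lesssim> d" using bounds xy by simp
    then have "\<beta> x \<triangle> ng (\<beta> y) \<lesssim> d" by (rule pre_trans[OF inf_le1])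
    then show "\<beta> x \<triangle> ng (\<beta> y) \<lesssim> \<beta> x \<triangle> (d \<triangle> ng (\<beta> y))"
      by (simp add: le_inf)
  qed (simp add: inf_mono)
  also have "\<dots> \<simeq> \<beta> x \<triangle> \<beta> (h y)" using h xy by (simp add: inf_cong)
  also have "\<dots> \<simeq> \<beta> (delt_inf x (h y))" using ops xy h_closed by simp
  finally show "\<beta> x \<triangle> ng (\<beta> y) \<simeq> \<beta> (x \<curlywedge>\<^bsub>dunn_on D\<^esub> h y)"
    using xy h_closed by (simp add: wedge_dunn_on[OF D])
  show "x = y" if "\<beta> x \<simeq> \<beta> y"
    using reflects xy that by (simp add: eqv_def) (meson delt_le_antisym)
qed (use D bounds ops mem[OF c_nonzero] one in \<open>simp_all add: dunn_on_ops\<close>)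

lemma products:
  "e \<odot> x \<simeq> x" "x \<odot> e \<simeq> x"
  "\<lbrakk>c \<lesssim> x; x \<lesssim> d\<rbrakk> \<Longrightarrow> c \<odot> x \<simeq> c" "\<lbrakk>c \<lesssim> x; x \<lesssim> d\<rbrakk> \<Longrightarrow> x \<odot> c \<simeq> c"
  "\<lbrakk>e \<lesssim> x; x \<lesssim> d\<rbrakk> \<Longrightarrow> d \<odot> x \<simeq> d" "\<lbrakk>e \<lesssim> x; x \<lesssim> d\<rbrakk> \<Longrightarrow> x \<odot> d \<simeq> d"
  "\<lbrakk>x \<lesssim> d; e \<lesssim> x \<or> s \<lesssim> x\<rbrakk> \<Longrightarrow> x \<odot> s \<simeq> s" "\<lbrakk>x \<lesssim> d; e \<lesssim> x \<or> s \<lesssim> x\<rbrakk> \<Longrightarrow> s \<odot> x \<simeq> s"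
  "\<lbrakk>x \<lesssim> d; s \<lesssim> x\<rbrakk> \<Longrightarrow> t \<odot> x \<simeq> x" "\<lbrakk>x \<lesssim> d; s \<lesssim> x\<rbrakk> \<Longrightarrow> x \<odot> t \<simeq> x"
  by (simp add: eqv_def)
    (simp add: eqv_def,
     (simp add: c_nonzero c_mul_eqv d_mul_eqv mul_s_eqv t_mul mul_commute[of _ c] mul_commute[of _ d]
       mul_commute[of s] mul_commute[of _ t])+)

lemma residuals:
  "e \<rightarrowtail> x \<simeq> x"
  "\<lbrakk>c \<lesssim> x; x \<lesssim> d\<rbrakk> \<Longrightarrow> c \<rightarrowtail> x \<simeq> d"
  "\<lbrakk>c \<lesssim> x; x \<lesssim> d\<rbrakk> \<Longrightarrow> x \<rightarrowtail> d \<simeq> d"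
  "\<lbrakk>e \<lesssim> x; x \<lesssim> d\<rbrakk> \<Longrightarrow> x \<rightarrowtail> c \<simeq> c"
  "\<lbrakk>e \<lesssim> x; x \<lesssim> d; \<not> x \<lesssim> e\<rbrakk> \<Longrightarrow> x \<rightarrowtail> e \<simeq> c"
  "\<lbrakk>e \<lesssim> x; x \<lesssim> d\<rbrakk> \<Longrightarrow> x \<rightarrowtail> s \<simeq> s"
  "\<lbrakk>s \<lesssim> x; x \<lesssim> d\<rbrakk> \<Longrightarrow> s \<rightarrowtail> x \<simeq> d"
  "\<lbrakk>s \<lesssim> x; x \<lesssim> u\<rbrakk> \<Longrightarrow> d \<rightarrowtail> x \<simeq> s"
  "\<lbrakk>x \<lesssim> d; s \<lesssim> x\<rbrakk> \<Longrightarrow> t \<rightarrowtail> x \<simeq> x"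
  by (simp_all add: c_nonzero e_im c_im im_d im_c im_e im_s s_im_eqv_d d_im t_im)

lemmas lattice_eqvs = inf_eqv1 inf_eqv2 sup_eqv1 sup_eqv2

lemmas delt_op_defs = delt_mult_def delt_inf_def delt_sup_def delt_imp_def delt_le_def delt_h_def

lemma not_le_if_not_le_e: "\<lbrakk>e \<lesssim> x; \<not> e \<lesssim> y\<rbrakk> \<Longrightarrow> \<not> x \<lesssim> y"
  using pre_trans by blast

lemma G1_embeds: assumes "d \<lesssim> e" shows "\<exists>\<phi>. embeds G1 \<phi>"
proof -
  have d: "x \<simeq> e" if "x \<simeq> d" for x
    using that assms e_le_d[OF c_nonzero] pre_trans[of x d e] pre_trans[of e d x] by (simp add: eqv_def)
  have f: "d \<lesssim> f" by (rule pre_trans[OF assms e_le_f])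
  show ?thesis
    unfolding G1_eq two_plus_def
    by (rule dunn_on_embeds[OF _ skew_dunn_G1[unfolded two_plus_def], where \<beta> = "\<lambda>x. if x = De then e else c"])
      (simp_all add: delt_carriers_def c_nonzero products residuals lattice_eqvs d f d_inf_ng_c delt_op_defs)
qed

lemma G2_embeds: assumes "\<not> d \<lesssim> e" "d \<lesssim> f" shows "\<exists>\<phi>. embeds G2 \<phi>"
proof -
  \<comment> \<open>This gives d \<le> \<not>d, hence every image lies below every negated image, as
    the choice I = B of a reflection requires.\<close>
  have "d \<odot> d \<lesssim> f" using d_mul_d[OF c_nonzero] assms(2) by (rule pre_trans)
  then have "d \<lesssim> ng d" by (rule iffD2[OF le_ng_iff_mul])
  moreover have "\<not> d \<lesssim> c" using not_le_if_not_le_e c_nonzero by simp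
  ultimately show ?thesis
    unfolding G2_eq S3_plus_def
    by (intro dunn_on_embeds[OF _ skew_dunn_G2[unfolded S3_plus_def],
          where \<beta> = "\<lambda>x. if x = De then e else if x = Dtop then d else c"])
      (simp_all add: delt_carriers_def assms c_nonzero products residuals lattice_eqvs d_inf_ng_c delt_op_defs)
qed

context
  assumes d_not_le_f: "\<not> d \<lesssim> f"
begin

lemma not_le_simps:
  "\<not> d \<lesssim> e" "\<not> d \<lesssim> c" "\<not> u \<lesssim> c" "\<not> t \<lesssim> c"
  "\<not> d \<lesssim> s" "\<not> u \<lesssim> s" "\<not> t \<lesssim> s" "\<not> e \<lesssim> s" "\<not> d \<lesssim> t" "\<not> d \<lesssim> u"
  "\<not> s \<lesssim> c \<Longrightarrow> \<not> s \<lesssim> e" "\<not> s \<lesssim> c \<Longrightarrow> \<not> t \<lesssim> e" "\<not> s \<lesssim> c \<Longrightarrow> \<not> u \<lesssim> e" "\<not> u \<lesssim> t \<Longrightarrow> \<not> u \<lesssim> e"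
proof -
  show es: "\<not> e \<lesssim> s" by (rule not_e_le_s[OF c_nonzero d_not_le_f])
  show "\<not> d \<lesssim> c" "\<not> u \<lesssim> c" "\<not> t \<lesssim> c" "\<not> d \<lesssim> s" "\<not> u \<lesssim> s" "\<not> t \<lesssim> s"
    using not_le_if_not_le_e es c_nonzero by simp_all
  show "\<not> d \<lesssim> e" "\<not> d \<lesssim> t" "\<not> d \<lesssim> u"
    using d_not_le_f pre_trans[OF _ e_le_f] pre_trans[OF _ u_simps(2)] pre_trans[OF _ t_simps(5)] c_nonzero by blast+
  show te: "\<not> s \<lesssim> c \<Longrightarrow> \<not> t \<lesssim> e" by (rule not_t_le_e[OF c_nonzero d_not_le_f])
  show "\<not> s \<lesssim> c \<Longrightarrow> \<not> s \<lesssim> e"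
    using te sup_le[OF pre_refl, of s e] unfolding t_def by blast
  show "\<not> s \<lesssim> c \<Longrightarrow> \<not> u \<lesssim> e" using te pre_trans[OF t_simps(3)] c_nonzero by blast
  show "\<not> u \<lesssim> t \<Longrightarrow> \<not> u \<lesssim> e" using pre_trans[OF _ t_simps(1)] c_nonzero by blast
qed

lemma e_s_lattice: "s \<triangle> e \<simeq> c" "e \<triangle> s \<simeq> c" "e \<nabla> s \<simeq> t" "s \<nabla> e \<simeq> t"
proof -
  show "s \<triangle> e \<simeq> c" using s_inf_e[OF c_nonzero d_not_le_f] c_nonzero by (simp add: eqv_def le_inf)
  then show "e \<triangle> s \<simeq> c" by (simp add: eqv_def le_inf_iff) (meson inf_le1 inf_le2 le_inf pre_trans)
  show "e \<nabla> s \<simeq> t" "s \<nabla> e \<simeq> t" by (simp_all add: t_def eqv_def sup_le)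
qed

lemma d_inf_ngs: "d \<triangle> ng c \<simeq> d" "d \<triangle> f \<simeq> u" "d \<triangle> ng s \<simeq> d" "d \<triangle> ng t \<simeq> u" "d \<triangle> ng u \<simeq> t" "d \<triangle> ng d \<simeq> s"
  using d_inf_ng_c[OF c_nonzero] d_inf_ng_s[OF c_nonzero] d_inf_ng_t[OF c_nonzero] d_inf_ng_u[OF c_nonzero]
  by (simp_all add: u_def s_def)

lemmas table = products residuals lattice_eqvs not_le_simps e_s_lattice d_inf_ngs

lemma G3_embeds: assumes "s \<lesssim> c" "u \<lesssim> e" shows "\<exists>\<phi>. embeds G3 \<phi>"
proof -
  \<comment> \<open>The general tables produce \<open>s\<close> and \<open>u\<close>, which have no
    counterpart in this monoid; here they collapse to \<open>c\<close> and e.\<close>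
  have *: "x \<simeq> s \<Longrightarrow> x \<simeq> c" "x \<simeq> u \<Longrightarrow> x \<simeq> e" for x
    using assms eqv_trans[of x] c_nonzero by (simp_all add: eqv_def[of s] eqv_def[of u])
  show ?thesis
    unfolding G3_eq S3_plus_def
    by (rule dunn_on_embeds[OF _ skew_dunn_G3[unfolded S3_plus_def],
          where \<beta> = "\<lambda>x. if x = De then e else if x = Dtop then d else c"])
      (simp_all add: delt_carriers_def c_nonzero table * delt_op_defs)
qed

lemma G4_embeds: assumes "s \<lesssim> c" "\<not> u \<lesssim> e" shows "\<exists>\<phi>. embeds G4 \<phi>"
proof -
  have "t \<lesssim> e" unfolding t_def by (rule sup_le[OF pre_refl pre_trans[OF assms(1) c_le_e]])
  then have *: "x \<simeq> s \<Longrightarrow> x \<simeq> c" "x \<simeq> t \<Longrightarrow> x \<simeq> e" for x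
    using assms eqv_trans[of x] c_nonzero by (simp_all add: eqv_def[of s] eqv_def[of t])
  have "\<not> u \<lesssim> t" using assms(2) pre_trans[OF _ \<open>t \<lesssim> e\<close>] by blast
  note u = u_mul_u[OF c_nonzero d_not_le_f this] u_im_u[OF c_nonzero]
  show ?thesis
    unfolding G4_eq C4_plus_def
    by (rule dunn_on_embeds[OF _ skew_dunn_G4[unfolded C4_plus_def],
          where \<beta> = "\<lambda>x. if x = De then e else if x = Dtop then d else if x = Da then u else c"])
      (simp_all add: delt_carriers_def c_nonzero table * u assms delt_op_defs)
qed

lemma G5_embeds: assumes "\<not> s \<lesssim> c" "u \<lesssim> t" shows "\<exists>\<phi>. embeds G5 \<phi>"
proof -
  have *: "x \<simeq> u \<Longrightarrow> x \<simeq> t" for x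
    using assms eqv_trans[of x] c_nonzero by (simp_all add: eqv_def[of u])
  note s = s_im_c[OF c_nonzero assms(1)] s_im_e[OF c_nonzero d_not_le_f assms(1)]
  show ?thesis
    unfolding G5_eq T5_def
    by (rule dunn_on_embeds[OF _ skew_dunn_G5[unfolded T5_def],
          where \<beta> = "\<lambda>x. if x = De then e else if x = Dtop then d else if x = Ds then s else if x = Dt then t else c"])
      (simp_all add: delt_carriers_def c_nonzero table * s assms delt_op_defs)
qed

lemma G6_embeds: assumes "\<not> s \<lesssim> c" "\<not> u \<lesssim> t" shows "\<exists>\<phi>. embeds G6 \<phi>"
proof -
  note s = s_im_c[OF c_nonzero assms(1)] s_im_e[OF c_nonzero d_not_le_f assms(1)]
  note u = u_mul_u[OF c_nonzero d_not_le_f assms(2)] u_im_u[OF c_nonzero] u_im_t[OF c_nonzero d_not_le_f assms(2)]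
  show ?thesis
    unfolding G6_eq T6_def
    by (rule dunn_on_embeds[OF _ skew_dunn_G6[unfolded T6_def],
          where \<beta> = "\<lambda>x. if x = De then e else if x = Dtop then d else if x = Ds then s
            else if x = Dt then t else if x = Du then u else c"])
      (simp_all add: delt_carriers_def c_nonzero table s u assms delt_op_defs)
qed

end

lemma some_G_embeds: "\<exists>G\<in>{G1, G2, G3, G4, G5, G6}. \<exists>\<phi>. embeds G \<phi>"
  using G1_embeds G2_embeds G3_embeds G4_embeds G5_embeds G6_embeds by blast

end
end

section \<open>Prime quotients\<close>

lemma meet_c4: "meet c4_order x y = (if le c4_order x y then x else y)"
  by (rule meet_eqI; cases x; cases y) (auto simp: c4_order_def)

lemma join_c4: "join c4_order x y = (if le c4_order x y then y else x)"
  by (rule join_eqI; cases x; cases y) (auto simp: c4_order_def)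

lemma C4_simps [simp]:
  "carrier C4 = UNIV" "mult C4 = c4_mult" "\<one>\<^bsub>C4\<^esub> = C4_e" "neg C4 = c4_neg"
  by (simp_all add: C4_def)

lemma C4_lattice:
  "x \<curlywedge>\<^bsub>C4\<^esub> y = (if le c4_order x y then x else y)" "x \<curlyvee>\<^bsub>C4\<^esub> y = (if le c4_order x y then y else x)"
  by (simp_all add: C4_def meet_c4 join_c4)

context dm_preorder begin

text \<open>Terms are evaluated in this algebra before the quotient is taken; equations are then
  read up to the equivalence of whichever preorder is in force.\<close>

definition alg :: "'a irl"
  where "alg = \<lparr>carrier = UNIV, mult = (\<odot>), one = e, wedge = (\<triangle>), vee = (\<nabla>), neg = ng\<rparr>"

lemma embeds_eval:
  assumes "embeds G \<phi>" "irl_algebra G" "range v \<subseteq> carrier G" "\<And>n. w n \<simeq> \<phi> (v n)"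
  shows "eval_trm G v p \<in> carrier G \<and> eval_trm alg w p \<simeq> \<phi> (eval_trm G v p)"
proof (induction p)
  case (Var n)
  then show ?case using assms(3,4) by auto
next
  case TOne
  then show ?case using assms(1,2) by (auto simp: embeds_def alg_def irl_algebra_def intro: eqv_sym)
next
  case (TMult p q)
  then show ?case
    using assms(1,2) unfolding embeds_def irl_algebra_def
    by (simp add: alg_def) (meson eqv_sym eqv_trans mul_cong)
next
  case (TWedge p q)
  then show ?case
    using assms(1,2) unfolding embeds_def irl_algebra_def
    by (simp add: alg_def) (meson eqv_sym eqv_trans inf_cong)
next
  case (TVee p q)
  then show ?case
    using assms(1,2) unfolding embeds_def irl_algebra_def
    by (simp add: alg_def) (meson eqv_sym eqv_trans sup_cong)
next
  case (TNeg p)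
  then show ?case
    using assms(1,2) unfolding embeds_def irl_algebra_def
    by (simp add: alg_def) (meson eqv_sym eqv_trans ng_cong)
qed

text \<open>Equations are inherited by quotients and subalgebras; here both steps are taken at once,
  by pulling \<open>\<simeq>\<close> back along the injective \<open>\<phi>\<close>.\<close>

lemma embeds_satisfies:
  assumes G: "embeds G \<phi>" "irl_algebra G"
    and \<Sigma>: "\<And>p q w. (p, q) \<in> \<Sigma> \<Longrightarrow> eval_trm alg w p \<simeq> eval_trm alg w q"
  shows "G \<Turnstile> \<Sigma>"
  unfolding satisfies_def
proof (safe)
  fix p q and v :: "nat \<Rightarrow> _" assume pq: "(p, q) \<in> \<Sigma>" and v: "range v \<subseteq> carrier G"
  have eval: "eval_trm G v r \<in> carrier G \<and> eval_trm alg (\<lambda>n. \<phi> (v n)) r \<simeq> \<phi> (eval_trm G v r)" for r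
    by (rule embeds_eval) (use G v in simp_all)
  have "\<phi> (eval_trm G v p) \<simeq> \<phi> (eval_trm G v q)"
    using eval \<Sigma>[OF pq] eqv_sym eqv_trans by meson
  then show "eval_trm G v p = eval_trm G v q"
    using G(1) eval unfolding embeds_def by blast
qed

section \<open>Filters and the quotients they define\<close>

definition filter :: "'a set \<Rightarrow> bool"
  where "filter F \<longleftrightarrow> e \<in> F \<and> (\<forall>x\<in>F. \<forall>y. x \<lesssim> y \<longrightarrow> y \<in> F) \<and> (\<forall>x\<in>F. \<forall>y\<in>F. x \<triangle> y \<in> F)"

lemma filterD:
  assumes "filter F"
  shows "e \<in> F" "\<lbrakk>x \<in> F; x \<lesssim> y\<rbrakk> \<Longrightarrow> y \<in> F" "\<lbrakk>x \<in> F; y \<in> F\<rbrakk> \<Longrightarrow> x \<triangle> y \<in> F"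
  using assms unfolding filter_def by blast+

text \<open>Zorn's lemma. Maximality is delivered elementwise: adjoining any x outside F already
  generates \<open>a\<close>.\<close>

lemma maximal_filter:
  assumes "\<not> e \<lesssim> a"
  obtains F where "filter F" "a \<notin> F"
    "\<And>x. x \<notin> F \<Longrightarrow> \<exists>p\<in>F. p \<triangle> x \<lesssim> a"
proof -
  let ?A = "{F. filter F \<and> a \<notin> F}"
  have "{x. e \<lesssim> x} \<in> ?A"
    using assms le_inf by (auto simp: filter_def intro: pre_trans)
  then have ne: "?A \<noteq> {}" by blast
  have chain: "\<Union>C \<in> ?A" if C: "C \<noteq> {}" "subset.chain ?A C" for C
  proof -
    have CA: "F \<in> C \<Longrightarrow> filter F \<and> a \<notin> F" for F using C by (auto simp: subset.chain_def)
    have "x \<triangle> y \<in> \<Union>C" if "x \<in> F" "F \<in> C" "y \<in> F'" "F' \<in> C" for x y F F'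
    proof -
      have "F \<subseteq> F' \<or> F' \<subseteq> F" using C that by (auto simp: subset.chain_def)
      then show ?thesis using that CA filterD(3) by blast
    qed
    moreover have "e \<in> \<Union>C" using C CA filterD(1) by blast
    moreover have "y \<in> \<Union>C" if "x \<in> F" "F \<in> C" "x \<lesssim> y" for x y F
      using that CA filterD(2) by blast
    ultimately show ?thesis using CA unfolding filter_def by blast
  qed
  obtain F where F: "filter F" "a \<notin> F" and max: "\<And>F'. \<lbrakk>filter F'; a \<notin> F'; F \<subseteq> F'\<rbrakk> \<Longrightarrow> F' = F"
    using subset_Zorn_nonempty[OF ne chain] by blast
  have "\<exists>p\<in>F. p \<triangle> x \<lesssim> a" if x: "x \<notin> F" for x
  proof (rule ccontr)
    assume neg: "\<not> ?thesis"
    \<comment> \<open>The filter generated by \<open>F\<close> and \<open>x\<close>; it would be a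
      strictly larger one avoiding \<open>a\<close>.\<close>
    let ?F = "{y. \<exists>p\<in>F. p \<triangle> x \<lesssim> y}"
    have "filter ?F"
      unfolding filter_def
    proof (intro conjI ballI allI impI)
      show "e \<in> ?F" using filterD(1)[OF F(1)] inf_le1 by blast
      show "y \<in> ?F" if "z \<in> ?F" "z \<lesssim> y" for y z
        using that pre_trans by blast
      fix y z assume "y \<in> ?F" "z \<in> ?F"
      then obtain p q where pq: "p \<in> F" "p \<triangle> x \<lesssim> y" "q \<in> F" "q \<triangle> x \<lesssim> z" by blast
      have "(p \<triangle> q) \<triangle> x \<lesssim> y \<triangle> z"
        using pre_trans[OF inf_mono[OF inf_le1 pre_refl] pq(2)] pre_trans[OF inf_mono[OF inf_le2 pre_refl] pq(4)]
        by (simp add: le_inf)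
      then show "y \<triangle> z \<in> ?F" using filterD(3)[OF F(1)] pq by blast
    qed
    moreover have "F \<subseteq> ?F" using inf_le1 by blast
    moreover have "x \<in> ?F" using filterD(1)[OF F(1)] inf_le2 by blast
    ultimately show False using max[of ?F] neg x by blast
  qed
  then show ?thesis using that F by blast
qed

lemma im_trans: "(x \<rightarrowtail> y) \<odot> (y \<rightarrowtail> z) \<lesssim> x \<rightarrowtail> z"
proof -
  have "x \<odot> ((x \<rightarrowtail> y) \<odot> (y \<rightarrowtail> z)) \<lesssim> y \<odot> (y \<rightarrowtail> z)"
    unfolding mul_assoc[symmetric] by (rule mul_mono[OF mul_im pre_refl])
  also have "\<dots> \<lesssim> z" by simp
  finally show ?thesis by (simp add: le_im_iff)
qed

lemma e_le_im: "x \<lesssim> y \<Longrightarrow> e \<lesssim> x \<rightarrowtail> y"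
  by (simp add: le_im_iff) (rule pre_trans[OF mul_e1])

context
  fixes F assumes F: "filter F"
begin

definition fle (infix "\<lesssim>\<^sub>F" 50) where "x \<lesssim>\<^sub>F y \<longleftrightarrow> x \<rightarrowtail> y \<in> F"

lemma fle_if_le: "x \<lesssim> y \<Longrightarrow> x \<lesssim>\<^sub>F y"
  unfolding fle_def using e_le_im filterD[OF F] by blast

lemma fle_if: assumes "p \<in> F" "x \<odot> p \<lesssim> y" shows "x \<lesssim>\<^sub>F y"
  unfolding fle_def using filterD(2)[OF F assms(1)] assms(2) by (simp add: le_im_iff)

text \<open>Closure of F under meets suffices for transitivity because meets lie below products.
  Residuation survives because the residuals of its two sides are equivalent already before the
  quotient.\<close>

lemma dm_preorder_fle: "dm_preorder (\<lesssim>\<^sub>F) (\<odot>) (\<triangle>) (\<nabla>) ng e"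
proof (unfold_locales)
  fix x y z
  show "x \<lesssim>\<^sub>F y \<Longrightarrow> y \<lesssim>\<^sub>F z \<Longrightarrow> x \<lesssim>\<^sub>F z"
    unfolding fle_def using filterD(2,3)[OF F] inf_le_mul im_trans by meson
  show "z \<lesssim>\<^sub>F x \<triangle> y" if "z \<lesssim>\<^sub>F x" "z \<lesssim>\<^sub>F y"
  proof (rule fle_if)
    show "(z \<rightarrowtail> x) \<triangle> (z \<rightarrowtail> y) \<in> F" using that filterD(3)[OF F] unfolding fle_def by blast
    show "z \<odot> ((z \<rightarrowtail> x) \<triangle> (z \<rightarrowtail> y)) \<lesssim> x \<triangle> y"
      by (intro le_inf pre_trans[OF mul_mono2[OF inf_le1] mul_im] pre_trans[OF mul_mono2[OF inf_le2] mul_im])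
  qed
  show "x \<nabla> y \<lesssim>\<^sub>F z" if "x \<lesssim>\<^sub>F z" "y \<lesssim>\<^sub>F z"
  proof (rule fle_if)
    let ?p = "(x \<rightarrowtail> z) \<triangle> (y \<rightarrowtail> z)"
    show "?p \<in> F" using that filterD(3)[OF F] unfolding fle_def by blast
    have "x \<odot> ?p \<lesssim> z" "y \<odot> ?p \<lesssim> z"
      by (rule pre_trans[OF mul_mono2[OF inf_le1] mul_im], rule pre_trans[OF mul_mono2[OF inf_le2] mul_im])
    then have "x \<lesssim> ?p \<rightarrowtail> z" "y \<lesssim> ?p \<rightarrowtail> z" by (simp_all add: le_im_iff mul_commute)
    then have "x \<nabla> y \<lesssim> ?p \<rightarrowtail> z" by (rule sup_le)
    then show "(x \<nabla> y) \<odot> ?p \<lesssim> z" by (simp add: le_im_iff mul_commute)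
  qed
  have "x \<odot> y \<rightarrowtail> z \<lesssim> ng z \<odot> y \<rightarrowtail> ng x" "ng z \<odot> y \<rightarrowtail> ng x \<lesssim> x \<odot> y \<rightarrowtail> z"
    unfolding im_def using mul_mono2[OF ng_ng1, of "y \<odot> ng z" x] mul_mono2[OF ng_ng2, of "y \<odot> ng z" x]
    by (simp_all add: mul_ac)
  then show "x \<odot> y \<lesssim>\<^sub>F z \<longleftrightarrow> ng z \<odot> y \<lesssim>\<^sub>F ng x"
    unfolding fle_def using filterD(2)[OF F] by blast
qed (auto intro: fle_if_le mul_assoc mul_commute distrib square)

end
end

context M_preorder begin

text \<open>Maximality makes a \<and> e the largest element strictly below e: for x outside F some p
  in F has p \<and> x \<le> a, so (x \<and> e) \<cdot> (p \<and> e) \<le> a \<and> e with p \<and> e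
  in F.\<close>

lemma m_preorder_fle:
  assumes F: "filter F" and a: "a \<notin> F" and max: "\<And>x. x \<notin> F \<Longrightarrow> \<exists>p\<in>F. p \<triangle> x \<lesssim> a"
  shows "m_preorder (fle F) (\<odot>) (\<triangle>) (\<nabla>) ng e (a \<triangle> e)"
proof -
  interpret fle: dm_preorder "fle F" "(\<odot>)" "(\<triangle>)" "(\<nabla>)" ng e by (rule dm_preorder_fle[OF F])
  note le = fle_if_le[OF F]
  show ?thesis
  proof unfold_locales
    show "fle F x hi" for x by (rule le) simp
    show "fle F e f" by (rule le) simp
    show "fle F (im (im f x \<nabla> im x e) lo) lo" for x by (rule le[OF M_law])
    show "fle F (a \<triangle> e) e" by (rule le) simp
    show "\<not> fle F e (a \<triangle> e)"
    proof
      assume "fle F e (a \<triangle> e)"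
      moreover have "im e (a \<triangle> e) \<lesssim> a"
        by (rule pre_trans[OF pre_trans[OF e_mul2 mul_im] inf_le1])
      ultimately show False unfolding fle_def[OF F] using filterD(2)[OF F] a by blast
    qed
    show "fle F (x \<triangle> e) (a \<triangle> e)" if "\<not> fle F e x" for x
    proof -
      have "x \<notin> F"
        using that filterD(2)[OF F, of x "im e x"] unfolding fle_def[OF F] by (auto simp: le_im_iff)
      then obtain p where p: "p \<in> F" "p \<triangle> x \<lesssim> a" using max by blast
      have "(x \<triangle> e) \<odot> (p \<triangle> e) \<lesssim> x" "(x \<triangle> e) \<odot> (p \<triangle> e) \<lesssim> p" "(x \<triangle> e) \<odot> (p \<triangle> e) \<lesssim> e"
        by (rule pre_trans[OF mul_mono[OF inf_le1 inf_le2] mul_e1],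
            rule pre_trans[OF mul_mono[OF inf_le2 inf_le1] e_mul1],
            rule pre_trans[OF mul_mono[OF inf_le2 inf_le2] mul_e1])
      then have "(x \<triangle> e) \<odot> (p \<triangle> e) \<lesssim> a \<triangle> e"
        by (intro le_inf pre_trans[OF _ p(2)])
      then show ?thesis
        using fle_if[OF F filterD(3)[OF F p(1) filterD(1)[OF F]]] by blast
    qed
  qed
qed

end

section \<open>The case c = 0 and the resulting dichotomy\<close>

context m_preorder begin

lemma embeds_C4: "embeds C4 (case_c4 lo e f hi)"
proof -
  have hi: "hi \<odot> x \<simeq> hi" "x \<odot> hi \<simeq> hi" if "\<not> x \<lesssim> lo" for x
    using hi_mul[OF that] by (simp_all add: eqv_def mul_commute[of x])
  have lo: "lo \<odot> x \<simeq> lo" "x \<odot> lo \<simeq> lo" for x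
    using lo_mul[of x] by (simp_all add: eqv_def mul_commute[of x])
  have "\<not> f \<lesssim> lo" using pre_trans[OF e_le_f] not_e_le_lo by blast
  moreover have "\<not> f \<lesssim> e" using not_mul_f_le_e[OF not_e_le_lo] pre_trans[OF e_mul1] by blast
  moreover have "\<not> hi \<lesssim> e" using pre_trans[OF _ e_le_f] not_hi_le_f by blast
  ultimately have [simp]: "\<not> f \<lesssim> lo" "\<not> f \<lesssim> e" "\<not> hi \<lesssim> e" by simp_all
  note [simp] = eqv_sym[OF hi(1)] eqv_sym[OF hi(2)] eqv_sym[OF lo(1)] eqv_sym[OF lo(2)]
  show ?thesis
    unfolding embeds_def
  proof (intro conjI ballI impI)
    fix x y
    show "case_c4 lo e f hi (\<sim>\<^bsub>C4\<^esub> x) \<simeq> ng (case_c4 lo e f hi x)" by (cases x) simp_all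
    show "case_c4 lo e f hi (x \<otimes>\<^bsub>C4\<^esub> y) \<simeq> case_c4 lo e f hi x \<odot> case_c4 lo e f hi y"
      by (cases x; cases y) (simp_all add: c4_mult_def, simp_all add: eqv_def)
    show "case_c4 lo e f hi (x \<curlywedge>\<^bsub>C4\<^esub> y) \<simeq> case_c4 lo e f hi x \<triangle> case_c4 lo e f hi y"
      "case_c4 lo e f hi (x \<curlyvee>\<^bsub>C4\<^esub> y) \<simeq> case_c4 lo e f hi x \<nabla> case_c4 lo e f hi y"
      by (cases x; cases y; simp add: C4_lattice c4_order_def eqv_def le_inf sup_le)+
    show "x = y" if "case_c4 lo e f hi x \<simeq> case_c4 lo e f hi y"
      using that by (cases x; cases y) (simp_all add: eqv_def)
  qed simp
qed

text \<open>When c = 0, \<open>inf_e_nonzero\<close> puts e below every nonzero element. A nonzero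
  small y then satisfies y \<le> y \<cdot> z \<le> e for a suitable z \<ge> e, so it is e; the
  remaining elements are negations of small ones.\<close>

lemma C4_onto: assumes "c \<lesssim> lo" shows "\<exists>k. x \<simeq> case_c4 lo e f hi k"
proof -
  have large: "e \<lesssim> y" if "\<not> y \<lesssim> lo" for y
    using inf_e_nonzero[OF that] c_greatest[of y] pre_trans[OF _ assms] by blast
  have small: "y \<simeq> lo \<or> y \<simeq> e" if "small y" for y
  proof (cases "y \<lesssim> lo")
    case False
    obtain z where z: "\<not> z \<lesssim> lo" "y \<odot> z \<lesssim> e" using \<open>small y\<close> by (rule smallE)
    have "y \<lesssim> y \<odot> z" by (rule pre_trans[OF mul_e2 mul_mono2[OF large[OF z(1)]]])
    then have "y \<lesssim> e" by (rule pre_trans[OF _ z(2)])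
    then show ?thesis using large[OF False] by (simp add: eqv_def)
  qed (simp add: eqv_def)
  have ng: "x \<simeq> ng y" if "ng x \<simeq> y" for y
    using ng_cong[OF that] eqv_trans[OF ng_ng_eqv(2)] by blast
  have "x \<simeq> lo \<or> x \<simeq> e \<or> x \<simeq> ng e \<or> x \<simeq> hi"
    using small_or[of x] small ng eqv_trans[OF ng ng_ng_eqv(1)] by blast
  then show ?thesis
    by (elim disjE) (rule exI[of _ C4_0], simp, rule exI[of _ C4_e], simp, rule exI[of _ C4_f], simp,
      rule exI[of _ C4_1], simp)
qed

lemma C4_eval:
  assumes "c \<lesssim> lo" "C4 \<Turnstile> {(p, q)}"
  shows "eval_trm alg w p \<simeq> eval_trm alg w q"
proof -
  let ?\<phi> = "case_c4 lo e f hi"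
  have "\<forall>n. \<exists>k. w n \<simeq> ?\<phi> k" using C4_onto[OF assms(1)] by blast
  from choice[OF this] obtain v where v: "\<And>n. w n \<simeq> ?\<phi> (v n)" by blast
  have "irl_algebra C4" by (simp add: irl_algebra_def)
  then have eval: "eval_trm alg w r \<simeq> ?\<phi> (eval_trm C4 v r)" for r
    using embeds_eval[OF embeds_C4, of v w r] v by simp
  moreover have "eval_trm C4 v p = eval_trm C4 v q"
    using assms(2) by (simp add: satisfies_def)
  ultimately show ?thesis using eqv_sym eqv_trans by metis
qed

lemma C4_or_G:
  "(\<forall>p q w. C4 \<Turnstile> {(p, q)} \<longrightarrow> eval_trm alg w p \<simeq> eval_trm alg w q) \<or>
    (\<exists>G\<in>{G1, G2, G3, G4, G5, G6}. \<exists>\<phi>. embeds G \<phi>)"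
  using C4_eval some_G_embeds by blast

end

section \<open>From members of M to preorders and back\<close>

context involutive_residuated_lattice begin

lemma neg_below_neg_iff: assumes "x \<in> carrier A" "y \<in> carrier A" shows "\<sim> x \<preceq> \<sim> y \<longleftrightarrow> y \<preceq> x"
  using neg_residuation[of y \<one> x] assms neg_closed by simp

end

lemma irl_algebra_class_M: assumes "A \<in> class_M" shows "irl_algebra A"
proof -
  interpret anti_idempotent_de_morgan_monoid A
    using assms by (simp add: class_M_def)
  show ?thesis by unfold_locales (simp_all add: wedge_closed vee_closed neg_closed)
qed

context
  fixes A :: "'a irl"
begin

text \<open>Precomposing the operations with \<open>retr\<close> makes them total, which removes all carrier conditions.\<close>

definition retr :: "'a \<Rightarrow> 'a"
  where "retr x = (if x \<in> carrier A then x else \<one>\<^bsub>A\<^esub>)"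

abbreviation "rle x y \<equiv> retr x \<preceq>\<^bsub>A\<^esub> retr y"
abbreviation "rmul x y \<equiv> retr x \<otimes>\<^bsub>A\<^esub> retr y"
abbreviation "rinf x y \<equiv> retr x \<curlywedge>\<^bsub>A\<^esub> retr y"
abbreviation "rsup x y \<equiv> retr x \<curlyvee>\<^bsub>A\<^esub> retr y"
abbreviation "rneg x \<equiv> \<sim>\<^bsub>A\<^esub> retr x"

context
  assumes A: "A \<in> class_M"
begin

interpretation anti_idempotent_de_morgan_monoid A
  using A by (simp add: class_M_def)

lemma retr_closed [simp]: "retr x \<in> carrier A"
  by (simp add: retr_def)

lemma retr_id [simp]: "x \<in> carrier A \<Longrightarrow> retr x = x"
  by (simp add: retr_def)

lemma class_M_closed [simp]:
  "\<one>\<^bsub>A\<^esub> \<in> carrier A" "\<lbrakk>x \<in> carrier A; y \<in> carrier A\<rbrakk> \<Longrightarrow> x \<otimes>\<^bsub>A\<^esub> y \<in> carrier A"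
  "\<lbrakk>x \<in> carrier A; y \<in> carrier A\<rbrakk> \<Longrightarrow> x \<curlywedge>\<^bsub>A\<^esub> y \<in> carrier A"
  "\<lbrakk>x \<in> carrier A; y \<in> carrier A\<rbrakk> \<Longrightarrow> x \<curlyvee>\<^bsub>A\<^esub> y \<in> carrier A"
  "x \<in> carrier A \<Longrightarrow> \<sim>\<^bsub>A\<^esub> x \<in> carrier A"
  by (simp_all add: wedge_closed vee_closed neg_closed)

lemma dm_preorder_class_M: "dm_preorder rle rmul rinf rsup rneg \<one>\<^bsub>A\<^esub>"
proof unfold_locales
  fix x y z
  show "rle x y \<Longrightarrow> rle y z \<Longrightarrow> rle x z" by (rule below_trans[of _ "retr y"]) simp_all
  show "rle z x \<Longrightarrow> rle z y \<Longrightarrow> rle z (rinf x y)" by (simp add: below_wedge_iff)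
  show "rle x z \<Longrightarrow> rle y z \<Longrightarrow> rle (rsup x y) z" by (simp add: vee_below_iff)
  show "rle (rinf x (rsup y z)) (rsup (rinf x y) (rinf x z))"
    by (simp add: wedge_vee_distrib below_refl)
  show "rle (rmul x y) z = rle (rmul (rneg z) y) (rneg x)"
    using neg_residuation[of "retr x" "retr y" "retr z"] by simp
qed (simp_all add: below_refl wedge_below below_vee neg_neg m_ac square_increasing)

lemma M_preorder_class_M: "M_preorder rle rmul rinf rsup rneg \<one>\<^bsub>A\<^esub>"
proof -
  interpret P: dm_preorder rle rmul rinf rsup rneg "\<one>\<^bsub>A\<^esub>" by (rule dm_preorder_class_M)
  have f: "\<f>\<^bsub>A\<^esub> = \<sim>\<^bsub>A\<^esub> \<one>\<^bsub>A\<^esub>" by (simp add: irl_f_def)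
  show ?thesis
  proof
    show "rle x (rmul P.f P.f)" for x using anti_idempotent[of "retr x"] by (simp add: f)
    show "rle \<one>\<^bsub>A\<^esub> P.f" using A by (simp add: class_M_def f)
    show "rle (P.im (rsup (P.im P.f x) (P.im x \<one>\<^bsub>A\<^esub>)) P.lo) P.lo" for x
    proof -
      have "((\<f>\<^bsub>A\<^esub> \<leadsto>\<^bsub>A\<^esub> retr x) \<curlyvee>\<^bsub>A\<^esub> (retr x \<leadsto>\<^bsub>A\<^esub> \<one>\<^bsub>A\<^esub>)) \<leadsto>\<^bsub>A\<^esub> \<o>\<^bsub>A\<^esub> = \<o>\<^bsub>A\<^esub>"
        using A by (simp add: class_M_def)
      then show ?thesis
        by (simp add: P.im_def irl_imp_def irl_zero_def f below_refl)
    qed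
  qed
qed

text \<open>The outer \<open>retr\<close> is there for variables, which may be assigned points off
  the carrier; the value of any other term lies in the carrier.\<close>

lemma retr_eval: "retr (eval_trm (dm_preorder.alg rmul rinf rsup rneg \<one>\<^bsub>A\<^esub>) w p) = eval_trm A (\<lambda>n. retr (w n)) p"
proof -
  have alg: "dm_preorder.alg rmul rinf rsup rneg \<one>\<^bsub>A\<^esub> =
    \<lparr>carrier = UNIV, mult = rmul, one = \<one>\<^bsub>A\<^esub>, wedge = rinf, vee = rsup, neg = rneg\<rparr>"
    by (rule dm_preorder.alg_def[OF dm_preorder_class_M])
  have eval: "eval_trm A (\<lambda>n. retr (w n)) q \<in> carrier A" for q
    by (induction q) simp_all
  show ?thesis by (induction p) (simp_all add: alg eval)
qed

text \<open>One \<open>G\<close> serves all \<Sigma> because the quotient it embeds in is selected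
  by the failing equation p = q alone.\<close>

lemma G_satisfies:
  assumes "C4 \<Turnstile> {(p, q)}" "\<not> A \<Turnstile> {(p, q)}"
  shows "\<exists>G\<in>{G1, G2, G3, G4, G5, G6}. \<forall>\<Sigma>. A \<Turnstile> \<Sigma> \<longrightarrow> G \<Turnstile> \<Sigma>"
proof -
  interpret P: M_preorder rle rmul rinf rsup rneg "\<one>\<^bsub>A\<^esub>" by (rule M_preorder_class_M)
  obtain v where v: "range v \<subseteq> carrier A" "eval_trm A v p \<noteq> eval_trm A v q"
    using assms(2) by (auto simp: satisfies_def)
  have rv: "(\<lambda>n. retr (v n)) = v" using v(1) by (simp add: fun_eq_iff image_subset_iff)
  let ?x = "eval_trm P.alg v p" and ?y = "eval_trm P.alg v q"
  let ?a = "rinf (P.im ?x ?y) (P.im ?y ?x)"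
  have "\<not> rle \<one>\<^bsub>A\<^esub> ?a"
  proof
    assume "rle \<one>\<^bsub>A\<^esub> ?a"
    then have "rle \<one>\<^bsub>A\<^esub> (P.im ?x ?y)" "rle \<one>\<^bsub>A\<^esub> (P.im ?y ?x)"
      by (simp_all only: P.le_inf_iff)
    then have "rle ?x ?y" "rle ?y ?x"
      unfolding P.le_im_iff using P.pre_trans[OF P.mul_e2] by blast+
    then have "retr ?x = retr ?y" by (simp add: below_antisym)
    then show False using v(2) by (simp add: retr_eval rv)
  qed
  then obtain F where F: "P.filter F" "?a \<notin> F" "\<And>x. x \<notin> F \<Longrightarrow> \<exists>p\<in>F. rle (rinf p x) ?a"
    by (rule P.maximal_filter) blast
  interpret Q: m_preorder "P.fle F" rmul rinf rsup rneg "\<one>\<^bsub>A\<^esub>" "rinf ?a \<one>\<^bsub>A\<^esub>"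
    by (rule P.m_preorder_fle[OF F])
  \<comment> \<open>Equivalence would place both residuals, and so \<open>?a\<close>, in F. Thus p
    and q still differ in the quotient, which rules out the C4 alternative of
    \<open>C4_or_G\<close>.\<close>
  have "\<not> Q.eqv ?x ?y"
    using P.filterD(3)[OF F(1)] F(2) by (auto simp: Q.eqv_def P.fle_def[OF F(1)])
  then obtain G \<phi> where G: "G \<in> {G1, G2, G3, G4, G5, G6}" and \<phi>: "Q.embeds G \<phi>"
    using Q.C4_or_G assms(1) by blast
  have "G \<Turnstile> \<Sigma>" if "A \<Turnstile> \<Sigma>" for \<Sigma>
  proof (rule Q.embeds_satisfies[OF \<phi>])
    have "G \<in> class_M" using G by (rule G_in_class_M)
    then show "irl_algebra G" by (rule irl_algebra_class_M)
    fix r s w assume "(r, s) \<in> \<Sigma>"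
    then have "eval_trm A (\<lambda>n. retr (w n)) r = eval_trm A (\<lambda>n. retr (w n)) s"
      using that[unfolded satisfies_def, THEN bspec, of "(r, s)"] by (simp add: image_subset_iff)
    then have "retr (eval_trm P.alg w r) = retr (eval_trm P.alg w s)" by (simp only: retr_eval)
    then have "rle (eval_trm P.alg w r) (eval_trm P.alg w s)" "rle (eval_trm P.alg w s) (eval_trm P.alg w r)"
      by (simp_all add: below_refl)
    then show "Q.eqv (eval_trm P.alg w r) (eval_trm P.alg w s)"
      unfolding Q.eqv_def by (simp add: P.fle_if_le[OF F(1)])
  qed
  then show ?thesis using G by blast
qed

end
end

section \<open>Varieties\<close>

definition valid :: "('a, 'm) irl_scheme \<Rightarrow> (trm \<times> trm) set"
  where "valid A = {(p, q). A \<Turnstile> {(p, q)}}"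

lemma satisfies_iff: "A \<Turnstile> \<Sigma> \<longleftrightarrow> \<Sigma> \<subseteq> valid A"
  by (auto simp: satisfies_def valid_def)

lemma variety_generated_eq: "\<V> A = models (valid A)"
  by (auto simp: variety_generated_def models_def satisfies_iff)

lemma models_antimono: "\<Sigma> \<subseteq> \<Sigma>' \<Longrightarrow> models \<Sigma>' \<subseteq> models \<Sigma>"
  by (auto simp: models_def satisfies_iff)

lemma satisfies_if_inj_hom:
  assumes "irl_algebra A" "inj_on \<phi> (carrier A)" "\<phi> ` carrier A \<subseteq> carrier B" "\<phi> \<one>\<^bsub>A\<^esub> = \<one>\<^bsub>B\<^esub>"
    "\<And>x. x \<in> carrier A \<Longrightarrow> \<phi> (\<sim>\<^bsub>A\<^esub> x) = \<sim>\<^bsub>B\<^esub> \<phi> x"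
    "\<And>x y. \<lbrakk>x \<in> carrier A; y \<in> carrier A\<rbrakk> \<Longrightarrow> \<phi> (x \<otimes>\<^bsub>A\<^esub> y) = \<phi> x \<otimes>\<^bsub>B\<^esub> \<phi> y \<and>
      \<phi> (x \<curlywedge>\<^bsub>A\<^esub> y) = \<phi> x \<curlywedge>\<^bsub>B\<^esub> \<phi> y \<and> \<phi> (x \<curlyvee>\<^bsub>A\<^esub> y) = \<phi> x \<curlyvee>\<^bsub>B\<^esub> \<phi> y"
  shows "valid B \<subseteq> valid A"
proof (clarsimp simp: valid_def satisfies_def)
  fix p q and v :: "nat \<Rightarrow> _"
  assume eq: "\<forall>v. range v \<subseteq> carrier B \<longrightarrow> eval_trm B v p = eval_trm B v q" and v: "range v \<subseteq> carrier A"
  have "eval_trm A v r \<in> carrier A \<and> \<phi> (eval_trm A v r) = eval_trm B (\<lambda>n. \<phi> (v n)) r" for r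
    using assms v unfolding irl_algebra_def by (induction r) auto
  moreover have "eval_trm B (\<lambda>n. \<phi> (v n)) p = eval_trm B (\<lambda>n. \<phi> (v n)) q"
    using v assms(3) by (intro eq[rule_format]) blast
  ultimately show "eval_trm A v p = eval_trm A v q"
    using assms(2) by (metis inj_onD)
qed

text \<open>The members of \<open>\<V> A\<close> live on \<open>'u\<close>, so \<open>A\<close>
  itself may not be among them. A copy of a finite \<open>A\<close> on the infinite type lets the
  equational theory of \<open>A\<close> be recovered from \<open>\<V> A\<close>.\<close>

lemma copy_exists:
  fixes A :: "'a irl"
  assumes A: "irl_algebra A" "finite (carrier A)" and "infinite (UNIV :: 'u set)"
  obtains A' :: "'u irl" where "irl_algebra A'" "valid A' = valid A"
proof -
  obtain T :: "'u set" where "finite T" "card T = card (carrier A)"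
    using infinite_arbitrarily_large[OF assms(3)] by blast
  then obtain g :: "'a \<Rightarrow> 'u" where g: "inj_on g (carrier A)"
    using finite_same_card_bij[OF A(2)] by (metis bij_betw_def)
  define g' where "g' = inv_into (carrier A) g"
  have g' [simp]: "g' (g x) = x" if "x \<in> carrier A" for x
    using g that by (simp add: g'_def)
  define A' :: "'u irl" where "A' = \<lparr>carrier = g ` carrier A, mult = \<lambda>x y. g (g' x \<otimes>\<^bsub>A\<^esub> g' y),
    one = g \<one>\<^bsub>A\<^esub>, wedge = \<lambda>x y. g (g' x \<curlywedge>\<^bsub>A\<^esub> g' y), vee = \<lambda>x y. g (g' x \<curlyvee>\<^bsub>A\<^esub> g' y),
    neg = \<lambda>x. g (\<sim>\<^bsub>A\<^esub> g' x)\<rparr>"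
  have A': "irl_algebra A'"
    using A(1) unfolding A'_def irl_algebra_def by auto
  moreover have "valid A' \<subseteq> valid A"
    by (rule satisfies_if_inj_hom[OF A(1) g]) (auto simp: A'_def)
  moreover have "valid A \<subseteq> valid A'"
    by (rule satisfies_if_inj_hom[OF A', of g'])
      (use A(1) in \<open>auto simp: A'_def irl_algebra_def inj_on_def\<close>)
  ultimately show ?thesis using that by blast
qed

lemma variety_generated_le_iff:
  fixes A :: "'a irl" and B :: "'b irl"
  assumes "irl_algebra A" "finite (carrier A)" "infinite (UNIV :: 'u set)"
  shows "(\<V> A :: 'u irl set) \<subseteq> \<V> B \<longleftrightarrow> valid B \<subseteq> valid A"
proof
  assume *: "(\<V> A :: 'u irl set) \<subseteq> \<V> B"
  obtain A' :: "'u irl" where "irl_algebra A'" "valid A' = valid A"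
    using copy_exists[OF assms] .
  then have "A' \<in> \<V> A" by (simp add: variety_generated_eq models_def satisfies_iff)
  then have "A' \<in> \<V> B" using * by blast
  then show "valid B \<subseteq> valid A"
    using \<open>valid A' = valid A\<close> by (simp add: variety_generated_eq models_def satisfies_iff)
qed (simp add: variety_generated_eq models_antimono)

section \<open>An equational axiomatization of M\<close>

text \<open>
  Residuation is replaced by the De Morgan law, distributivity of the product over joins, and
  \<open>\<not>(x \<cdot> y) \<cdot> y \<le> \<not>x\<close>.
\<close>

definition M_axioms :: "(trm \<times> trm) list"
  where "M_axioms =
   (let x = Var 0; y = Var 1; z = Var 2; f = TNeg TOne; lo = TNeg (TMult f f);
        im = (\<lambda>p q. TNeg (TMult p (TNeg q)))
    in [(TMult (TMult x y) z, TMult x (TMult y z)), (TMult x y, TMult y x), (TMult TOne x, x),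
        (TWedge x y, TWedge y x), (TVee x y, TVee y x),
        (TWedge (TWedge x y) z, TWedge x (TWedge y z)), (TVee (TVee x y) z, TVee x (TVee y z)),
        (TWedge x (TVee x y), x), (TVee x (TWedge x y), x),
        (TWedge x (TVee y z), TVee (TWedge x y) (TWedge x z)),
        (TNeg (TNeg x), x), (TNeg (TVee x y), TWedge (TNeg x) (TNeg y)),
        (TMult x (TVee y z), TVee (TMult x y) (TMult x z)),
        (TWedge (TMult (TNeg (TMult x y)) y) (TNeg x), TMult (TNeg (TMult x y)) y),
        (TWedge x (TMult x x), x), (TWedge x (TMult f f), x), (TWedge TOne f, TOne),
        (im (TVee (im f x) (im x TOne)) lo, lo)])"

lemma class_M_if_axioms:
  assumes "irl_algebra A" and "A \<Turnstile> set M_axioms"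
  shows "A \<in> class_M"
proof -
  have [simp]: "\<one>\<^bsub>A\<^esub> \<in> carrier A" "\<And>x y. \<lbrakk>x \<in> carrier A; y \<in> carrier A\<rbrakk> \<Longrightarrow> x \<otimes>\<^bsub>A\<^esub> y \<in> carrier A"
    "\<And>x y. \<lbrakk>x \<in> carrier A; y \<in> carrier A\<rbrakk> \<Longrightarrow> x \<curlywedge>\<^bsub>A\<^esub> y \<in> carrier A"
    "\<And>x y. \<lbrakk>x \<in> carrier A; y \<in> carrier A\<rbrakk> \<Longrightarrow> x \<curlyvee>\<^bsub>A\<^esub> y \<in> carrier A"
    "\<And>x. x \<in> carrier A \<Longrightarrow> \<sim>\<^bsub>A\<^esub> x \<in> carrier A"
    using assms(1) by (simp_all add: irl_algebra_def)
  have ax: "eval_trm A (\<lambda>n. if n = 0 then x else if n = 1 then y else z) (fst (M_axioms ! i))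
      = eval_trm A (\<lambda>n. if n = 0 then x else if n = 1 then y else z) (snd (M_axioms ! i))"
    if "x \<in> carrier A" "y \<in> carrier A" "z \<in> carrier A" "i < length M_axioms" for x y z i
  proof -
    have "M_axioms ! i \<in> set M_axioms" using that by simp
    from assms(2)[unfolded satisfies_def, THEN bspec, OF this] show ?thesis
      using that by (simp add: case_prod_beta image_subset_iff)
  qed
  note M = M_axioms_def
  note defs = M_axioms_def Let_def below_def irl_imp_def irl_zero_def irl_f_def
  have laws:
    "(x \<otimes>\<^bsub>A\<^esub> y) \<otimes>\<^bsub>A\<^esub> z = x \<otimes>\<^bsub>A\<^esub> (y \<otimes>\<^bsub>A\<^esub> z)"
    "x \<otimes>\<^bsub>A\<^esub> y = y \<otimes>\<^bsub>A\<^esub> x"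
    "\<one>\<^bsub>A\<^esub> \<otimes>\<^bsub>A\<^esub> x = x"
    "x \<curlywedge>\<^bsub>A\<^esub> y = y \<curlywedge>\<^bsub>A\<^esub> x"
    "x \<curlyvee>\<^bsub>A\<^esub> y = y \<curlyvee>\<^bsub>A\<^esub> x"
    "(x \<curlywedge>\<^bsub>A\<^esub> y) \<curlywedge>\<^bsub>A\<^esub> z = x \<curlywedge>\<^bsub>A\<^esub> (y \<curlywedge>\<^bsub>A\<^esub> z)"
    "(x \<curlyvee>\<^bsub>A\<^esub> y) \<curlyvee>\<^bsub>A\<^esub> z = x \<curlyvee>\<^bsub>A\<^esub> (y \<curlyvee>\<^bsub>A\<^esub> z)"
    "x \<curlywedge>\<^bsub>A\<^esub> (x \<curlyvee>\<^bsub>A\<^esub> y) = x"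
    "x \<curlyvee>\<^bsub>A\<^esub> (x \<curlywedge>\<^bsub>A\<^esub> y) = x"
    "x \<curlywedge>\<^bsub>A\<^esub> (y \<curlyvee>\<^bsub>A\<^esub> z) = (x \<curlywedge>\<^bsub>A\<^esub> y) \<curlyvee>\<^bsub>A\<^esub> (x \<curlywedge>\<^bsub>A\<^esub> z)"
    "\<sim>\<^bsub>A\<^esub> (\<sim>\<^bsub>A\<^esub> x) = x"
    "\<sim>\<^bsub>A\<^esub> (x \<curlyvee>\<^bsub>A\<^esub> y) = \<sim>\<^bsub>A\<^esub> x \<curlywedge>\<^bsub>A\<^esub> \<sim>\<^bsub>A\<^esub> y"
    "x \<otimes>\<^bsub>A\<^esub> (y \<curlyvee>\<^bsub>A\<^esub> z) = (x \<otimes>\<^bsub>A\<^esub> y) \<curlyvee>\<^bsub>A\<^esub> (x \<otimes>\<^bsub>A\<^esub> z)"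
    "\<sim>\<^bsub>A\<^esub> (x \<otimes>\<^bsub>A\<^esub> y) \<otimes>\<^bsub>A\<^esub> y \<preceq>\<^bsub>A\<^esub> \<sim>\<^bsub>A\<^esub> x"
    "x \<preceq>\<^bsub>A\<^esub> x \<otimes>\<^bsub>A\<^esub> x"
    "x \<preceq>\<^bsub>A\<^esub> \<f>\<^bsub>A\<^esub> \<otimes>\<^bsub>A\<^esub> \<f>\<^bsub>A\<^esub>"
    "\<one>\<^bsub>A\<^esub> \<preceq>\<^bsub>A\<^esub> \<f>\<^bsub>A\<^esub>"
    "((\<f>\<^bsub>A\<^esub> \<leadsto>\<^bsub>A\<^esub> x) \<curlyvee>\<^bsub>A\<^esub> (x \<leadsto>\<^bsub>A\<^esub> \<one>\<^bsub>A\<^esub>)) \<leadsto>\<^bsub>A\<^esub> \<o>\<^bsub>A\<^esub> = \<o>\<^bsub>A\<^esub>"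
    if xyz: "x \<in> carrier A" "y \<in> carrier A" "z \<in> carrier A" for x y z
  proof -
    note ax = ax[OF xyz]
    show "(x \<otimes>\<^bsub>A\<^esub> y) \<otimes>\<^bsub>A\<^esub> z = x \<otimes>\<^bsub>A\<^esub> (y \<otimes>\<^bsub>A\<^esub> z)"
      using ax[of 0] by (simp add: defs)
    show "x \<otimes>\<^bsub>A\<^esub> y = y \<otimes>\<^bsub>A\<^esub> x"
      using ax[of 1] by (simp add: defs)
    show "\<one>\<^bsub>A\<^esub> \<otimes>\<^bsub>A\<^esub> x = x"
      using ax[of 2] by (simp add: defs)
    show "x \<curlywedge>\<^bsub>A\<^esub> y = y \<curlywedge>\<^bsub>A\<^esub> x"
      using ax[of 3] by (simp add: defs)
    show "x \<curlyvee>\<^bsub>A\<^esub> y = y \<curlyvee>\<^bsub>A\<^esub> x"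
      using ax[of 4] by (simp add: defs)
    show "(x \<curlywedge>\<^bsub>A\<^esub> y) \<curlywedge>\<^bsub>A\<^esub> z = x \<curlywedge>\<^bsub>A\<^esub> (y \<curlywedge>\<^bsub>A\<^esub> z)"
      using ax[of 5] by (simp add: defs)
    show "(x \<curlyvee>\<^bsub>A\<^esub> y) \<curlyvee>\<^bsub>A\<^esub> z = x \<curlyvee>\<^bsub>A\<^esub> (y \<curlyvee>\<^bsub>A\<^esub> z)"
      using ax[of 6] by (simp add: defs)
    show "x \<curlywedge>\<^bsub>A\<^esub> (x \<curlyvee>\<^bsub>A\<^esub> y) = x"
      using ax[of 7] by (simp add: defs)
    show "x \<curlyvee>\<^bsub>A\<^esub> (x \<curlywedge>\<^bsub>A\<^esub> y) = x"
      using ax[of 8] by (simp add: defs)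
    show "x \<curlywedge>\<^bsub>A\<^esub> (y \<curlyvee>\<^bsub>A\<^esub> z) = (x \<curlywedge>\<^bsub>A\<^esub> y) \<curlyvee>\<^bsub>A\<^esub> (x \<curlywedge>\<^bsub>A\<^esub> z)"
      using ax[of 9] by (simp add: defs)
    show "\<sim>\<^bsub>A\<^esub> (\<sim>\<^bsub>A\<^esub> x) = x"
      using ax[of 10] by (simp add: defs)
    show "\<sim>\<^bsub>A\<^esub> (x \<curlyvee>\<^bsub>A\<^esub> y) = \<sim>\<^bsub>A\<^esub> x \<curlywedge>\<^bsub>A\<^esub> \<sim>\<^bsub>A\<^esub> y"
      using ax[of 11] by (simp add: defs)
    show "x \<otimes>\<^bsub>A\<^esub> (y \<curlyvee>\<^bsub>A\<^esub> z) = (x \<otimes>\<^bsub>A\<^esub> y) \<curlyvee>\<^bsub>A\<^esub> (x \<otimes>\<^bsub>A\<^esub> z)"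
      using ax[of 12] by (simp add: defs)
    show "\<sim>\<^bsub>A\<^esub> (x \<otimes>\<^bsub>A\<^esub> y) \<otimes>\<^bsub>A\<^esub> y \<preceq>\<^bsub>A\<^esub> \<sim>\<^bsub>A\<^esub> x"
      using ax[of 13] by (simp add: defs)
    show "x \<preceq>\<^bsub>A\<^esub> x \<otimes>\<^bsub>A\<^esub> x"
      using ax[of 14] by (simp add: defs)
    show "x \<preceq>\<^bsub>A\<^esub> \<f>\<^bsub>A\<^esub> \<otimes>\<^bsub>A\<^esub> \<f>\<^bsub>A\<^esub>"
      using ax[of 15] by (simp add: defs)
    show "\<one>\<^bsub>A\<^esub> \<preceq>\<^bsub>A\<^esub> \<f>\<^bsub>A\<^esub>"
      using ax[of 16] by (simp add: defs)
    show "((\<f>\<^bsub>A\<^esub> \<leadsto>\<^bsub>A\<^esub> x) \<curlyvee>\<^bsub>A\<^esub> (x \<leadsto>\<^bsub>A\<^esub> \<one>\<^bsub>A\<^esub>)) \<leadsto>\<^bsub>A\<^esub> \<o>\<^bsub>A\<^esub> = \<o>\<^bsub>A\<^esub>"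
      using ax[of 17] by (simp add: defs)
  qed
  have one: "\<one>\<^bsub>A\<^esub> \<in> carrier A" by simp
  note laws1 = laws(3,11,15,16,18)[OF _ one one] and laws2 = laws(8,9,12,14)[OF _ _ one]
    and comm = laws(2,4,5)[OF _ _ one] and laws3 = laws(1,6,7,10,13)
  interpret lattice_monoid A
  proof unfold_locales
    show "x \<otimes>\<^bsub>A\<^esub> \<one>\<^bsub>A\<^esub> = x" if "x \<in> carrier A" for x
      using that comm(1)[of x "\<one>\<^bsub>A\<^esub>"] laws1(1) by simp
  qed (simp_all add: laws1 laws2 laws3, (rule comm; assumption)+)
  \<comment> \<open>The De Morgan law turns x \<cdot> y \<le> z into \<not>z \<le> \<not>(x \<cdot>
    y); products are monotone since they preserve joins; and \<not>(x \<cdot> y) \<cdot> y \<le>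
    \<not>x finishes.\<close>
  have neg_residuation: "\<sim>\<^bsub>A\<^esub> z \<otimes>\<^bsub>A\<^esub> y \<preceq>\<^bsub>A\<^esub> \<sim>\<^bsub>A\<^esub> x"
    if "x \<otimes>\<^bsub>A\<^esub> y \<preceq>\<^bsub>A\<^esub> z" and xyz: "x \<in> carrier A" "y \<in> carrier A" "z \<in> carrier A" for x y z
  proof -
    let ?xy = "x \<otimes>\<^bsub>A\<^esub> y"
    have "z = ?xy \<curlyvee>\<^bsub>A\<^esub> z" using that by (simp add: below_iff_vee)
    then have "\<sim>\<^bsub>A\<^esub> z = \<sim>\<^bsub>A\<^esub> ?xy \<curlywedge>\<^bsub>A\<^esub> \<sim>\<^bsub>A\<^esub> z" using laws2(3)[of ?xy z] xyz by simp
    then have "\<sim>\<^bsub>A\<^esub> z \<preceq>\<^bsub>A\<^esub> \<sim>\<^bsub>A\<^esub> ?xy" using wedge_below(1)[of "\<sim>\<^bsub>A\<^esub> ?xy" "\<sim>\<^bsub>A\<^esub> z"] xyz by simp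
    then have "\<sim>\<^bsub>A\<^esub> z \<curlyvee>\<^bsub>A\<^esub> \<sim>\<^bsub>A\<^esub> ?xy = \<sim>\<^bsub>A\<^esub> ?xy" using xyz by (simp add: below_iff_vee)
    then have "y \<otimes>\<^bsub>A\<^esub> \<sim>\<^bsub>A\<^esub> z \<curlyvee>\<^bsub>A\<^esub> y \<otimes>\<^bsub>A\<^esub> \<sim>\<^bsub>A\<^esub> ?xy = y \<otimes>\<^bsub>A\<^esub> \<sim>\<^bsub>A\<^esub> ?xy"
      using laws3(5)[of y "\<sim>\<^bsub>A\<^esub> z" "\<sim>\<^bsub>A\<^esub> ?xy"] xyz by simp
    then have "\<sim>\<^bsub>A\<^esub> z \<otimes>\<^bsub>A\<^esub> y \<preceq>\<^bsub>A\<^esub> \<sim>\<^bsub>A\<^esub> ?xy \<otimes>\<^bsub>A\<^esub> y"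
      using xyz comm(1)[of y] by (simp add: below_iff_vee)
    then show ?thesis using laws2(4)[of x y] below_trans xyz by simp
  qed
  have "anti_idempotent_de_morgan_monoid A"
  proof unfold_locales
    fix x y z assume xyz: "x \<in> carrier A" "y \<in> carrier A" "z \<in> carrier A"
    \<comment> \<open>The converse direction is the same implication for \<not>z, y, \<not>x, by
      double negation.\<close>
    show "x \<otimes>\<^bsub>A\<^esub> y \<preceq>\<^bsub>A\<^esub> z \<longleftrightarrow> \<sim>\<^bsub>A\<^esub> z \<otimes>\<^bsub>A\<^esub> y \<preceq>\<^bsub>A\<^esub> \<sim>\<^bsub>A\<^esub> x"
      using neg_residuation[of x y z] neg_residuation[of "\<sim>\<^bsub>A\<^esub> z" y "\<sim>\<^bsub>A\<^esub> x"] xyz by (auto simp: laws1(2))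
  qed (simp_all add: laws1 laws3)
  then show ?thesis
    using laws(17)[OF one one one] laws1(5) by (simp add: class_M_def)
qed

lemma axioms_if_class_M:
  assumes A: "A \<in> class_M"
  shows "A \<Turnstile> set M_axioms"
proof -
  interpret anti_idempotent_de_morgan_monoid A
    using A by (simp add: class_M_def)
  note closed [simp] = wedge_closed vee_closed neg_closed
  have neg_antimono: "\<sim>\<^bsub>A\<^esub> x \<preceq>\<^bsub>A\<^esub> \<sim>\<^bsub>A\<^esub> y \<longleftrightarrow> y \<preceq>\<^bsub>A\<^esub> x" if "x \<in> carrier A" "y \<in> carrier A" for x y
    using that by (rule neg_below_neg_iff)
  have eqI: "x = y" if "\<And>z. z \<in> carrier A \<Longrightarrow> x \<preceq>\<^bsub>A\<^esub> z \<longleftrightarrow> y \<preceq>\<^bsub>A\<^esub> z" "x \<in> carrier A" "y \<in> carrier A" for x y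
    using that below_refl below_antisym by blast
  have neg_vee: "\<sim>\<^bsub>A\<^esub> (x \<curlyvee>\<^bsub>A\<^esub> y) = \<sim>\<^bsub>A\<^esub> x \<curlywedge>\<^bsub>A\<^esub> \<sim>\<^bsub>A\<^esub> y" if "x \<in> carrier A" "y \<in> carrier A" for x y
  proof (rule below_antisym)
    have "\<sim>\<^bsub>A\<^esub> (\<sim>\<^bsub>A\<^esub> (\<sim>\<^bsub>A\<^esub> x \<curlywedge>\<^bsub>A\<^esub> \<sim>\<^bsub>A\<^esub> y)) \<preceq>\<^bsub>A\<^esub> \<sim>\<^bsub>A\<^esub> x"
      "\<sim>\<^bsub>A\<^esub> (\<sim>\<^bsub>A\<^esub> (\<sim>\<^bsub>A\<^esub> x \<curlywedge>\<^bsub>A\<^esub> \<sim>\<^bsub>A\<^esub> y)) \<preceq>\<^bsub>A\<^esub> \<sim>\<^bsub>A\<^esub> y"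
      using that by (simp_all add: neg_neg wedge_below)
    then have "x \<curlyvee>\<^bsub>A\<^esub> y \<preceq>\<^bsub>A\<^esub> \<sim>\<^bsub>A\<^esub> (\<sim>\<^bsub>A\<^esub> x \<curlywedge>\<^bsub>A\<^esub> \<sim>\<^bsub>A\<^esub> y)"
      using that by (simp only: neg_antimono vee_below_iff closed)
    then show "\<sim>\<^bsub>A\<^esub> x \<curlywedge>\<^bsub>A\<^esub> \<sim>\<^bsub>A\<^esub> y \<preceq>\<^bsub>A\<^esub> \<sim>\<^bsub>A\<^esub> (x \<curlyvee>\<^bsub>A\<^esub> y)"
      using neg_antimono[of "\<sim>\<^bsub>A\<^esub> (\<sim>\<^bsub>A\<^esub> x \<curlywedge>\<^bsub>A\<^esub> \<sim>\<^bsub>A\<^esub> y)" "x \<curlyvee>\<^bsub>A\<^esub> y"] that by (simp add: neg_neg)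
  qed (use that in \<open>simp_all add: below_wedge_iff neg_antimono below_vee\<close>)
  \<comment> \<open>Residuation in the form of an adjunction: a left adjoint preserves joins, which
    is the next fact.\<close>
  have mult_below_iff: "x \<otimes>\<^bsub>A\<^esub> y \<preceq>\<^bsub>A\<^esub> z \<longleftrightarrow> y \<preceq>\<^bsub>A\<^esub> \<sim>\<^bsub>A\<^esub> (\<sim>\<^bsub>A\<^esub> z \<otimes>\<^bsub>A\<^esub> x)"
    if "x \<in> carrier A" "y \<in> carrier A" "z \<in> carrier A" for x y z
    using that neg_residuation[of y x z] neg_antimono[of "\<sim>\<^bsub>A\<^esub> z \<otimes>\<^bsub>A\<^esub> x" "\<sim>\<^bsub>A\<^esub> y"]
      neg_antimono[of "\<sim>\<^bsub>A\<^esub> (\<sim>\<^bsub>A\<^esub> z \<otimes>\<^bsub>A\<^esub> x)" "y"] by (simp add: m_comm[of x y] neg_neg)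
  have mult_vee: "x \<otimes>\<^bsub>A\<^esub> (y \<curlyvee>\<^bsub>A\<^esub> z) = x \<otimes>\<^bsub>A\<^esub> y \<curlyvee>\<^bsub>A\<^esub> x \<otimes>\<^bsub>A\<^esub> z"
    if "x \<in> carrier A" "y \<in> carrier A" "z \<in> carrier A" for x y z
    by (rule eqI) (use that in \<open>simp_all add: mult_below_iff vee_below_iff\<close>)
  have f: "\<f>\<^bsub>A\<^esub> = \<sim>\<^bsub>A\<^esub> \<one>\<^bsub>A\<^esub>" by (simp add: irl_f_def)
  have M: "\<one>\<^bsub>A\<^esub> \<preceq>\<^bsub>A\<^esub> \<f>\<^bsub>A\<^esub>"
    "\<And>x. x \<in> carrier A \<Longrightarrow> ((\<f>\<^bsub>A\<^esub> \<leadsto>\<^bsub>A\<^esub> x) \<curlyvee>\<^bsub>A\<^esub> (x \<leadsto>\<^bsub>A\<^esub> \<one>\<^bsub>A\<^esub>)) \<leadsto>\<^bsub>A\<^esub> \<o>\<^bsub>A\<^esub> = \<o>\<^bsub>A\<^esub>"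
    using A by (simp_all add: class_M_def)
  have anti: "x \<preceq>\<^bsub>A\<^esub> \<f>\<^bsub>A\<^esub> \<otimes>\<^bsub>A\<^esub> \<f>\<^bsub>A\<^esub>" if "x \<in> carrier A" for x
    using that by (rule anti_idempotent)
  have "eval_trm A v p = eval_trm A v q" if v: "range v \<subseteq> carrier A" and "(p, q) \<in> set M_axioms" for v p q
  proof -
    have [simp]: "v n \<in> carrier A" for n using v by auto
    have res: "\<sim>\<^bsub>A\<^esub> (v 0 \<otimes>\<^bsub>A\<^esub> v 1) \<otimes>\<^bsub>A\<^esub> v 1 \<preceq>\<^bsub>A\<^esub> \<sim>\<^bsub>A\<^esub> v 0"
      using neg_residuation[of "v 0" "v 1" "v 0 \<otimes>\<^bsub>A\<^esub> v 1"] by (simp add: below_refl)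
    have comm: "v 0 \<otimes>\<^bsub>A\<^esub> v (Suc 0) = v (Suc 0) \<otimes>\<^bsub>A\<^esub> v 0" "v 0 \<curlywedge>\<^bsub>A\<^esub> v (Suc 0) = v (Suc 0) \<curlywedge>\<^bsub>A\<^esub> v 0"
      "v 0 \<curlyvee>\<^bsub>A\<^esub> v (Suc 0) = v (Suc 0) \<curlyvee>\<^bsub>A\<^esub> v 0"
      by (simp_all add: m_comm wedge_commute vee_commute)
    have "\<sim>\<^bsub>A\<^esub> ((\<sim>\<^bsub>A\<^esub> (\<sim>\<^bsub>A\<^esub> \<one>\<^bsub>A\<^esub> \<otimes>\<^bsub>A\<^esub> \<sim>\<^bsub>A\<^esub> v 0) \<curlyvee>\<^bsub>A\<^esub> \<sim>\<^bsub>A\<^esub> (v 0 \<otimes>\<^bsub>A\<^esub> \<sim>\<^bsub>A\<^esub> \<one>\<^bsub>A\<^esub>)) \<otimes>\<^bsub>A\<^esub>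
        (\<sim>\<^bsub>A\<^esub> \<one>\<^bsub>A\<^esub> \<otimes>\<^bsub>A\<^esub> \<sim>\<^bsub>A\<^esub> \<one>\<^bsub>A\<^esub>)) = \<sim>\<^bsub>A\<^esub> (\<sim>\<^bsub>A\<^esub> \<one>\<^bsub>A\<^esub> \<otimes>\<^bsub>A\<^esub> \<sim>\<^bsub>A\<^esub> \<one>\<^bsub>A\<^esub>)"
      using M(2)[of "v 0"] by (simp add: irl_imp_def irl_zero_def f neg_neg)
    note eqs = this m_assoc wedge_assoc vee_assoc wedge_absorb vee_absorb wedge_vee_distrib neg_neg neg_vee mult_vee
      res[unfolded below_def] square_increasing[unfolded below_def] anti[unfolded below_def f]
      M(1)[unfolded below_def f]
    from that(2) show ?thesis
      unfolding M_axioms_def Let_def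
      by (auto simp only: list.set insert_iff empty_iff prod.inject) ((simp add: eqs[simplified]; fail) | (simp add: comm; fail))+
  qed
  then show ?thesis by (auto simp: satisfies_def)
qed

lemma class_M_eq: "class_M = models (set M_axioms)"
  using class_M_if_axioms axioms_if_class_M irl_algebra_class_M by (auto simp: models_def)

section \<open>Separating equations\<close>

text \<open>C4 is the subalgebra {0, e, e', 1} of every skew reflection with e in I.\<close>

lemma (in skew_dunn) valid_S_C4: "valid S \<subseteq> valid C4"
proof (rule satisfies_if_inj_hom)
  let ?\<phi> = "case_c4 Lo (Base \<one>) (Copy \<one>) Hi"
  show "irl_algebra C4" by (simp add: irl_algebra_def)
  show "inj_on ?\<phi> (carrier C4)" by (auto simp: inj_on_def split: c4.splits)
  show "?\<phi> ` carrier C4 \<subseteq> carrier S" by (auto split: c4.splits)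
  show "?\<phi> (\<sim>\<^bsub>C4\<^esub> x) = \<sim>\<^bsub>S\<^esub> ?\<phi> x" for x by (cases x) simp_all
  have [simp]: "?\<phi> x \<in> skew_carrier B" for x by (cases x) simp_all
  have h: "\<one> \<curlywedge> h \<one> = \<one>"
    using mult_in_I_iff[of \<one> \<one>] one_in_I by (simp add: below_def)
  show "?\<phi> (x \<otimes>\<^bsub>C4\<^esub> y) = ?\<phi> x \<otimes>\<^bsub>S\<^esub> ?\<phi> y \<and> ?\<phi> (x \<curlywedge>\<^bsub>C4\<^esub> y) = ?\<phi> x \<curlywedge>\<^bsub>S\<^esub> ?\<phi> y \<and>
      ?\<phi> (x \<curlyvee>\<^bsub>C4\<^esub> y) = ?\<phi> x \<curlyvee>\<^bsub>S\<^esub> ?\<phi> y" for x y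
    by (simp add: wedge_S vee_S skew_sup_def C4_lattice, cases x; cases y)
      (simp_all add: c4_order_def c4_mult_def h one_imp wedge_idem vee_idem)
qed simp

text \<open>An executable twin of \<open>skew_mult\<close>: the lattice operations and residuals of
  \<open>dunn_on\<close> are given by choice and description, so the separating equations are
  evaluated on explicit tables.\<close>

fun tab_mult :: "delt set \<Rightarrow> delt skew \<Rightarrow> delt skew \<Rightarrow> delt skew" where
  "tab_mult D Lo _ = Lo"
| "tab_mult D _ Lo = Lo"
| "tab_mult D Hi _ = Hi"
| "tab_mult D _ Hi = Hi"
| "tab_mult D (Base b) (Base c) = Base (delt_mult b c)"
| "tab_mult D (Base b) (Copy c) = Copy (delt_imp D b c)"
| "tab_mult D (Copy b) (Base c) = Copy (delt_imp D c b)"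
| "tab_mult D (Copy b) (Copy c) = Hi"

fun tab_inf :: "(delt \<Rightarrow> delt) \<Rightarrow> delt skew \<Rightarrow> delt skew \<Rightarrow> delt skew" where
  "tab_inf h Lo _ = Lo"
| "tab_inf h _ Lo = Lo"
| "tab_inf h Hi x = x"
| "tab_inf h x Hi = x"
| "tab_inf h (Base b) (Base c) = Base (delt_inf b c)"
| "tab_inf h (Copy b) (Copy c) = Copy (delt_sup b c)"
| "tab_inf h (Base b) (Copy c) = Base (delt_inf b (h c))"
| "tab_inf h (Copy c) (Base b) = Base (delt_inf b (h c))"

definition tab :: "delt set \<Rightarrow> (delt \<Rightarrow> delt) \<Rightarrow> delt skew irl"
  where "tab D h = \<lparr>carrier = Base ` D \<union> Copy ` D \<union> {Lo, Hi}, mult = tab_mult D, one = Base De,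
    wedge = tab_inf h, vee = (\<lambda>x y. skew_neg (tab_inf h (skew_neg x) (skew_neg y))), neg = skew_neg\<rparr>"

lemma eval_tab:
  assumes D: "D \<in> delt_carriers" and "skew_dunn (dunn_on D) I h"
    and v: "range v \<subseteq> carrier (skew_reflection I (dunn_on D))"
  shows "eval_trm (skew_reflection I (dunn_on D)) v p = eval_trm (tab D h) v p"
proof -
  interpret skew_dunn "dunn_on D" I h by fact
  have mult: "skew_mult (dunn_on D) x y = tab_mult D x y"
    if "x \<in> skew_carrier (dunn_on D)" "y \<in> skew_carrier (dunn_on D)" for x y
    using that by (cases x; cases y) (simp_all add: dunn_on_ops[OF D])
  have inf: "skew_inf x y = tab_inf h x y"
    if "x \<in> skew_carrier (dunn_on D)" "y \<in> skew_carrier (dunn_on D)" for x y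
    using that h_closed by (cases x; cases y) (simp_all add: dunn_on_ops[OF D])
  have v: "De \<in> D" "v n \<in> skew_carrier (dunn_on D)" for n using v one_closed by auto
  have "eval_trm S v p \<in> skew_carrier (dunn_on D) \<and> eval_trm S v p = eval_trm (tab D h) v p"
    by (induction p) (use v in \<open>auto simp: tab_def mult inf wedge_S vee_S skew_sup_def
      simp flip: mult inf skew_sup_def\<close>)
  then show ?thesis by blast
qed

text \<open>The equation with index \<open>j\<close> (counted from \<open>0\<close>) fails in the \<open>(j + 1)\<close>-st of the six algebras only.\<close>

definition separators :: "(trm \<times> trm) list"
  where "separators =
   (let x = Var 0; f = TNeg TOne
    in [(TMult (TNeg x) (TNeg (TMult x f)), TMult f (TNeg (TMult x f))),
        (TMult f (TWedge x (TWedge TOne (TNeg x))), TMult f (TWedge TOne (TMult x (TNeg x)))),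
        (TMult (TNeg x) f, TMult f (TNeg (TVee x TOne))),
        (TMult x (TNeg (TMult f (TWedge x (TNeg x)))), TMult x (TNeg (TMult f (TWedge (TNeg x) (TMult x x))))),
        (TWedge x (TMult f (TWedge x f)), TWedge x (TMult (TWedge x f) (TWedge x f))),
        (TMult x (TNeg (TMult x (TWedge TOne (TNeg (TMult x x))))),
         TMult x (TMult x (TNeg (TMult x (TWedge TOne (TNeg x))))))])"

definition separator_holds :: "delt skew irl \<Rightarrow> bool list"
  where "separator_holds T =
    map (\<lambda>(p, q). \<forall>x\<in>carrier T. eval_trm T (\<lambda>_. x) p = eval_trm T (\<lambda>_. x) q) separators"

lemma separator_holds_tab:
  "separator_holds (tab {Dbot, De} (\<lambda>_. De)) = [False, True, True, True, True, True]"
  "separator_holds (tab {Dbot, De, Dtop} (\<lambda>_. Dtop)) = [True, False, True, True, True, True]"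
  "separator_holds (tab {Dbot, De, Dtop} (delt_h {Dbot, De, Dtop})) = [True, True, False, True, True, True]"
  "separator_holds (tab {Dbot, De, Da, Dtop} (delt_h {Dbot, De, Da, Dtop})) = [True, True, True, False, True, True]"
  "separator_holds (tab {Dbot, De, Ds, Dt, Dtop} (delt_h {Dbot, De, Ds, Dt, Dtop})) =
    [True, True, True, True, False, True]"
  "separator_holds (tab {Dbot, De, Ds, Dt, Du, Dtop} (delt_h {Dbot, De, Ds, Dt, Du, Dtop})) =
    [True, True, True, True, True, False]"
  by code_simp+

lemma separator_valid_iff:
  assumes "D \<in> delt_carriers" "skew_dunn (dunn_on D) I h" "j < length separators"
  shows "separators ! j \<in> valid (skew_reflection I (dunn_on D)) \<longleftrightarrow> separator_holds (tab D h) ! j"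
proof -
  interpret skew_dunn "dunn_on D" I h by fact
  obtain p q where pq: "separators ! j = (p, q)" by fastforce
  have mem: "(p, q) \<in> set separators" using pq assms(3) nth_mem by metis
  \<comment> \<open>\<open>Var 0\<close> is the only variable, so validity amounts to a check over
    the finite carrier with constant assignments.\<close>
  have "\<forall>(p, q)\<in>set separators. \<forall>v. eval_trm S v p = eval_trm S (\<lambda>_. v 0) p \<and> eval_trm S v q = eval_trm S (\<lambda>_. v 0) q"
    by (simp add: separators_def Let_def)
  from bspec[OF this mem]
  have var: "eval_trm S v p = eval_trm S (\<lambda>_. v 0) p" "eval_trm S v q = eval_trm S (\<lambda>_. v 0) q" for v
    by blast+
  have carrier: "carrier (tab D h) = carrier S" by (auto simp: tab_def skew_carrier_def)
  have "(p, q) \<in> valid S \<longleftrightarrow> (\<forall>v. range v \<subseteq> carrier S \<longrightarrow> eval_trm S v p = eval_trm S v q)"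
    by (simp add: valid_def satisfies_def)
  also have "\<dots> \<longleftrightarrow> (\<forall>x\<in>carrier S. eval_trm S (\<lambda>_. x) p = eval_trm S (\<lambda>_. x) q)"
  proof (intro iffI allI ballI impI)
    fix x assume *: "\<forall>v. range v \<subseteq> carrier S \<longrightarrow> eval_trm S v p = eval_trm S v q" "x \<in> carrier S"
    show "eval_trm S (\<lambda>_. x) p = eval_trm S (\<lambda>_. x) q"
      using *(2) by (intro *(1)[rule_format]) auto
  next
    fix v :: "nat \<Rightarrow> _"
    assume *: "\<forall>x\<in>carrier S. eval_trm S (\<lambda>_. x) p = eval_trm S (\<lambda>_. x) q" "range v \<subseteq> carrier S"
    show "eval_trm S v p = eval_trm S v q"
      unfolding var[of v] by (rule *(1)[rule_format]) (use *(2) in blast)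
  qed
  also have "\<dots> \<longleftrightarrow> separator_holds (tab D h) ! j"
    using assms(3) eval_tab[OF assms(1,2)]
    by (simp add: separator_holds_def pq carrier image_subset_iff del: S_simps)
  finally show ?thesis by (simp add: pq)
qed

section \<open>The six varieties are exactly the covers\<close>

definition Gs :: "delt skew irl list"
  where "Gs = [G1, G2, G3, G4, G5, G6]"

lemma separators_Gs:
  assumes "i < 6" "j < 6"
  shows "separators ! j \<in> valid (Gs ! i) \<longleftrightarrow> i \<noteq> j"
proof -
  have len: "length separators = 6" by (simp add: separators_def Let_def)
  note iff = separator_valid_iff[OF _ skew_dunn_G1[unfolded two_plus_def]]
    separator_valid_iff[OF _ skew_dunn_G2[unfolded S3_plus_def]]
    separator_valid_iff[OF _ skew_dunn_G3[unfolded S3_plus_def]]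
    separator_valid_iff[OF _ skew_dunn_G4[unfolded C4_plus_def]]
    separator_valid_iff[OF _ skew_dunn_G5[unfolded T5_def]]
    separator_valid_iff[OF _ skew_dunn_G6[unfolded T6_def]]
  have "i \<in> {0, 1, 2, 3, 4, 5}" "j \<in> {0, 1, 2, 3, 4, 5}" using assms by auto
  then show ?thesis
    by (elim insertE emptyE)
      (simp_all add: Gs_def G_eqs[unfolded two_plus_def S3_plus_def C4_plus_def T5_def T6_def]
        iff delt_carriers_def len separator_holds_tab)
qed

lemma Gs_props:
  assumes "G \<in> set Gs"
  shows "G \<in> class_M" "irl_algebra G" "finite (carrier G)" "valid G \<subseteq> valid C4"
proof -
  show M: "G \<in> class_M" using G_in_class_M assms by (simp add: Gs_def)
  then show "irl_algebra G" by (rule irl_algebra_class_M)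
  have fin: "finite (carrier (skew_reflection I (dunn_on D)))" if "finite D" for D I
    using that by (simp add: skew_reflection_def skew_carrier_def)
  show "finite (carrier G)"
    using assms fin by (auto simp: Gs_def G_eqs two_plus_def S3_plus_def C4_plus_def T5_def T6_def)
  show "valid G \<subseteq> valid C4"
    using assms skew_dunn_G[THEN skew_dunn.valid_S_C4] by (auto simp: Gs_def G_eqs)
qed

text \<open>A cover includes some member of \<open>W\<close>, and with nothing strictly between it
  equals that member. Conversely, something strictly between \<open>a\<close> and \<open>w\<close>
  would include a member of \<open>W\<close> properly inside \<open>w\<close>.\<close>

lemma covers_in_eqI:
  assumes "a \<in> L" "W \<subseteq> L" "\<And>w. w \<in> W \<Longrightarrow> a \<subset> w"
    and above: "\<And>k. \<lbrakk>k \<in> L; a \<subset> k\<rbrakk> \<Longrightarrow> \<exists>w\<in>W. w \<subseteq> k"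
    and antichain: "\<And>v w. \<lbrakk>v \<in> W; w \<in> W; v \<subseteq> w\<rbrakk> \<Longrightarrow> v = w"
  shows "covers_in L a = W"
proof (intro equalityI subsetI)
  fix k assume "k \<in> covers_in L a"
  then have k: "k \<in> L" "a \<subset> k" "\<not> (\<exists>c\<in>L. a \<subset> c \<and> c \<subset> k)" by (simp_all add: covers_in_def)
  obtain w where w: "w \<in> W" "w \<subseteq> k" using above[OF k(1,2)] ..
  have "\<not> w \<subset> k" using k(3) w(1) assms(2,3) by blast
  then show "k \<in> W" using w by blast
next
  fix w assume w: "w \<in> W"
  have False if c: "c \<in> L" "a \<subset> c" "c \<subset> w" for c
  proof -
    obtain v where "v \<in> W" "v \<subseteq> c" using above[OF c(1,2)] ..
    then show False using antichain[OF _ w, of v] c(3) by blast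
  qed
  then show "w \<in> covers_in L a" using w assms(1-3) by (auto simp: covers_in_def)
qed

theorem theorem8p10:
  assumes "infinite (UNIV :: 'u set)"
  shows "covers_in (subvarieties (class_M :: 'u irl set)) (\<V> C4) =
    {\<V> G1, \<V> G2, \<V> G3, \<V> G4, \<V> G5, \<V> G6}"
proof -
  let ?L = "subvarieties (class_M :: 'u irl set)" and ?a = "\<V> C4 :: 'u irl set"
  let ?V = "\<lambda>G. \<V> G :: 'u irl set"
  have variety: "variety (\<V> A :: 'u irl set)" for A :: "'x irl"
    unfolding variety_def variety_generated_eq by blast
  have le_iff: "?V G \<subseteq> ?V H \<longleftrightarrow> valid H \<subseteq> valid G" if "G \<in> set Gs" for G H
    using variety_generated_le_iff[OF Gs_props(2,3)[OF that] assms] .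
  have len: "length Gs = 6" by (simp add: Gs_def)
  have antichain: "G = H" if GH: "G \<in> set Gs" "H \<in> set Gs" "?V G \<subseteq> ?V H" for G H
  proof -
    obtain i j where "i < 6" "G = Gs ! i" "j < 6" "H = Gs ! j"
      using GH(1,2) in_set_conv_nth[of G Gs] in_set_conv_nth[of H Gs] len by metis
    then show ?thesis using GH le_iff[OF GH(1)] separators_Gs by blast
  qed
  have a_le: "?a \<subseteq> ?V G" if "G \<in> set Gs" for G
    using Gs_props(4)[OF that] by (simp add: variety_generated_eq models_antimono)
  have in_L: "?V G \<in> ?L" if "G \<in> set Gs" for G
    using axioms_if_class_M[OF Gs_props(1)[OF that]] variety
    by (auto simp: subvarieties_def class_M_eq satisfies_iff variety_generated_eq
        intro: models_antimono[THEN subsetD])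
  have a_less: "?a \<subset> ?V G" if G: "G \<in> set Gs" for G
  proof -
    have "?V G \<noteq> ?a"
    proof
      assume *: "?V G = ?a"
      \<comment> \<open>\<open>?a\<close> lies below all six varieties, so equality with one of them
        would collapse the antichain.\<close>
      have "G = H" if "H \<in> set Gs" for H
        using antichain[OF G that] a_le[OF that] * by simp
      then have "Gs ! 0 = Gs ! 1" using nth_mem[of 0 Gs] nth_mem[of 1 Gs] len by (metis one_less_numeral_iff semiring_norm(76) zero_less_numeral)
      then show False using separators_Gs[of 0 0] separators_Gs[of 1 0] by simp
    qed
    then show ?thesis using a_le[OF G] by blast
  qed
  have a_in_L: "?a \<in> ?L"
    using a_le[of G1] in_L[of G1] variety by (auto simp: subvarieties_def Gs_def)
  have above: "\<exists>G\<in>set Gs. ?V G \<subseteq> K" if K: "K \<in> ?L" "?a \<subset> K" for K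
  proof -
    obtain A \<Sigma> where A: "A \<in> K" "A \<notin> ?a" "K = models \<Sigma>" "K \<subseteq> class_M"
      using K by (auto simp: subvarieties_def variety_def)
    then have "\<not> A \<Turnstile> valid C4" and \<Sigma>: "A \<Turnstile> \<Sigma>" by (auto simp: variety_generated_eq models_def)
    then have "\<not> valid C4 \<subseteq> valid A" by (simp add: satisfies_iff)
    then obtain p q where "C4 \<Turnstile> {(p, q)}" "\<not> A \<Turnstile> {(p, q)}"
      unfolding valid_def by blast
    then obtain G where G: "G \<in> set Gs" "\<forall>\<Sigma>. A \<Turnstile> \<Sigma> \<longrightarrow> G \<Turnstile> \<Sigma>"
      using G_satisfies[of A p q] A by (auto simp: Gs_def)
    \<comment> \<open>\<open>G\<close> and the members of \<open>K\<close> have different carrier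
      types, so the inclusion is read off from the axioms \<Sigma> of \<open>K\<close> rather than
      from membership of \<open>G\<close>.\<close>
    then have "\<Sigma> \<subseteq> valid G" using \<Sigma> by (simp flip: satisfies_iff)
    then have "?V G \<subseteq> K" unfolding A(3) variety_generated_eq by (rule models_antimono)
    then show ?thesis using G(1) by blast
  qed
  have "covers_in ?L ?a = ?V ` set Gs"
  proof (rule covers_in_eqI)
    show "?a \<in> ?L" by (rule a_in_L)
    show "?V ` set Gs \<subseteq> ?L" by (rule image_subsetI) (rule in_L)
    show "?a \<subset> w" if "w \<in> ?V ` set Gs" for w using that by (rule imageE) (simp only: a_less)
    show "\<exists>w\<in>?V ` set Gs. w \<subseteq> K" if "K \<in> ?L" "?a \<subset> K" for K
      unfolding bex_simps by (rule above[OF that])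
    show "v = w" if "v \<in> ?V ` set Gs" "w \<in> ?V ` set Gs" "v \<subseteq> w" for v w
      using that antichain by blast
  qed
  then show ?thesis by (simp add: Gs_def)
qed

end
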